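(* Let $\Omega=(0,1)\times B_1(0)\subset\mathbb{R}^3$, where $B_1(0)\subset\mathbb{R}^2$ is the unit disc, let $K_1=\{\operatorname{diag}(0,0,0),\operatorname{diag}(1,0,0)\}$, $p\in[1,+\infty)$, and $F=\operatorname{diag}(\frac12,0,0)$. Then there exists a constant $C>0$ such that for every $\epsilon\in(0,1)$ $$E^{(p)}_{\epsilon,2}(\mathcal{A}_F^{\rm dir})\le C\,\epsilon^{2p/(2p+1)},$$ where $E^{(p)}_{\epsilon,2}(\mathcal{A}_F^{\rm dir})$ is the minimal singularly perturbed energy on $\Omega$ for the wells $K_1$ with Dirichlet datum $F$ (defined in the context).
   Context: $\operatorname{sym}(M)=\frac12(M+M^T)$. Let $K=\{A_0,\dots,A_m\}\subset\mathbb{R}^{d\times d}_{\rm sym}$ be a set of $m+1$ matrices (wells), here $d=3$, $m=1$. A function $\chi:\Omega\to K$ is written $\chi=\sum_{j=0}^m\chi_jA_j$ with $\chi_j:\Omega\to\{0,1\}$, $\sum_{j=0}^m\chi_j=1$. Define $$E^{(p)}_{\epsilon,m+1}(u;\chi)=\int_\Omega|\operatorname{sym}(\nabla u)-\chi|^p\,dx+\epsilon\sum_{j=1}^m\|D\chi_j\|_{TV(\Omega)}.$$ For $F\in\mathbb{R}^{d\times d}_{\rm sym}$ let $$\mathcal{A}_F^{\rm dir}=\{u\in W^{1,p}_{\rm loc}(\mathbb{R}^d;\mathbb{R}^d): u(x)=Fx+b\text{ in }\mathbb{R}^d\setminus\Omega\text{ for some }b\in\mathbb{R}^d\},$$ $$E^{(p)}_{\epsilon,m+1}(\mathcal{A}_F^{\rm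 dir})=\inf_{\chi\in BV(\Omega;K)}\ \inf_{u\in\mathcal{A}_F^{\rm dir}}E^{(p)}_{\epsilon,m+1}(u;\chi).$$ *)

theory Defs
  imports "HOL-Analysis.Analysis"
begin

section \<open>Test functions\<close>

definition partial_deriv :: "'n::finite \<Rightarrow> (real^'n \<Rightarrow> 'b::real_normed_vector) \<Rightarrow> real^'n \<Rightarrow> 'b"
  where "partial_deriv j \<phi> x = frechet_derivative \<phi> (at x) (axis j 1)"

text \<open>The space \<open>C\<^sup>1\<^sub>c(\<Omega>)\<close>; its elements are extended by zero to the whole space.\<close>

definition C1c :: "(real^'n::finite) set \<Rightarrow> (real^'n \<Rightarrow> 'b::real_normed_vector) set"
  where "C1c \<Omega> = {\<phi>. (\<forall>x. \<phi> differentiable (at x)) \<and>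
                     (\<forall>j. continuous_on UNIV (partial_deriv j \<phi>)) \<and>
                     compact (closure {x. \<phi> x \<noteq> 0}) \<and> closure {x. \<phi> x \<noteq> 0} \<subseteq> \<Omega>}"

definition divergence :: "(real^'n::finite \<Rightarrow> real^'n) \<Rightarrow> real^'n \<Rightarrow> real"
  where "divergence \<phi> x = (\<Sum>j\<in>UNIV. partial_deriv j \<phi> x $ j)"


section \<open>Local Sobolev spaces on the whole space\<close>

definition Lp_loc :: "real \<Rightarrow> (real^'n::finite \<Rightarrow> 'b::euclidean_space) set"
  where "Lp_loc p = {f. f \<in> borel_measurable lebesgue \<and>
                       (\<forall>S. compact S \<longrightarrow> set_integrable lebesgue S (\<lambda>x. norm (f x) powr p))}"

text \<open>Row \<open>i\<close>, column \<open>j\<close> of the gradient is \<open>\<partial>\<^sub>j u\<^sub>i\<close>. As in Evans--Gariepy, weak derivatives are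
  tested against \<open>C\<^sup>1\<^sub>c\<close> functions, which is the same as testing against smooth ones.\<close>

definition has_weak_gradient ::
    "(real^'n::finite \<Rightarrow> real^'n) \<Rightarrow> (real^'n \<Rightarrow> real^'n^'n) \<Rightarrow> bool"
  where "has_weak_gradient u G \<longleftrightarrow> u \<in> Lp_loc 1 \<and> G \<in> Lp_loc 1 \<and>
    (\<forall>\<phi>\<in>C1c UNIV. \<forall>i j.
       (LINT x|lebesgue. u x $ i * partial_deriv j \<phi> x) = - (LINT x|lebesgue. G x $ i $ j * \<phi> x))"

text \<open>A weak gradient is determined up to a null set, and the choice of the representative is
  irrelevant below.\<close>

definition weak_gradient :: "(real^'n::finite \<Rightarrow> real^'n) \<Rightarrow> real^'n \<Rightarrow> real^'n^'n"
  where "weak_gradient u = (SOME G. has_weak_gradient u G)"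

definition W1p_loc :: "real \<Rightarrow> (real^'n::finite \<Rightarrow> real^'n) set"
  where "W1p_loc p = {u. u \<in> Lp_loc p \<and> (\<exists>G. has_weak_gradient u G) \<and> weak_gradient u \<in> Lp_loc p}"


section \<open>Functions of bounded variation\<close>

text \<open>The total variation \<open>\<parallel>Df\<parallel>\<close> of the distributional gradient of \<open>f\<close> on the open set \<open>\<Omega>\<close>.
  \<^const>\<open>ennreal\<close> truncates negative values, which does not affect the supremum since \<open>\<phi> = 0\<close> is
  admissible.\<close>

definition total_variation :: "(real^'n::finite) set \<Rightarrow> (real^'n \<Rightarrow> real) \<Rightarrow> ennreal"
  where "total_variation \<Omega> f =
    (SUP \<phi> \<in> {\<phi> \<in> C1c \<Omega>. \<forall>x. norm (\<phi> x) \<le> 1}. ennreal (LINT x:\<Omega>|lebesgue. f x * divergence \<phi> x))"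

definition BV :: "(real^'n::finite) set \<Rightarrow> (real^'n \<Rightarrow> real) set"
  where "BV \<Omega> = {f. set_integrable lebesgue \<Omega> f \<and> total_variation \<Omega> f < \<infinity>}"

text \<open>\<open>BV(\<Omega>; K)\<close>: the values outside \<open>\<Omega>\<close> are irrelevant.\<close>

definition BV_into :: "(real^'n::finite) set \<Rightarrow> (real^'n^'n) set \<Rightarrow> (real^'n \<Rightarrow> real^'n^'n) set"
  where "BV_into \<Omega> K = {X. (\<forall>i j. (\<lambda>x. X x $ i $ j) \<in> BV \<Omega>) \<and> (\<forall>x\<in>\<Omega>. X x \<in> K)}"


section \<open>The singularly perturbed energy\<close>

text \<open>The wells are enumerated as \<open>A 0, \<dots>, A m\<close> and are pairwise distinct, so that
  \<open>\<chi> = (\<Sum>j\<le>m. \<chi>\<^sub>j A\<^sub>j)\<close> with \<open>\<chi>\<^sub>j \<in> {0, 1}\<close> and \<open>(\<Sum>j\<le>m. \<chi>\<^sub>j) = 1\<close> forces \<open>\<chi>\<^sub>j\<close> to be the indicator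
  of \<open>{\<chi> = A\<^sub>j}\<close>.\<close>

definition phase :: "(nat \<Rightarrow> real^'n::finite^'n) \<Rightarrow> (real^'n \<Rightarrow> real^'n^'n) \<Rightarrow> nat \<Rightarrow> real^'n \<Rightarrow> real"
  where "phase A X j x = (if X x = A j then 1 else 0)"

lemma phase_decomposition:
  assumes "inj_on A {..m}" and "X x \<in> A ` {..m}"
  shows "(\<Sum>j\<le>m. phase A X j x) = 1" and "X x = (\<Sum>j\<le>m. phase A X j x *\<^sub>R A j)"
proof -
  obtain k where k: "k \<le> m" "X x = A k"
    using assms(2) by auto
  have ph: "phase A X j x = (if k = j then 1 else 0)" if "j \<in> {..m}" for j
    using assms(1) k that by (auto simp: phase_def inj_on_def)
  show "(\<Sum>j\<le>m. phase A X j x) = 1"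
    using k by (simp add: ph)
  have "(\<Sum>j\<le>m. phase A X j x *\<^sub>R A j) = (\<Sum>j\<le>m. if k = j then A j else 0)"
    by (rule sum.cong) (auto simp: ph)
  then show "X x = (\<Sum>j\<le>m. phase A X j x *\<^sub>R A j)"
    using k by simp
qed

definition sym_part :: "real^'n::finite^'n \<Rightarrow> real^'n^'n"
  where "sym_part M = (1/2) *\<^sub>R (M + transpose M)"

text \<open>The norm of \<^typ>\<open>real^'n^'n\<close> is the Frobenius norm.\<close>

definition energy ::
    "real \<Rightarrow> real \<Rightarrow> (real^'n::finite) set \<Rightarrow> nat \<Rightarrow> (nat \<Rightarrow> real^'n^'n) \<Rightarrow>
     (real^'n \<Rightarrow> real^'n) \<Rightarrow> (real^'n \<Rightarrow> real^'n^'n) \<Rightarrow> ennreal"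
  where "energy p \<epsilon> \<Omega> m A u X =
    (\<integral>\<^sup>+x\<in>\<Omega>. ennreal (norm (sym_part (weak_gradient u x) - X x) powr p) \<partial>lebesgue) +
    ennreal \<epsilon> * (\<Sum>j=1..m. total_variation \<Omega> (phase A X j))"

definition dirichlet_class ::
    "real \<Rightarrow> (real^'n::finite) set \<Rightarrow> real^'n^'n \<Rightarrow> (real^'n \<Rightarrow> real^'n) set"
  where "dirichlet_class p \<Omega> F =
    {u \<in> W1p_loc p. \<exists>b. AE x in lebesgue. x \<notin> \<Omega> \<longrightarrow> u x = F *v x + b}"

definition min_energy ::
    "real \<Rightarrow> real \<Rightarrow> (real^'n::finite) set \<Rightarrow> nat \<Rightarrow> (nat \<Rightarrow> real^'n^'n) \<Rightarrow> real^'n^'n \<Rightarrow> ennreal"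
  where "min_energy p \<epsilon> \<Omega> m A F =
    (INF X \<in> BV_into \<Omega> (A ` {..m}). INF u \<in> dirichlet_class p \<Omega> F. energy p \<epsilon> \<Omega> m A u X)"


section \<open>The cylinder and the two wells\<close>

definition diag :: "real^'n::finite \<Rightarrow> real^'n^'n"
  where "diag v = (\<chi> i j. if i = j then v $ i else 0)"

definition cylinder :: "(real^3) set"
  where "cylinder = {x. 0 < x $ 1 \<and> x $ 1 < 1 \<and> (vector [x $ 2, x $ 3] :: real^2) \<in> ball 0 1}"

definition wells :: "nat \<Rightarrow> real^3^3"
  where "wells j = (if j = 0 then diag (vector [0, 0, 0]) else diag (vector [1, 0, 0]))"

end

theory Submission
  imports Defs
begin

text \<open>
  The competitor is a branched laminate. Write \<open>q = x\<^sub>2\<^sup>2 + x\<^sub>3\<^sup>2\<close>. The first displacement component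
  is \<open>x\<^sub>1 / 2\<close> plus a triangle wave of period \<open>1 / (N 3\<^sup>j)\<close> in \<open>x\<^sub>1\<close> on the \<open>j\<close>-th of the shells
  \<open>1 - \<theta>\<^sup>j \<le> q \<le> 1 - \<theta>\<^sup>j\<^sup>+\<^sup>1\<close>, where \<open>\<theta> = \<rho> / 3\<close> and \<open>\<rho>\<^sup>2\<^sup>p = 1/3\<close>. Passing from one
  shell to the next, the tips of the wave beyond a level that decreases from \<open>1/4\<close> to \<open>1/12\<close> are
  reflected; this triples the frequency and keeps the slope \<open>\<plusminus>1\<close> and the mean 0. As the mean stays 0,
  the shear strains can be cancelled exactly by a radial displacement that vanishes on the boundary and
  whose strain is of order \<open>(h / l)\<^sup>2\<close> (\<open>h\<close> the period, \<open>l\<close> the width of the shell).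
  In the last shell, where \<open>h\<close> and \<open>l\<close> are comparable, the same mechanism with final level 0
  flattens the wave, at a bounded energy density. Both \<open>\<Sum>\<^sub>j l (h / l)\<^sup>2\<^sup>p\<close> and \<open>\<Sum>\<^sub>j l / h\<close> are
  geometric series of ratio \<open>\<rho>\<close>, so the energy is at most \<open>C (N\<^sup>-\<^sup>2\<^sup>p + \<epsilon> N)\<close>, and
  \<open>N\<close> of order \<open>\<epsilon>\<^sup>-\<^sup>1\<^sup>/\<^sup>(\<^sup>2\<^sup>p\<^sup>+\<^sup>1\<^sup>)\<close> balances the two terms.
\<close>

section \<open>Weak gradients and total variation\<close>

text \<open>The exponent \<open>2 * p / (2 * p + 1)\<close> is owed to the symmetrised gradient.
  Branching a scalar wave leaves a shear of order h / l and would only yield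
  \<open>p / (p + 1)\<close>. Here the radial displacement absorbs this shear, and its own strain
  gains a further factor h / l. Being an x_1-primitive of the q-derivative of the wave, it returns
  to 0 after a period only if that derivative has mean 0; reflection at two opposite levels ensures
  this by symmetry, and is why the frequency triples instead of doubling. The variable q is
  preferred to the radius because it is a polynomial, because its gradient (0, 2 x_2, 2 x_3) has the
  shape of the cancelling field, and because the area of an annulus is linear in q. With l of order
  \<theta>^j and \<rho> = 3 \<theta>, the elastic series has ratio (\<rho> / 3) \<rho>^(-2p) and the
  surface series has ratio \<rho>. Both converge for 3^(-1/(2p-1)) < \<rho> < 1; the value with
  \<rho>^(2p) = 1/3 makes the ratios equal. The energy refers to an unspecified weak gradient, which
  must be identified almost everywhere; the surface term is bounded through difference quotients of
  the phase.\<close>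

definition has_partial :: "'n::finite \<Rightarrow> (real^'n \<Rightarrow> real) \<Rightarrow> real \<Rightarrow> real^'n \<Rightarrow> bool"
  where "has_partial j f D x \<longleftrightarrow> ((\<lambda>t. f (x + t *\<^sub>R axis j 1)) has_real_derivative D) (at 0)"

definition locally_bounded :: "('a::real_normed_vector \<Rightarrow> real) \<Rightarrow> bool"
  where "locally_bounded f \<longleftrightarrow> (\<forall>R. \<exists>B. \<forall>x. norm x \<le> R \<longrightarrow> \<bar>f x\<bar> \<le> B)"

lemma has_partial_shift:
  assumes "has_partial j f D (x + s *\<^sub>R axis j 1)"
  shows "((\<lambda>t. f (x + t *\<^sub>R axis j 1)) has_real_derivative D) (at s)"
proof -
  have "((\<lambda>t. f (x + s *\<^sub>R axis j 1 + (t - s) *\<^sub>R axis j 1)) has_real_derivative D * 1) (at s)"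
    by (rule DERIV_chain2[where f="\<lambda>t. f (x + s *\<^sub>R axis j 1 + t *\<^sub>R axis j 1)" and g="\<lambda>t. t - s"])
      (use assms in \<open>auto simp: has_partial_def intro!: derivative_eq_intros\<close>)
  then show ?thesis
    by (simp add: algebra_simps)
qed

lemma lebesgue_distr_plus: "distr lebesgue lebesgue ((+) (c::'a::euclidean_space)) = lebesgue"
  using lebesgue_affine_euclidean[of "\<lambda>_. 1" c]
  by (simp add: euclidean_representation density_1)

lemma measurable_lebesgue_plus: "(+) (c::'a::euclidean_space) \<in> lebesgue \<rightarrow>\<^sub>M lebesgue"
  using lebesgue_affine_measurable[of "\<lambda>_. 1" c]
  by (simp add: euclidean_representation)

lemma measurable_shift:
  fixes c :: "'a::euclidean_space"
  assumes "f \<in> lebesgue \<rightarrow>\<^sub>M M"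
  shows "(\<lambda>x. f (x - c)) \<in> lebesgue \<rightarrow>\<^sub>M M" "(\<lambda>x. f (x + c)) \<in> lebesgue \<rightarrow>\<^sub>M M"
  using measurable_comp[OF measurable_lebesgue_plus[of "-c"] assms]
    measurable_comp[OF measurable_lebesgue_plus[of "c"] assms]
  by (simp_all add: comp_def algebra_simps)

lemma integral_lebesgue_shift:
  fixes f :: "'a::euclidean_space \<Rightarrow> real"
  assumes "f \<in> borel_measurable lebesgue"
  shows "(LINT x|lebesgue. f (x + c)) = (LINT x|lebesgue. f x)"
proof -
  have "(LINT x|lebesgue. f x) = (LINT x|distr lebesgue lebesgue ((+) c). f x)"
    by (simp add: lebesgue_distr_plus)
  also have "\<dots> = (LINT x|lebesgue. f (c + x))"
    by (rule integral_distr[OF measurable_lebesgue_plus assms])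
  finally show ?thesis
    by (simp add: add.commute)
qed

lemma integrable_bounded_support:
  fixes f :: "'a::euclidean_space \<Rightarrow> real"
  assumes "f \<in> borel_measurable lebesgue" and "\<And>x. norm x > R \<Longrightarrow> f x = 0" and "\<And>x. norm x \<le> R \<Longrightarrow> \<bar>f x\<bar> \<le> B"
  shows "integrable lebesgue f"
proof (rule Bochner_Integration.integrable_bound[where f="\<lambda>x. B * indicat_real (cball 0 R) x"])
  show "integrable lebesgue (\<lambda>x::'a. B * indicat_real (cball 0 R) x)"
    by (intro integrable_mult_right integrable_real_indicator)
      (auto simp: emeasure_lborel_cball_finite[unfolded infinity_ennreal_def])
  have "\<bar>f x\<bar> \<le> \<bar>B * indicat_real (cball 0 R) x\<bar>" for x
    using assms(2,3)[of x] by (cases "norm x \<le> R") (auto simp: indicator_def)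
  then show "AE x in lebesgue. norm (f x) \<le> norm (B * indicat_real (cball 0 R) x)"
    by simp
qed (use assms in auto)

lemma continuous_bounded_support_bounded:
  fixes f :: "'a::euclidean_space \<Rightarrow> real"
  assumes "continuous_on UNIV f" and "\<And>x. norm x > R \<Longrightarrow> f x = 0"
  obtains B where "B \<ge> 0" "\<And>x. \<bar>f x\<bar> \<le> B"
proof -
  have "bounded (f ` cball 0 R)"
    by (intro compact_imp_bounded compact_continuous_image)
      (auto intro: continuous_on_subset[OF assms(1)])
  then obtain B where "B > 0" and B: "\<forall>x\<in>cball 0 R. \<bar>f x\<bar> \<le> B"
    unfolding bounded_pos by auto
  have "\<bar>f x\<bar> \<le> B" for x
    using B \<open>B > 0\<close> assms(2)[of x] by (cases "norm x \<le> R") auto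
  then show ?thesis
    using that[of B] \<open>B > 0\<close> by auto
qed

lemma locally_boundedD:
  assumes "locally_bounded f"
  obtains B where "B \<ge> 0" "\<And>x. norm x \<le> R \<Longrightarrow> \<bar>f x\<bar> \<le> B"
proof -
  obtain B where "\<And>x. norm x \<le> R \<Longrightarrow> \<bar>f x\<bar> \<le> B"
    using assms unfolding locally_bounded_def by metis
  then have "\<bar>f x\<bar> \<le> max B 0" if "norm x \<le> R" for x
    using that by fastforce
  then show ?thesis
    using that[of "max B 0"] by auto
qed

text \<open>Integration by parts for difference quotients: by translation invariance, the difference
  quotient of \<open>\<psi>\<close> can be moved to \<open>f\<close>.\<close>

lemma difference_quotient_limit:
  fixes f \<psi> :: "real^'n::finite \<Rightarrow> real"
  assumes f: "f \<in> borel_measurable lebesgue" "locally_bounded f"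
    and \<psi>: "continuous_on UNIV \<psi>" "\<And>x. norm x > R \<Longrightarrow> \<psi> x = 0"
    and \<psi>': "\<And>x. has_partial j \<psi> (\<psi>' x) x" "continuous_on UNIV \<psi>'" "\<And>x. norm x > R \<Longrightarrow> \<psi>' x = 0"
  shows "(\<lambda>n. LINT x|lebesgue. (f (x - (1 / real (Suc n)) *\<^sub>R axis j 1) - f x) * real (Suc n) * \<psi> x)
           \<longlonglongrightarrow> (LINT x|lebesgue. f x * \<psi>' x)"
proof -
  \<comment> \<open>The radius is R + 1 because arguments are shifted by at most 1.\<close>
  obtain B where B: "B \<ge> 0" "\<And>x. norm x \<le> R + 1 \<Longrightarrow> \<bar>f x\<bar> \<le> B"
    using locally_boundedD[OF f(2)] by metis
  obtain M where M: "M \<ge> 0" "\<And>x. \<bar>\<psi> x\<bar> \<le> M"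
    using continuous_bounded_support_bounded \<psi> by metis
  obtain M' where M': "M' \<ge> 0" "\<And>x. \<bar>\<psi>' x\<bar> \<le> M'"
    using continuous_bounded_support_bounded \<psi>' by metis
  have m\<psi>: "\<psi> \<in> borel_measurable lebesgue" "\<psi>' \<in> borel_measurable lebesgue"
    using \<psi>(1) \<psi>'(2) by (simp_all add: borel_measurable_continuous_onI measurable_completion)
  define t where "t n = 1 / real (Suc n)" for n
  have t: "t n > 0" "t n \<le> 1" "real (Suc n) = 1 / t n" for n
    by (auto simp: t_def)
  have t0: "t \<longlonglongrightarrow> 0"
    unfolding t_def by (rule LIMSEQ_Suc[OF lim_1_over_n])
  have nle: "norm x \<le> norm (x + s *\<^sub>R axis j 1) + \<bar>s\<bar>" "norm (x + s *\<^sub>R axis j 1) \<le> norm x + \<bar>s\<bar>" for x :: "real^'n" and s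
    using norm_triangle_ineq[of x "s *\<^sub>R axis j 1"]
      norm_triangle_ineq4[of "x + s *\<^sub>R axis j 1" "s *\<^sub>R axis j 1"] by (simp_all)
  have shift: "(LINT x|lebesgue. (f (x - t n *\<^sub>R axis j 1) - f x) * (1 / t n) * \<psi> x) =
      (LINT x|lebesgue. f x * ((\<psi> (x + t n *\<^sub>R axis j 1) - \<psi> x) / t n))" for n
  proof -
    have i1: "integrable lebesgue (\<lambda>x. f (x - t n *\<^sub>R axis j 1) * \<psi> x)"
    proof (rule integrable_bounded_support)
      show "(\<lambda>x. f (x - t n *\<^sub>R axis j 1) * \<psi> x) \<in> borel_measurable lebesgue"
        by (intro borel_measurable_times measurable_shift(1)[OF f(1)] m\<psi>)
      show "\<bar>f (x - t n *\<^sub>R axis j 1) * \<psi> x\<bar> \<le> B * M" if "norm x \<le> R" for x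
        unfolding abs_mult
        by (rule mult_mono) (use that B M nle(2)[of x "- t n"] t[of n] in auto)
    qed (use \<psi> in auto)
    have i2: "integrable lebesgue (\<lambda>x. f x * \<psi> x)"
    proof (rule integrable_bounded_support)
      show "(\<lambda>x. f x * \<psi> x) \<in> borel_measurable lebesgue"
        by (intro borel_measurable_times f m\<psi>)
      show "\<bar>f x * \<psi> x\<bar> \<le> B * M" if "norm x \<le> R" for x
        unfolding abs_mult
        by (rule mult_mono) (use that B M in auto)
    qed (use \<psi> in auto)
    have i3: "integrable lebesgue (\<lambda>x. f x * \<psi> (x + t n *\<^sub>R axis j 1))"
    proof (rule integrable_bounded_support)
      show "(\<lambda>x. f x * \<psi> (x + t n *\<^sub>R axis j 1)) \<in> borel_measurable lebesgue"
        by (intro borel_measurable_times measurable_shift(2)[OF m\<psi>(1)] f)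
      show "\<bar>f x * \<psi> (x + t n *\<^sub>R axis j 1)\<bar> \<le> B * M" if "norm x \<le> R + 1" for x
        unfolding abs_mult
        by (rule mult_mono) (use that B M in auto)
      show "f x * \<psi> (x + t n *\<^sub>R axis j 1) = 0" if "norm x > R + 1" for x
        using that nle(1)[of x "t n"] t[of n] \<psi>(2)[of "x + t n *\<^sub>R axis j 1"] by auto
    qed
    have "(LINT x|lebesgue. f (x - t n *\<^sub>R axis j 1) * \<psi> x) =
        (LINT x|lebesgue. f x * \<psi> (x + t n *\<^sub>R axis j 1))"
      using integral_lebesgue_shift[of "\<lambda>x. f (x - t n *\<^sub>R axis j 1) * \<psi> x" "t n *\<^sub>R axis j 1"] i1
      by simp
    then have "(LINT x|lebesgue. (f (x - t n *\<^sub>R axis j 1) * \<psi> x - f x * \<psi> x) / t n) =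
        (LINT x|lebesgue. (f x * \<psi> (x + t n *\<^sub>R axis j 1) - f x * \<psi> x) / t n)"
      by (simp add: i1 i2 i3)
    then show ?thesis
      by (simp add: algebra_simps diff_divide_distrib)
  qed
  have "(\<lambda>n. LINT x|lebesgue. f x * ((\<psi> (x + t n *\<^sub>R axis j 1) - \<psi> x) / t n))
           \<longlonglongrightarrow> (LINT x|lebesgue. f x * \<psi>' x)"
  proof (rule integral_dominated_convergence[where w="\<lambda>x. B * M' * indicat_real (cball 0 (R+1)) x"])
    show "(\<lambda>x. f x * \<psi>' x) \<in> borel_measurable lebesgue"
      by (intro borel_measurable_times f m\<psi>)
    show "(\<lambda>x. f x * ((\<psi> (x + t n *\<^sub>R axis j 1) - \<psi> x) / t n)) \<in> borel_measurable lebesgue" for n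
      using measurable_shift(2)[OF m\<psi>(1), of "t n *\<^sub>R axis j 1"] f(1) m\<psi>(1) by measurable
    show "integrable lebesgue (\<lambda>x::real^'n. B * M' * indicat_real (cball 0 (R + 1)) x)"
      by (intro integrable_mult_right integrable_real_indicator)
        (auto simp: emeasure_lborel_cball_finite[unfolded infinity_ennreal_def])
    have "(\<lambda>n. (\<psi> (x + t n *\<^sub>R axis j 1) - \<psi> x) / t n) \<longlonglongrightarrow> \<psi>' x" for x
    proof -
      have "((\<lambda>h. (\<psi> (x + h *\<^sub>R axis j 1) - \<psi> x) / h) \<longlongrightarrow> \<psi>' x) (at 0)"
        using \<psi>'(1)[of x] by (simp add: has_partial_def DERIV_def)
      moreover have "filterlim t (at 0) sequentially"
        unfolding filterlim_at using t0 less_imp_neq[OF t(1)] by (auto intro!: always_eventually)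
      ultimately show ?thesis
        by (rule filterlim_compose)
    qed
    then show "AE x in lebesgue. (\<lambda>n. f x * ((\<psi> (x + t n *\<^sub>R axis j 1) - \<psi> x) / t n)) \<longlonglongrightarrow> f x * \<psi>' x"
      by (intro always_eventually allI tendsto_mult_left)
    have "\<bar>f x * ((\<psi> (x + t n *\<^sub>R axis j 1) - \<psi> x) / t n)\<bar> \<le> B * M' * indicat_real (cball 0 (R + 1)) x" for n x
    proof (cases "norm x \<le> R + 1")
      case True
      \<comment> \<open>The mean value theorem along the axis bounds the quotients by M' uniformly
        in n, as dominated convergence demands.\<close>
      have "\<exists>z. 0 < z \<and> z < t n \<and> \<psi> (x + t n *\<^sub>R axis j 1) - \<psi> (x + 0 *\<^sub>R axis j 1) = (t n - 0) * \<psi>' (x + z *\<^sub>R axis j 1)"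
        by (rule MVT2[OF t(1)]) (rule has_partial_shift[OF \<psi>'(1)])
      then obtain z where "\<psi> (x + t n *\<^sub>R axis j 1) - \<psi> x = t n * \<psi>' (x + z *\<^sub>R axis j 1)"
        by auto
      then have "\<bar>(\<psi> (x + t n *\<^sub>R axis j 1) - \<psi> x) / t n\<bar> \<le> M'"
        using M' t(1)[of n] by simp
      then have "\<bar>f x\<bar> * \<bar>(\<psi> (x + t n *\<^sub>R axis j 1) - \<psi> x) / t n\<bar> \<le> B * M'"
        by (intro mult_mono) (use True B in auto)
      then show ?thesis
        using True by (simp add: abs_mult)
    next
      case False
      then show ?thesis
        using nle(1)[of x "t n"] t[of n] \<psi>(2)[of x] \<psi>(2)[of "x + t n *\<^sub>R axis j 1"] by auto
    qed
    then show "AE x in lebesgue. norm (f x * ((\<psi> (x + t n *\<^sub>R axis j 1) - \<psi> x) / t n)) \<le> B * M' * indicat_real (cball 0 (R + 1)) x" for n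
      by simp
  qed
  then show ?thesis
    unfolding shift[symmetric] unfolding t_def by simp
qed


section \<open>Test functions of class C^1 with compact support\<close>

lemma C1c_has_vector_derivative:
  fixes \<phi> :: "real^'n::finite \<Rightarrow> 'b::real_normed_vector"
  assumes "\<phi> \<in> C1c \<Omega>"
  shows "((\<lambda>t. \<phi> (x + t *\<^sub>R axis j 1)) has_vector_derivative partial_deriv j \<phi> x) (at 0)"
proof -
  have "\<phi> differentiable (at x)"
    using assms by (simp add: C1c_def)
  then have d: "(\<phi> has_derivative frechet_derivative \<phi> (at x)) (at x)"
    by (simp add: frechet_derivative_works)
  have "((\<lambda>t. \<phi> (x + t *\<^sub>R axis j 1)) has_derivative (\<lambda>t. frechet_derivative \<phi> (at x) (t *\<^sub>R axis j 1))) (at 0)"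
    by (rule has_derivative_compose[where g=\<phi>]) (use d in \<open>auto intro!: derivative_eq_intros\<close>)
  moreover have "frechet_derivative \<phi> (at x) (t *\<^sub>R axis j 1) = t *\<^sub>R partial_deriv j \<phi> x" for t
    using linear_frechet_derivative[OF \<open>\<phi> differentiable (at x)\<close>]
    by (simp add: partial_deriv_def linear_cmul)
  ultimately show ?thesis
    by (simp add: has_vector_derivative_def)
qed

lemma C1c_has_partial:
  fixes \<phi> :: "real^'n::finite \<Rightarrow> real"
  assumes "\<phi> \<in> C1c \<Omega>"
  shows "has_partial j \<phi> (partial_deriv j \<phi> x) x"
  using C1c_has_vector_derivative[OF assms]
  by (simp add: has_partial_def has_real_derivative_iff_has_vector_derivative)

lemma C1c_has_partial_component:
  fixes \<phi> :: "real^'n::finite \<Rightarrow> real^'m::finite"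
  assumes "\<phi> \<in> C1c \<Omega>"
  shows "has_partial j (\<lambda>x. \<phi> x $ i) (partial_deriv j \<phi> x $ i) x"
  using bounded_linear.has_vector_derivative[OF bounded_linear_vec_nth C1c_has_vector_derivative[OF assms]]
  by (simp add: has_partial_def has_real_derivative_iff_has_vector_derivative)

lemma C1c_continuous:
  assumes "\<phi> \<in> C1c \<Omega>"
  shows "continuous_on UNIV \<phi>" "continuous_on UNIV (partial_deriv j \<phi>)"
  using assms
  by (auto simp: C1c_def intro!: continuous_at_imp_continuous_on differentiable_imp_continuous_within)

lemma C1c_zero:
  assumes "\<phi> \<in> C1c \<Omega>" and "x \<notin> \<Omega>"
  shows "\<phi> x = 0" "partial_deriv j \<phi> x = 0"
proof -
  have "x \<notin> closure {x. \<phi> x \<noteq> 0}"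
    using assms by (auto simp: C1c_def)
  then have op: "open (- closure {x. \<phi> x \<noteq> 0})" "x \<in> - closure {x. \<phi> x \<noteq> 0}"
    by auto
  have z: "\<phi> y = 0" if "y \<in> - closure {x. \<phi> x \<noteq> 0}" for y
  proof (rule ccontr)
    assume "\<phi> y \<noteq> 0"
    then have "y \<in> closure {x. \<phi> x \<noteq> 0}"
      by (intro subsetD[OF closure_subset]) simp
    then show False
      using that by simp
  qed
  show "\<phi> x = 0"
    using z op by blast
  have "(\<phi> has_derivative (\<lambda>_. 0)) (at x)"
    by (rule has_derivative_transform_within_open[OF has_derivative_const[of 0] op]) (erule z[symmetric])
  then show "partial_deriv j \<phi> x = 0"
    unfolding partial_deriv_def by (subst frechet_derivative_at[symmetric]) simp_all
qed

lemma C1c_support: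
  assumes "\<phi> \<in> C1c \<Omega>"
  obtains R where "\<And>x. norm x > R \<Longrightarrow> \<phi> x = 0" "\<And>x j. norm x > R \<Longrightarrow> partial_deriv j \<phi> x = 0"
proof -
  let ?S = "closure {x. \<phi> x \<noteq> 0}"
  \<comment> \<open>The function is also a test function on its own closed support, so
    \<open>C1c_zero\<close> makes it vanish off that set together with its derivatives.\<close>
  have "compact ?S" and mem: "\<phi> \<in> C1c ?S"
    using assms by (auto simp: C1c_def)
  then obtain R where "\<forall>x\<in>?S. norm x \<le> R"
    using compact_imp_bounded bounded_iff by blast
  then have "x \<notin> ?S" if "norm x > R" for x
    using that by force
  then show ?thesis
    using that[of R] C1c_zero[OF mem] by blast
qed

section \<open>Locally Lipschitz functions and their weak gradients\<close>

text \<open>The constants are local because \<open>rad\<close> is quadratic and products have to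
  stay in the class.\<close>

definition locally_lipschitz :: "('a::real_normed_vector \<Rightarrow> real) \<Rightarrow> bool"
  where "locally_lipschitz f \<longleftrightarrow>
    (\<forall>R. \<exists>L\<ge>0. \<forall>x y. norm x \<le> R \<longrightarrow> norm y \<le> R \<longrightarrow> \<bar>f x - f y\<bar> \<le> L * norm (x - y))"

lemma locally_lipschitzD:
  assumes "locally_lipschitz f"
  obtains L where "L \<ge> 0" "\<And>x y. norm x \<le> R \<Longrightarrow> norm y \<le> R \<Longrightarrow> \<bar>f x - f y\<bar> \<le> L * norm (x - y)"
  using assms unfolding locally_lipschitz_def by metis

lemma locally_lipschitz_continuous:
  fixes f :: "'a::real_normed_vector \<Rightarrow> real"
  assumes "locally_lipschitz f"
  shows "continuous_on UNIV f"
proof (rule continuous_at_imp_continuous_on, rule ballI)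
  fix x :: 'a
  obtain L where L: "L \<ge> 0" "\<And>y z. norm y \<le> norm x + 1 \<Longrightarrow> norm z \<le> norm x + 1 \<Longrightarrow> \<bar>f y - f z\<bar> \<le> L * norm (y - z)"
    using locally_lipschitzD[OF assms] by metis
  have "L-lipschitz_on (ball x 1) f"
  proof (rule lipschitz_onI)
    fix y z assume "y \<in> ball x 1" "z \<in> ball x 1"
    then have "norm y \<le> norm x + 1" "norm z \<le> norm x + 1"
      using norm_triangle_sub[of y x] norm_triangle_sub[of z x]
      by (auto simp: dist_norm norm_minus_commute)
    then show "dist (f y) (f z) \<le> L * dist y z"
      using L(2) by (simp add: dist_norm)
  qed (use L in auto)
  then have "continuous_on (ball x 1) f"
    by (rule lipschitz_on_continuous_on)
  then show "isCont f x"
    by (simp add: continuous_on_eq_continuous_at)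
qed

lemma locally_lipschitz_bounded:
  assumes "locally_lipschitz f"
  shows "locally_bounded f"
  unfolding locally_bounded_def
proof
  fix R
  obtain L where L: "L \<ge> 0" "\<And>x y. norm x \<le> max R 0 \<Longrightarrow> norm y \<le> max R 0 \<Longrightarrow> \<bar>f x - f y\<bar> \<le> L * norm (x - y)"
    using locally_lipschitzD[OF assms] by metis
  have "\<bar>f x\<bar> \<le> \<bar>f 0\<bar> + L * max R 0" if "norm x \<le> R" for x
  proof -
    have "norm x \<le> max R 0"
      using that by simp
    then have "\<bar>f x - f 0\<bar> \<le> L * norm x" "L * norm x \<le> L * max R 0"
      using L(2)[of x 0] L(1) by (auto intro: mult_left_mono)
    then show ?thesis
      by linarith
  qed
  then show "\<exists>B. \<forall>x. norm x \<le> R \<longrightarrow> \<bar>f x\<bar> \<le> B"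
    by blast
qed

text \<open>The bound is only almost everywhere, since partial derivatives are controlled only where
  they exist.\<close>

lemma Lp_locI:
  fixes f :: "real^'n::finite \<Rightarrow> 'b::euclidean_space"
  assumes f: "f \<in> borel_measurable lebesgue"
    and b: "\<And>R. \<exists>B. AE x in lebesgue. norm x \<le> R \<longrightarrow> norm (f x) \<le> B" and "p \<ge> 0"
  shows "f \<in> Lp_loc p"
  unfolding Lp_loc_def mem_Collect_eq
proof (intro conjI allI impI f)
  fix S :: "(real^'n) set" assume S: "compact S"
  then obtain R where R: "\<And>x. x \<in> S \<Longrightarrow> norm x \<le> R"
    using compact_imp_bounded bounded_iff by metis
  obtain B where B: "AE x in lebesgue. norm x \<le> R \<longrightarrow> norm (f x) \<le> B"
    using b by blast
  have Sm: "S \<in> sets lebesgue"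
    using S by (simp add: borel_compact)
  show "set_integrable lebesgue S (\<lambda>x. norm (f x) powr p)"
    unfolding set_integrable_def
  proof (rule Bochner_Integration.integrable_bound[where f="\<lambda>x. B powr p * indicat_real S x"])
    show "integrable lebesgue (\<lambda>x. B powr p * indicat_real S x)"
      using S Sm by (intro integrable_mult_right integrable_real_indicator)
        (auto simp: emeasure_compact_finite[unfolded infinity_ennreal_def] borel_compact)
    show "(\<lambda>x. indicat_real S x *\<^sub>R norm (f x) powr p) \<in> borel_measurable lebesgue"
      using Sm f by measurable
    show "AE x in lebesgue. norm (indicat_real S x *\<^sub>R norm (f x) powr p) \<le> norm (B powr p * indicat_real S x)"
      using B
    proof eventually_elim
      case (elim x)
      show ?case
        using R[of x] elim powr_mono2[of p "norm (f x)" B] \<open>p \<ge> 0\<close> by (auto simp: indicator_def)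
    qed
  qed
qed

lemma has_partial_bound:
  assumes L: "\<And>x y. norm x \<le> R + 1 \<Longrightarrow> norm y \<le> R + 1 \<Longrightarrow> \<bar>f x - f y\<bar> \<le> L * norm (x - y)"
    and "has_partial j f D x" and x: "norm x \<le> R"
  shows "\<bar>D\<bar> \<le> L"
proof -
  have "((\<lambda>h. \<bar>(f (x + h *\<^sub>R axis j 1) - f x) / h\<bar>) \<longlongrightarrow> \<bar>D\<bar>) (at 0)"
    using assms(2) by (intro tendsto_intros) (simp add: has_partial_def DERIV_def)
  moreover have "eventually (\<lambda>h. \<bar>(f (x + h *\<^sub>R axis j 1) - f x) / h\<bar> \<le> L) (at 0)"
    unfolding eventually_at
  proof (intro exI[of _ 1] conjI ballI impI)
    fix h :: real assume h: "h \<noteq> 0 \<and> dist h 0 < 1"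
    have "norm (x + h *\<^sub>R axis j 1) \<le> R + 1"
      using norm_triangle_ineq[of x "h *\<^sub>R axis j 1"] h x by simp
    then have "\<bar>f (x + h *\<^sub>R axis j 1) - f x\<bar> \<le> L * \<bar>h\<bar>"
      using L[of "x + h *\<^sub>R axis j 1" x] x by simp
    then show "\<bar>(f (x + h *\<^sub>R axis j 1) - f x) / h\<bar> \<le> L"
      using h by (simp add: divide_le_eq)
  qed simp
  ultimately show ?thesis
    by (rule tendsto_upperbound) simp
qed

lemma difference_quotient_tendsto:
  assumes "has_partial j f D x"
  shows "(\<lambda>n. (f (x - (1 / real (Suc n)) *\<^sub>R axis j 1) - f x) * real (Suc n)) \<longlonglongrightarrow> - D"
proof -
  have "((\<lambda>h. - ((f (x + h *\<^sub>R axis j 1) - f x) / h)) \<longlongrightarrow> - D) (at 0)"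
    using assms by (intro tendsto_intros) (simp add: has_partial_def DERIV_def)
  moreover have "filterlim (\<lambda>n. - (1 / real (Suc n))) (at 0) sequentially"
    unfolding filterlim_at using tendsto_minus[OF LIMSEQ_Suc[OF lim_1_over_n[where 'a=real]]]
    by (auto intro!: always_eventually)
  ultimately show ?thesis
    using filterlim_compose by fastforce
qed

text \<open>Completeness of Lebesgue measure: nothing is known about g on the exceptional null
  set.\<close>

lemma lebesgue_measurable_AE_cong:
  fixes f g :: "'a::euclidean_space \<Rightarrow> real"
  assumes f: "f \<in> borel_measurable lebesgue" and fg: "AE x in lebesgue. f x = g x"
  shows "g \<in> borel_measurable lebesgue"
proof (rule measurableI)
  fix A :: "real set" assume A: "A \<in> sets borel"
  have 1: "f -` A \<inter> space lebesgue \<in> sets lebesgue"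
    using f A by (rule measurable_sets)
  have 2: "AE x in lebesgue. (x \<in> f -` A \<inter> space lebesgue) = (x \<in> g -` A \<inter> space lebesgue)"
    using fg by eventually_elim auto
  show "g -` A \<inter> space lebesgue \<in> sets lebesgue"
    by (rule completion.in_sets_AE[OF 2 1]) auto
qed auto

text \<open>Almost everywhere g is the limit of measurable difference quotients. The total function
  \<open>lim\<close> of them is measurable, whatever it returns where no limit exists.\<close>

lemma has_partial_measurable:
  fixes f g :: "real^'n::finite \<Rightarrow> real"
  assumes f: "f \<in> borel_measurable lebesgue" and g: "AE x in lebesgue. has_partial j f (g x) x"
  shows "g \<in> borel_measurable lebesgue"
proof -
  let ?q = "\<lambda>n x. - ((f (x - (1 / real (Suc n)) *\<^sub>R axis j 1) - f x) * real (Suc n))"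
  have q: "?q n \<in> borel_measurable lebesgue" for n
    using measurable_shift(1)[OF f] f by measurable
  have "(\<lambda>x. lim (\<lambda>n. ?q n x)) \<in> borel_measurable lebesgue"
    by (rule borel_measurable_lim_metric[OF q])
  moreover have "AE x in lebesgue. lim (\<lambda>n. ?q n x) = g x"
    using g
  proof eventually_elim
    case (elim x)
    then show ?case
      using tendsto_minus[OF difference_quotient_tendsto[OF elim]] by (intro limI) simp
  qed
  ultimately show ?thesis
    by (rule lebesgue_measurable_AE_cong)
qed


lemma norm_vec_le_CARD:
  fixes v :: "'b::real_normed_vector^'n::finite"
  assumes "\<And>i. norm (v $ i) \<le> B"
  shows "norm v \<le> real CARD('n) * B"
proof -
  have "norm v \<le> (\<Sum>i\<in>UNIV. norm (v $ i))"
    unfolding norm_vec_def by (rule L2_set_le_sum) simp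
  also have "\<dots> \<le> (\<Sum>i\<in>(UNIV::'n set). B)"
    by (rule sum_mono) (rule assms)
  finally show ?thesis
    by simp
qed

text \<open>Both sides of the integration by parts are limits of the same integrals of difference
  quotients of u: translation moves the quotients to the test function, while the Lipschitz bound
  allows dominated convergence towards G.\<close>

lemma has_weak_gradientI:
  fixes u :: "real^'n::finite \<Rightarrow> real^'n"
  assumes u: "\<And>i. locally_lipschitz (\<lambda>x. u x $ i)"
    and G: "AE x in lebesgue. \<forall>i j. has_partial j (\<lambda>x. u x $ i) (G x $ i $ j) x"
    and "p \<ge> 0"
  shows "has_weak_gradient u G" "u \<in> Lp_loc p" "G \<in> Lp_loc p"
proof -
  have cu: "continuous_on UNIV u"
    using locally_lipschitz_continuous[OF u] by (subst continuous_on_componentwise) (auto simp: Basis_vec_def inner_axis)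
  have mui: "(\<lambda>x. u x $ i) \<in> borel_measurable lebesgue" for i
    by (intro measurable_completion)
      (simp add: borel_measurable_continuous_onI locally_lipschitz_continuous[OF u])
  have mu: "u \<in> borel_measurable lebesgue"
    using cu by (simp add: borel_measurable_continuous_onI measurable_completion)
  have Gij: "AE x in lebesgue. has_partial j (\<lambda>x. u x $ i) (G x $ i $ j) x" for i j
    using G by eventually_elim simp
  have mGij: "(\<lambda>x. G x $ i $ j) \<in> borel_measurable lebesgue" for i j
    by (rule has_partial_measurable[OF mui Gij])
  have mG: "G \<in> borel_measurable lebesgue"
    using mGij by (subst borel_measurable_euclidean_space) (auto simp: Basis_vec_def inner_axis)
  have Lp: "u \<in> Lp_loc p'" "G \<in> Lp_loc p'" if "p' \<ge> 0" for p'
  proof (rule Lp_locI[OF mu _ that])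
    fix R
    have "bounded (u ` cball 0 R)"
      by (intro compact_imp_bounded compact_continuous_image) (auto intro: continuous_on_subset[OF cu])
    then obtain B where "\<forall>x\<in>cball 0 R. norm (u x) \<le> B"
      unfolding bounded_iff by auto
    then show "\<exists>B. AE x in lebesgue. norm x \<le> R \<longrightarrow> norm (u x) \<le> B"
      by (intro exI[of _ B]) simp
  next
    show "G \<in> Lp_loc p'"
    proof (rule Lp_locI[OF mG _ that])
      fix R
      have "\<exists>L. \<forall>i. \<forall>x y. norm x \<le> R + 1 \<longrightarrow> norm y \<le> R + 1 \<longrightarrow> \<bar>u x $ i - u y $ i\<bar> \<le> L i * norm (x - y)"
        using u unfolding locally_lipschitz_def by (intro choice allI) metis
      then obtain L where L: "\<And>i x y. norm x \<le> R + 1 \<Longrightarrow> norm y \<le> R + 1 \<Longrightarrow> \<bar>u x $ i - u y $ i\<bar> \<le> L i * norm (x - y)"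
        by metis
      define M where "M = Max (range L)"
      have LM: "L i \<le> M" for i
        unfolding M_def by (rule Max_ge) auto
      have "AE x in lebesgue. norm x \<le> R \<longrightarrow> norm (G x) \<le> real CARD('n) * (real CARD('n) * M)"
        using G
      proof eventually_elim
        case (elim x)
        show ?case
        proof
          assume x: "norm x \<le> R"
          have "\<bar>G x $ i $ j\<bar> \<le> M" for i j
          proof -
            have "\<bar>G x $ i $ j\<bar> \<le> L i"
              by (rule has_partial_bound[where f="\<lambda>x. u x $ i", OF L]) (use elim x in auto)
            then show ?thesis
              using LM[of i] by simp
          qed
          then show "norm (G x) \<le> real CARD('n) * (real CARD('n) * M)"
            by (intro norm_vec_le_CARD) simp
        qed
      qed
      then show "\<exists>B. AE x in lebesgue. norm x \<le> R \<longrightarrow> norm (G x) \<le> B"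
        by blast
    qed
  qed
  show "u \<in> Lp_loc p" "G \<in> Lp_loc p"
    using Lp \<open>p \<ge> 0\<close> by auto
  show "has_weak_gradient u G"
    unfolding has_weak_gradient_def
  proof (intro conjI ballI allI)
    show "u \<in> Lp_loc 1" "G \<in> Lp_loc 1"
      using Lp by auto
    fix \<phi> :: "real^'n \<Rightarrow> real" and i j assume \<phi>: "\<phi> \<in> C1c UNIV"
    obtain R where R: "\<And>x. norm x > R \<Longrightarrow> \<phi> x = 0" "\<And>x. norm x > R \<Longrightarrow> partial_deriv j \<phi> x = 0"
      using C1c_support[OF \<phi>] by metis
    obtain M where M: "M \<ge> 0" "\<And>x. \<bar>\<phi> x\<bar> \<le> M"
      using continuous_bounded_support_bounded[OF C1c_continuous(1)[OF \<phi>] R(1)] by metis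
    obtain L where L: "L \<ge> 0" "\<And>x y. norm x \<le> R + 1 \<Longrightarrow> norm y \<le> R + 1 \<Longrightarrow> \<bar>u x $ i - u y $ i\<bar> \<le> L * norm (x - y)"
      using locally_lipschitzD[OF u] by metis
    let ?q = "\<lambda>n x. (u (x - (1 / real (Suc n)) *\<^sub>R axis j 1) $ i - u x $ i) * real (Suc n)"
    have m\<phi>: "\<phi> \<in> borel_measurable lebesgue"
      using C1c_continuous(1)[OF \<phi>] by (simp add: borel_measurable_continuous_onI measurable_completion)
    have "(\<lambda>n. LINT x|lebesgue. ?q n x * \<phi> x) \<longlonglongrightarrow> (LINT x|lebesgue. u x $ i * partial_deriv j \<phi> x)"
      by (rule difference_quotient_limit[OF mui locally_lipschitz_bounded[OF u] C1c_continuous(1)[OF \<phi>] R(1)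
            C1c_has_partial[OF \<phi>] C1c_continuous(2)[OF \<phi>] R(2)])
    moreover have "(\<lambda>n. LINT x|lebesgue. ?q n x * \<phi> x) \<longlonglongrightarrow> (LINT x|lebesgue. - (G x $ i $ j * \<phi> x))"
    proof (rule integral_dominated_convergence[where w="\<lambda>x. L * M * indicat_real (cball 0 R) x"])
      show "(\<lambda>x. - (G x $ i $ j * \<phi> x)) \<in> borel_measurable lebesgue"
        using mGij m\<phi> by measurable
      show "(\<lambda>x. ?q n x * \<phi> x) \<in> borel_measurable lebesgue" for n
        using measurable_shift(1)[OF mui[of i], of "(1 / real (Suc n)) *\<^sub>R axis j 1"] mui m\<phi> by measurable
      show "integrable lebesgue (\<lambda>x::real^'n. L * M * indicat_real (cball 0 R) x)"
        by (intro integrable_mult_right integrable_real_indicator)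
          (auto simp: emeasure_lborel_cball_finite[unfolded infinity_ennreal_def])
      show "AE x in lebesgue. (\<lambda>n. ?q n x * \<phi> x) \<longlonglongrightarrow> - (G x $ i $ j * \<phi> x)"
        using Gij[of j i]
      proof eventually_elim
        case (elim x)
        show ?case
          using tendsto_mult_right[OF difference_quotient_tendsto[OF elim], of "\<phi> x"] by simp
      qed
      have "\<bar>?q n x * \<phi> x\<bar> \<le> L * M * indicat_real (cball 0 R) x" for n x
      proof (cases "norm x \<le> R")
        case True
        define t where "t = 1 / real (Suc n)"
        have t: "0 < t" "t \<le> 1" "real (Suc n) = 1 / t"
          by (auto simp: t_def)
        have "norm (x - t *\<^sub>R axis j 1) \<le> R + 1"
          using norm_triangle_ineq4[of x "t *\<^sub>R axis j 1"] t True by simp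
        then have "\<bar>u (x - t *\<^sub>R axis j 1) $ i - u x $ i\<bar> \<le> L * t"
          using L(2)[of "x - t *\<^sub>R axis j 1" x] t True by simp
        then have "\<bar>(u (x - t *\<^sub>R axis j 1) $ i - u x $ i) * (1 / t)\<bar> \<le> L"
          using t by (simp add: field_simps abs_mult)
        then have "\<bar>(u (x - t *\<^sub>R axis j 1) $ i - u x $ i) * (1 / t)\<bar> * \<bar>\<phi> x\<bar> \<le> L * M"
          by (intro mult_mono) (use M L in auto)
        then show ?thesis
          using True unfolding t(3) t_def[symmetric] by (simp add: abs_mult)
      next
        case False
        then show ?thesis
          using R(1)[of x] by simp
      qed
      then show "AE x in lebesgue. norm (?q n x * \<phi> x) \<le> L * M * indicat_real (cball 0 R) x" for n
        by simp
    qed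
    ultimately show "(LINT x|lebesgue. u x $ i * partial_deriv j \<phi> x) = - (LINT x|lebesgue. G x $ i $ j * \<phi> x)"
      using LIMSEQ_unique by fastforce
  qed
qed

text \<open>A linear bound on the L^1 modulus of continuity of f in each coordinate direction passes
  to the limit in the pairing with the divergence. The directions are added, whence the dimension as
  a factor. While g matters only in \<Omega>, f is a version of it that is meaningful at shifted
  points outside \<Omega>.\<close>

lemma total_variation_le:
  fixes f g :: "real^'n::finite \<Rightarrow> real"
  assumes f: "f \<in> borel_measurable lebesgue" "locally_bounded f"
    and g: "g \<in> borel_measurable lebesgue" "AE x in lebesgue. x \<in> \<Omega> \<longrightarrow> g x = f x"
    and \<Omega>: "\<Omega> \<in> sets lebesgue" and "K \<ge> 0" "\<tau> > 0"
    and K: "\<And>t j. 0 < t \<Longrightarrow> t < \<tau> \<Longrightarrow>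
      (\<integral>\<^sup>+x\<in>\<Omega>. ennreal \<bar>f (x - t *\<^sub>R axis j 1) - f x\<bar> \<partial>lebesgue) \<le> ennreal (K * t)"
  shows "total_variation \<Omega> g \<le> ennreal (real CARD('n) * K)"
  unfolding total_variation_def
proof (rule SUP_least, clarify)
  fix \<phi> :: "real^'n \<Rightarrow> real^'n"
  assume \<phi>: "\<phi> \<in> C1c \<Omega>" and le1: "\<forall>x. norm (\<phi> x) \<le> 1"
  obtain R where R: "\<And>x. norm x > R \<Longrightarrow> \<phi> x = 0" "\<And>x j. norm x > R \<Longrightarrow> partial_deriv j \<phi> x = 0"
    using C1c_support[OF \<phi>] by metis
  have c: "continuous_on UNIV (\<lambda>x. \<phi> x $ j)" "continuous_on UNIV (\<lambda>x. partial_deriv j \<phi> x $ i)" for i j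
    using C1c_continuous[OF \<phi>] by (auto intro!: continuous_intros)
  have m: "(\<lambda>x. \<phi> x $ j) \<in> borel_measurable lebesgue" "(\<lambda>x. partial_deriv j \<phi> x $ i) \<in> borel_measurable lebesgue" for i j
    using c by (simp_all add: borel_measurable_continuous_onI measurable_completion)
  have int: "integrable lebesgue (\<lambda>x. f x * partial_deriv j \<phi> x $ j)" for j
  proof -
    obtain B where B: "B \<ge> 0" "\<And>x. norm x \<le> R \<Longrightarrow> \<bar>f x\<bar> \<le> B"
      using locally_boundedD[OF f(2)] by metis
    obtain M where M: "M \<ge> 0" "\<And>x. \<bar>partial_deriv j \<phi> x $ j\<bar> \<le> M"
      using continuous_bounded_support_bounded[OF c(2)[of j j], of R] R by auto
    show ?thesis
    proof (rule integrable_bounded_support)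
      show "(\<lambda>x. f x * partial_deriv j \<phi> x $ j) \<in> borel_measurable lebesgue"
        using f m by measurable
      show "\<bar>f x * partial_deriv j \<phi> x $ j\<bar> \<le> B * M" if "norm x \<le> R" for x
        unfolding abs_mult by (rule mult_mono) (use B M that in auto)
    qed (use R in auto)
  qed
  have le: "(LINT x|lebesgue. f x * partial_deriv j \<phi> x $ j) \<le> K" for j
  proof -
    let ?I = "\<lambda>n. LINT x|lebesgue. (f (x - (1 / real (Suc n)) *\<^sub>R axis j 1) - f x) * real (Suc n) * \<phi> x $ j"
    have "?I \<longlonglongrightarrow> (LINT x|lebesgue. f x * partial_deriv j \<phi> x $ j)"
      by (rule difference_quotient_limit[OF f c(1) _ C1c_has_partial_component[OF \<phi>] c(2), of R]) (use R in auto)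
    moreover have "eventually (\<lambda>n. 1 / real (Suc n) < \<tau>) sequentially"
      using order_tendstoD(2)[OF LIMSEQ_Suc[OF lim_1_over_n[where 'a=real]] \<open>\<tau> > 0\<close>] by simp
    then have "eventually (\<lambda>n. ?I n \<le> K) sequentially"
    proof eventually_elim
      case (elim n)
      define t where "t = 1 / real (Suc n)"
      have t: "0 < t" "t < \<tau>" "real (Suc n) = 1 / t"
        using elim by (auto simp: t_def)
      have "ennreal \<bar>LINT x|lebesgue. (f (x - t *\<^sub>R axis j 1) - f x) * (1 / t) * \<phi> x $ j\<bar>
          \<le> (\<integral>\<^sup>+x. ennreal \<bar>(f (x - t *\<^sub>R axis j 1) - f x) * (1 / t) * \<phi> x $ j\<bar> \<partial>lebesgue)"
      proof (cases "integrable lebesgue (\<lambda>x. (f (x - t *\<^sub>R axis j 1) - f x) * (1 / t) * \<phi> x $ j)")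
        case True
        then show ?thesis
          using integral_norm_bound_ennreal[OF True] by simp
      next
        case False
        \<comment> \<open>The integral of a non-integrable function is 0 by convention, so the bound
          is trivial.\<close>
        show ?thesis
          unfolding not_integrable_integral_eq[OF False] by (simp only: abs_zero ennreal_0 zero_le)
      qed
      also have "\<dots> \<le> (\<integral>\<^sup>+x. ennreal (1 / t) * (ennreal \<bar>f (x - t *\<^sub>R axis j 1) - f x\<bar> * indicator \<Omega> x) \<partial>lebesgue)"
      proof (rule nn_integral_mono)
        fix x
        show "ennreal \<bar>(f (x - t *\<^sub>R axis j 1) - f x) * (1 / t) * \<phi> x $ j\<bar>
           \<le> ennreal (1 / t) * (ennreal \<bar>f (x - t *\<^sub>R axis j 1) - f x\<bar> * indicator \<Omega> x)"
        proof (cases "x \<in> \<Omega>")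
          case True
          have "\<bar>\<phi> x $ j\<bar> \<le> 1"
            using le1 component_le_norm_cart[of "\<phi> x" j] by (meson order_trans)
          then have "\<bar>f (x - t *\<^sub>R axis j 1) - f x\<bar> * (1 / t) * \<bar>\<phi> x $ j\<bar> \<le> \<bar>f (x - t *\<^sub>R axis j 1) - f x\<bar> * (1 / t) * 1"
            using t by (intro mult_left_mono) auto
          then show ?thesis
            using True t by (simp add: abs_mult ennreal_mult''[symmetric] mult.commute)
        next
          case False
          then show ?thesis
            using C1c_zero(1)[OF \<phi>] by simp
        qed
      qed
      also have "\<dots> = ennreal (1 / t) * (\<integral>\<^sup>+x\<in>\<Omega>. ennreal \<bar>f (x - t *\<^sub>R axis j 1) - f x\<bar> \<partial>lebesgue)"
      proof (rule nn_integral_cmult)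
        show "(\<lambda>x. ennreal \<bar>f (x - t *\<^sub>R axis j 1) - f x\<bar> * indicator \<Omega> x) \<in> borel_measurable lebesgue"
          using measurable_shift(1)[OF f(1), of "t *\<^sub>R axis j 1"] f(1) \<Omega> by measurable
      qed
      also have "\<dots> \<le> ennreal (1 / t) * ennreal (K * t)"
        by (intro mult_left_mono K t) simp
      also have "\<dots> = ennreal K"
        using t \<open>K \<ge> 0\<close> by (simp add: ennreal_mult[symmetric])
      finally show ?case
        using \<open>K \<ge> 0\<close> by (simp add: t(3)[symmetric] t_def)
    qed
    ultimately show ?thesis
      by (rule tendsto_upperbound) simp
  qed
  \<comment> \<open>The divergence vanishes off \<Omega>, so g over \<Omega> can be exchanged for f
    over the whole space.\<close>
  have "(LINT x:\<Omega>|lebesgue. g x * divergence \<phi> x) = (LINT x|lebesgue. f x * divergence \<phi> x)"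
    unfolding set_lebesgue_integral_def
  proof (rule integral_cong_AE)
    show "(\<lambda>x. indicat_real \<Omega> x *\<^sub>R (g x * divergence \<phi> x)) \<in> borel_measurable lebesgue"
      unfolding divergence_def using \<Omega> g m by measurable
    show "(\<lambda>x. f x * divergence \<phi> x) \<in> borel_measurable lebesgue"
      unfolding divergence_def using f m by measurable
    show "AE x in lebesgue. indicat_real \<Omega> x *\<^sub>R (g x * divergence \<phi> x) = f x * divergence \<phi> x"
      using g(2)
    proof eventually_elim
      case (elim x)
      then show ?case
        using C1c_zero(2)[OF \<phi>, of x] by (cases "x \<in> \<Omega>") (auto simp: divergence_def)
    qed
  qed
  also have "\<dots> = (\<Sum>j\<in>UNIV. LINT x|lebesgue. f x * partial_deriv j \<phi> x $ j)"
    unfolding divergence_def sum_distrib_left by (rule Bochner_Integration.integral_sum) (rule int)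
  also have "\<dots> \<le> (\<Sum>j\<in>(UNIV::'n set). K)"
    by (rule sum_mono) (rule le)
  finally show "ennreal (LINT x:\<Omega>|lebesgue. g x * divergence \<phi> x) \<le> ennreal (real CARD('n) * K)"
    by (intro ennreal_leI) simp
qed

section \<open>Locally Lipschitz functions and a smooth step\<close>

lemma locally_lipschitz_const: "locally_lipschitz (\<lambda>_. c)"
  unfolding locally_lipschitz_def by (auto intro!: exI[of _ 0])

lemma locally_lipschitz_component: "locally_lipschitz (\<lambda>x::real^'n::finite. x $ i)"
  unfolding locally_lipschitz_def
  using component_le_norm_cart[of "x - y" i for x y :: "real^'n"] by (auto intro!: exI[of _ 1])

lemma locally_lipschitz_id: "locally_lipschitz (\<lambda>x::real. x)"
  unfolding locally_lipschitz_def by (auto intro!: exI[of _ 1])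

lemma locally_lipschitz_add:
  assumes "locally_lipschitz f" "locally_lipschitz g"
  shows "locally_lipschitz (\<lambda>x. f x + g x)"
  unfolding locally_lipschitz_def
proof
  fix R
  obtain L where L: "L \<ge> 0" "\<And>x y. norm x \<le> R \<Longrightarrow> norm y \<le> R \<Longrightarrow> \<bar>f x - f y\<bar> \<le> L * norm (x - y)"
    using locally_lipschitzD[OF assms(1)] by metis
  obtain M where M: "M \<ge> 0" "\<And>x y. norm x \<le> R \<Longrightarrow> norm y \<le> R \<Longrightarrow> \<bar>g x - g y\<bar> \<le> M * norm (x - y)"
    using locally_lipschitzD[OF assms(2)] by metis
  have "\<bar>f x + g x - (f y + g y)\<bar> \<le> (L + M) * norm (x - y)" if "norm x \<le> R" "norm y \<le> R" for x y
    using L(2)[OF that] M(2)[OF that] unfolding distrib_right by linarith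
  then show "\<exists>L\<ge>0. \<forall>x y. norm x \<le> R \<longrightarrow> norm y \<le> R \<longrightarrow> \<bar>f x + g x - (f y + g y)\<bar> \<le> L * norm (x - y)"
    using L(1) M(1) by (intro exI[of _ "L + M"]) auto
qed

lemma locally_lipschitz_mult:
  assumes "locally_lipschitz f" "locally_lipschitz g"
  shows "locally_lipschitz (\<lambda>x. f x * g x)"
  unfolding locally_lipschitz_def
proof
  fix R
  obtain L where L: "L \<ge> 0" "\<And>x y. norm x \<le> R \<Longrightarrow> norm y \<le> R \<Longrightarrow> \<bar>f x - f y\<bar> \<le> L * norm (x - y)"
    using locally_lipschitzD[OF assms(1)] by metis
  obtain M where M: "M \<ge> 0" "\<And>x y. norm x \<le> R \<Longrightarrow> norm y \<le> R \<Longrightarrow> \<bar>g x - g y\<bar> \<le> M * norm (x - y)"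
    using locally_lipschitzD[OF assms(2)] by metis
  obtain B where B: "B \<ge> 0" "\<And>x. norm x \<le> R \<Longrightarrow> \<bar>f x\<bar> \<le> B"
    using locally_boundedD[OF locally_lipschitz_bounded[OF assms(1)]] by metis
  obtain C where C: "C \<ge> 0" "\<And>x. norm x \<le> R \<Longrightarrow> \<bar>g x\<bar> \<le> C"
    using locally_boundedD[OF locally_lipschitz_bounded[OF assms(2)]] by metis
  have "\<bar>f x * g x - f y * g y\<bar> \<le> (L * C + B * M) * norm (x - y)" if xy: "norm x \<le> R" "norm y \<le> R" for x y
  proof -
    have "\<bar>f x * g x - f y * g y\<bar> = \<bar>(f x - f y) * g x + f y * (g x - g y)\<bar>"
      by (simp add: algebra_simps)
    also have "\<dots> \<le> \<bar>f x - f y\<bar> * \<bar>g x\<bar> + \<bar>f y\<bar> * \<bar>g x - g y\<bar>"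
      by (simp add: abs_mult[symmetric])
    also have "\<dots> \<le> (L * norm (x - y)) * C + B * (M * norm (x - y))"
      by (intro add_mono mult_mono L M B C xy) (use L M B C in auto)
    finally show ?thesis
      by (simp add: algebra_simps)
  qed
  then show "\<exists>L\<ge>0. \<forall>x y. norm x \<le> R \<longrightarrow> norm y \<le> R \<longrightarrow> \<bar>f x * g x - f y * g y\<bar> \<le> L * norm (x - y)"
    using L(1) M(1) B(1) C(1) by (intro exI[of _ "L * C + B * M"]) auto
qed

lemma locally_lipschitz_diff:
  assumes "locally_lipschitz f" "locally_lipschitz g"
  shows "locally_lipschitz (\<lambda>x. f x - g x)"
  using locally_lipschitz_add[OF assms(1) locally_lipschitz_mult[OF locally_lipschitz_const[of "-1"] assms(2)]]
  by simp

lemma locally_lipschitz_minus: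
  assumes "locally_lipschitz f"
  shows "locally_lipschitz (\<lambda>x. - f x)"
  using locally_lipschitz_mult[OF locally_lipschitz_const[of "-1"] assms] by simp

lemma locally_lipschitz_divide:
  assumes "locally_lipschitz f"
  shows "locally_lipschitz (\<lambda>x. f x / c)"
  using locally_lipschitz_mult[OF assms locally_lipschitz_const[of "1 / c"]] by simp

lemma locally_lipschitz_power:
  assumes "locally_lipschitz f"
  shows "locally_lipschitz (\<lambda>x. f x ^ n)"
  by (induction n) (simp_all add: locally_lipschitz_const locally_lipschitz_mult[OF assms])

lemma locally_lipschitz_sum:
  assumes "\<And>i. i \<in> I \<Longrightarrow> locally_lipschitz (f i)"
  shows "locally_lipschitz (\<lambda>x. \<Sum>i\<in>I. f i x)"
  using assms
  by (induction I rule: infinite_finite_induct) (simp_all add: locally_lipschitz_const locally_lipschitz_add)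

lemma locally_lipschitz_compose:
  fixes f :: "'a::real_normed_vector \<Rightarrow> real" and g :: "real \<Rightarrow> real"
  assumes g: "locally_lipschitz g" and f: "locally_lipschitz f"
  shows "locally_lipschitz (\<lambda>x. g (f x))"
  unfolding locally_lipschitz_def
proof
  fix R
  obtain L where L: "L \<ge> 0" "\<And>x y. norm x \<le> R \<Longrightarrow> norm y \<le> R \<Longrightarrow> \<bar>f x - f y\<bar> \<le> L * norm (x - y)"
    using locally_lipschitzD[OF f] by metis
  obtain B where B: "B \<ge> 0" "\<And>x. norm x \<le> R \<Longrightarrow> \<bar>f x\<bar> \<le> B"
    using locally_boundedD[OF locally_lipschitz_bounded[OF f]] by metis
  obtain M where M: "M \<ge> 0" "\<And>x y. norm x \<le> B \<Longrightarrow> norm y \<le> B \<Longrightarrow> \<bar>g x - g y\<bar> \<le> M * norm (x - y)"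
    using locally_lipschitzD[OF g] by metis
  have "\<bar>g (f x) - g (f y)\<bar> \<le> M * L * norm (x - y)" if xy: "norm x \<le> R" "norm y \<le> R" for x y
  proof -
    have "\<bar>g (f x) - g (f y)\<bar> \<le> M * \<bar>f x - f y\<bar>"
      using M(2)[of "f x" "f y"] B(2) xy by simp
    also have "\<dots> \<le> M * (L * norm (x - y))"
      by (intro mult_left_mono L M xy)
    finally show ?thesis
      by (simp add: mult.assoc)
  qed
  then show "\<exists>L\<ge>0. \<forall>x y. norm x \<le> R \<longrightarrow> norm y \<le> R \<longrightarrow> \<bar>g (f x) - g (f y)\<bar> \<le> L * norm (x - y)"
    using L(1) M(1) by (intro exI[of _ "M * L"]) auto
qed

lemma locally_lipschitz_max:
  fixes f g :: "'a::real_normed_vector \<Rightarrow> real"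
  assumes "locally_lipschitz f" "locally_lipschitz g"
  shows "locally_lipschitz (\<lambda>x. max (f x) (g x))"
proof -
  have a: "locally_lipschitz (\<lambda>x::real. \<bar>x\<bar>)"
    unfolding locally_lipschitz_def by (auto intro!: exI[of _ 1])
  have "locally_lipschitz (\<lambda>x. (f x + g x + \<bar>f x - g x\<bar>) / 2)"
    by (intro locally_lipschitz_divide locally_lipschitz_add assms
        locally_lipschitz_compose[OF a] locally_lipschitz_diff)
  also have "(\<lambda>x. (f x + g x + \<bar>f x - g x\<bar>) / 2) = (\<lambda>x. max (f x) (g x))"
    by (auto simp: max_def fun_eq_iff)
  finally show ?thesis .
qed

lemma locally_lipschitz_min:
  fixes f g :: "'a::real_normed_vector \<Rightarrow> real"
  assumes "locally_lipschitz f" "locally_lipschitz g"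
  shows "locally_lipschitz (\<lambda>x. min (f x) (g x))"
  using locally_lipschitz_minus[OF locally_lipschitz_max[OF assms[THEN locally_lipschitz_minus]]]
  by (simp add: minus_max_eq_min)

lemmas locally_lipschitz_intros =
  locally_lipschitz_const locally_lipschitz_component locally_lipschitz_id locally_lipschitz_add
  locally_lipschitz_mult locally_lipschitz_diff locally_lipschitz_minus locally_lipschitz_divide
  locally_lipschitz_power locally_lipschitz_sum locally_lipschitz_max locally_lipschitz_min

section \<open>A step with two controlled derivatives\<close>

lemma DERIV_pos_part_power:
  fixes t :: real
  assumes "n \<ge> 2"
  shows "((\<lambda>t. max 0 t ^ n) has_real_derivative real n * max 0 t ^ (n - 1)) (at t)"
proof -
  consider "t > 0" | "t < 0" | "t = 0"
    by linarith
  then show ?thesis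
  proof cases
    case 1
    have "((\<lambda>t. t ^ n) has_real_derivative real n * t ^ (n - 1)) (at t)"
      by (auto intro!: derivative_eq_intros)
    then have "((\<lambda>t. max 0 t ^ n) has_real_derivative real n * t ^ (n - 1)) (at t)"
      by (rule has_field_derivative_transform_within_open[where S="{0<..}"]) (use 1 in auto)
    then show ?thesis
      using 1 by (simp add: max_def)
  next
    case 2
    have "((\<lambda>t. 0) has_real_derivative 0) (at t)"
      by simp
    then have "((\<lambda>t. max 0 t ^ n) has_real_derivative 0) (at t)"
      by (rule has_field_derivative_transform_within_open[where S="{..<0}"]) (use 2 assms in \<open>auto simp: max_def\<close>)
    then show ?thesis
      using 2 assms by (simp add: max_def zero_power)
  next
    case 3
    \<comment> \<open>At the kink the quotient is 0 or h^(n-1), which for n \<ge> 2 and |h| < 1 is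
      at most |h|.\<close>
    have "((\<lambda>h::real. (max 0 (0 + h) ^ n - max 0 0 ^ n) / h) \<longlongrightarrow> 0) (at 0)"
    proof (rule Lim_null_comparison)
      show "((\<lambda>h::real. \<bar>h\<bar>) \<longlongrightarrow> 0) (at 0)"
        by (rule tendsto_eq_intros | simp)+
      have "norm ((max 0 (0 + h) ^ n - max 0 0 ^ n) / h) \<le> \<bar>h\<bar>" if "h \<noteq> 0" "\<bar>h\<bar> < 1" for h :: real
      proof (cases "h > 0")
        case True
        have "h ^ n / h = h ^ (n - 1)"
          using True assms by (simp add: power_diff)
        moreover have "h ^ (n - 1) \<le> h ^ 1"
          using True that assms by (intro power_decreasing) auto
        ultimately show ?thesis
          using True assms by (simp add: max_def zero_power)
      qed (use that assms in \<open>auto simp: max_def\<close>)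
      then show "eventually (\<lambda>h. norm ((max 0 (0 + h) ^ n - max 0 0 ^ n) / h) \<le> \<bar>h\<bar>) (at (0::real))"
        unfolding eventually_at by (intro exI[of _ 1]) (auto simp: dist_norm)
    qed
    then show ?thesis
      using 3 assms by (simp add: DERIV_def zero_power)
  qed
qed

text \<open>The integral of the quadratic B-spline on \<open>[0, 3]\<close>.\<close>

definition step :: "real \<Rightarrow> real"
  where "step t = (max 0 t ^ 3 - 3 * max 0 (t - 1) ^ 3 + 3 * max 0 (t - 2) ^ 3 - max 0 (t - 3) ^ 3) / 6"

text \<open>Two derivatives of the step are tracked because the radial displacement already contains
  the first derivative of the level, so its gradient contains the second.\<close>

definition step1 :: "real \<Rightarrow> real"
  where "step1 t = (max 0 t ^ 2 - 3 * max 0 (t - 1) ^ 2 + 3 * max 0 (t - 2) ^ 2 - max 0 (t - 3) ^ 2) / 2"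

definition step2 :: "real \<Rightarrow> real"
  where "step2 t = max 0 t - 3 * max 0 (t - 1) + 3 * max 0 (t - 2) - max 0 (t - 3)"

lemma DERIV_pos_part_power_shift:
  assumes "n \<ge> 2"
  shows "((\<lambda>t. max 0 (t - c) ^ n) has_real_derivative real n * max 0 (t - c) ^ (n - 1)) (at t)"
proof -
  have "((\<lambda>t. max 0 (t - c) ^ n) has_real_derivative real n * max 0 (t - c) ^ (n - 1) * 1) (at t)"
    by (rule DERIV_chain2[where f="\<lambda>t. max 0 t ^ n" and g="\<lambda>t. t - c", OF DERIV_pos_part_power[OF assms]])
      (auto intro!: derivative_eq_intros)
  then show ?thesis
    by simp
qed

lemma DERIV_step: "(step has_real_derivative step1 t) (at t)"
  unfolding step_def step1_def
  by (rule DERIV_cong, (rule DERIV_cdivide DERIV_add DERIV_diff DERIV_cmult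
        DERIV_pos_part_power_shift[of 3] DERIV_pos_part_power[of 3] | simp)+)

lemma DERIV_step1: "(step1 has_real_derivative step2 t) (at t)"
  unfolding step1_def step2_def
  by (rule DERIV_cong, (rule DERIV_cdivide DERIV_add DERIV_diff DERIV_cmult
        DERIV_pos_part_power_shift[of 2] DERIV_pos_part_power[of 2] | simp)+)

lemma step_eq_0: "t \<le> 0 \<Longrightarrow> step t = 0" "t \<le> 0 \<Longrightarrow> step1 t = 0" "t \<le> 0 \<Longrightarrow> step2 t = 0"
  by (simp_all add: step_def step1_def step2_def)

lemma step_eq_1: "t \<ge> 3 \<Longrightarrow> step t = 1" "t \<ge> 3 \<Longrightarrow> step1 t = 0" "t \<ge> 3 \<Longrightarrow> step2 t = 0"
  by (simp_all add: step_def step1_def step2_def max_def power2_eq_square power3_eq_cube algebra_simps)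

lemma step1_bounds: "0 \<le> step1 t" "step1 t \<le> 1"
proof -
  consider "t \<le> 0" | "0 < t" "t \<le> 1" | "1 < t" "t \<le> 2" | "2 < t" "t \<le> 3" | "t > 3"
    by linarith
  then have "0 \<le> step1 t \<and> step1 t \<le> 1"
  proof cases
    case 2
    then have "step1 t = t\<^sup>2 / 2"
      by (simp add: step1_def max_def)
    then show ?thesis
      using 2 power_le_one[of t 2] zero_le_power2[of t] by linarith
  next
    case 3
    then have "step1 t = (t\<^sup>2 - 3 * (t - 1)\<^sup>2) / 2"
      by (simp add: step1_def max_def)
    also have "\<dots> = ((t - 1) * (2 - t) * 2 + 1) / 2"
      by (simp add: power2_eq_square algebra_simps)
    finally have "step1 t = ((t - 1) * (2 - t) * 2 + 1) / 2" .
    moreover have "0 \<le> (t - 1) * (2 - t)"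
      using 3 by simp
    moreover have "(t - 1) * (2 - t) \<le> 1/4"
      using zero_le_power2[of "t - 3/2"] by (simp add: power2_eq_square algebra_simps)
    ultimately show ?thesis
      by auto
  next
    case 4
    then have "step1 t = (t\<^sup>2 - 3 * (t - 1)\<^sup>2 + 3 * (t - 2)\<^sup>2) / 2"
      by (simp add: step1_def max_def)
    also have "\<dots> = (3 - t)\<^sup>2 / 2"
      by (simp add: power2_eq_square algebra_simps)
    finally show ?thesis
      using 4 power_le_one[of "3 - t" 2] zero_le_power2[of "3 - t"] by linarith
  qed (auto simp: step_eq_0 step_eq_1)
  then show "0 \<le> step1 t" "step1 t \<le> 1"
    by auto
qed

lemma step2_bound: "\<bar>step2 t\<bar> \<le> 1"
  unfolding step2_def max_def by (auto simp: abs_if)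

lemma step_mono: "s \<le> t \<Longrightarrow> step s \<le> step t"
  using DERIV_nonneg_imp_nondecreasing[of s t step] DERIV_step step1_bounds(1) by blast

lemma step_bounds: "0 \<le> step t" "step t \<le> 1"
  using step_mono[of "min 0 t" t] step_mono[of t "max 3 t"] by (simp_all add: step_eq_0 step_eq_1)

lemma locally_lipschitz_step:
  "locally_lipschitz step" "locally_lipschitz step1" "locally_lipschitz step2"
  unfolding step_def step1_def step2_def by (intro locally_lipschitz_intros)+

lemma continuous_on_step:
  "continuous_on S f \<Longrightarrow> continuous_on S (\<lambda>x. step (f x))"
  "continuous_on S f \<Longrightarrow> continuous_on S (\<lambda>x. step1 (f x))"
  "continuous_on S f \<Longrightarrow> continuous_on S (\<lambda>x. step2 (f x))"
  using locally_lipschitz_step[THEN locally_lipschitz_continuous]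
  by (auto intro: continuous_on_compose2[of UNIV])


section \<open>Uniqueness of weak gradients\<close>

text \<open>A product of one-dimensional steps, each rising within distance 3 / r of a face; as r
  grows, these converge to the indicator of the open box.\<close>

lemma C1c_box_bump:
  fixes a b :: "real^'n::finite"
  assumes "r > 0"
  defines "\<phi> \<equiv> \<lambda>x::real^'n. \<Prod>i\<in>UNIV. step (r * (x $ i - a $ i)) * step (r * (b $ i - x $ i))"
  shows "\<phi> \<in> C1c UNIV" "\<And>x. x \<notin> box a b \<Longrightarrow> \<phi> x = 0" "\<And>x. 0 \<le> \<phi> x" "\<And>x. \<phi> x \<le> 1"
proof -
  define g where "g i t = step (r * (t - a $ i)) * step (r * (b $ i - t))" for i t
  define g' where "g' i t = r * step1 (r * (t - a $ i)) * step (r * (b $ i - t)) - r * step1 (r * (b $ i - t)) * step (r * (t - a $ i))" for i t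
  have g: "(g i has_real_derivative g' i t) (at t)" for i t
    unfolding g_def g'_def
    by (auto intro!: derivative_eq_intros DERIV_chain2[OF DERIV_step])
  have \<phi>: "\<phi> = (\<lambda>x. \<Prod>i\<in>UNIV. g i (x $ i))"
    by (simp add: \<phi>_def g_def)
  define D where "D x y = (\<Sum>i\<in>UNIV. g' i (x $ i) * y $ i * (\<Prod>k\<in>UNIV - {i}. g k (x $ k)))" for x y :: "real^'n"
  have gc: "((\<lambda>x. g i (x $ i)) has_derivative (\<lambda>y. g' i (x $ i) * y $ i)) (at x)" for i and x :: "real^'n"
    by (rule has_derivative_compose[where g="g i" and f="\<lambda>x. x $ i"])
      (use g in \<open>auto simp: has_field_derivative_def intro!: bounded_linear_imp_has_derivative bounded_linear_vec_nth\<close>)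
  have d: "(\<phi> has_derivative D x) (at x)" for x
    unfolding \<phi> D_def by (rule has_derivative_prod) (rule gc)
  have p: "partial_deriv j \<phi> x = D x (axis j 1)" for j x
    unfolding partial_deriv_def frechet_derivative_at[OF d, symmetric] ..
  have c: "continuous_on UNIV (\<lambda>x::real^'n. g i (x $ i))" "continuous_on UNIV (\<lambda>x::real^'n. g' i (x $ i))" for i
    unfolding g_def g'_def by (auto intro!: continuous_intros continuous_on_step)
  have z: "\<phi> x = 0" if x: "x \<notin> box a b" for x
  proof -
    obtain i where "x $ i \<le> a $ i \<or> b $ i \<le> x $ i"
      using x by (auto simp: mem_box_cart not_less)
    then have "g i (x $ i) = 0"
      using assms(1) by (auto simp: g_def step_eq_0 mult_nonneg_nonpos)
    then show ?thesis
      unfolding \<phi> by (auto intro: prod_zero)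
  qed
  then show "\<And>x. x \<notin> box a b \<Longrightarrow> \<phi> x = 0" .
  show "0 \<le> \<phi> x" "\<phi> x \<le> 1" for x
    unfolding \<phi> g_def
    by (auto intro!: prod_nonneg prod_le_1 mult_nonneg_nonneg mult_le_one step_bounds)
  have "bounded {x. \<phi> x \<noteq> 0}"
    by (rule bounded_subset[OF bounded_box[of a b]]) (use z in auto)
  then have "compact (closure {x. \<phi> x \<noteq> 0})"
    by (simp add: compact_eq_bounded_closed bounded_closure)
  moreover have "continuous_on UNIV (partial_deriv j \<phi>)" for j
    unfolding p D_def using c by (intro continuous_intros) auto
  ultimately show "\<phi> \<in> C1c UNIV"
    unfolding C1c_def using d by (auto simp: differentiable_def)
qed

lemma step_scaled_tendsto: "(\<lambda>n. step (real n * t)) \<longlonglongrightarrow> (if t > 0 then 1 else 0)"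
proof (cases "t > 0")
  case True
  obtain N where N: "real N * t > 3"
    using reals_Archimedean3[OF True] by blast
  have "eventually (\<lambda>n. step (real n * t) = 1) sequentially"
    unfolding eventually_sequentially
  proof (intro exI[of _ N] allI impI)
    fix n assume "N \<le> n"
    then have "real N * t \<le> real n * t"
      using True by simp
    then show "step (real n * t) = 1"
      using N by (intro step_eq_1) simp
  qed
  then show ?thesis
    using True by (simp add: tendsto_eventually)
next
  case False
  then have "step (real n * t) = 0" for n
    by (intro step_eq_0) (simp add: mult_nonneg_nonpos)
  then show ?thesis
    using False by simp
qed

text \<open>Boxes form an intersection-stable generator of the Borel sets. The total integral is a
  separate assumption because the whole space is not a box; it drives the complement step of the
  induction.\<close>

lemma AE_zero_if_box_integrals_zero:
  fixes F :: "'a::euclidean_space \<Rightarrow> real"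
  assumes F: "integrable lborel F" and z: "\<And>a b. (LINT x:box a b|lborel. F x) = 0"
    and tot: "(LINT x|lborel. F x) = 0"
  shows "AE x in lborel. F x = 0"
proof (rule density_unique_real[OF F])
  fix A :: "'a set" assume "A \<in> sets lborel"
  then have A: "A \<in> sigma_sets UNIV (range (\<lambda>(a, b). box a b :: 'a set))"
    by (simp add: borel_eq_box)
  have si: "set_integrable lborel A F" if "A \<in> sets borel" for A
    using F that by (simp add: set_integrable_def integrable_mult_indicator del: real_scaleR_def)
  have "(LINT x:A|lborel. F x) = 0"
  proof (rule sigma_sets_induct_disjoint[OF _ _ A])
    show "Int_stable (range (\<lambda>(a, b). box a b :: 'a set))"
      by (auto simp: Int_stable_def box_Int_box)
    show "(LINT x:A|lborel. F x) = 0" if "A \<in> range (\<lambda>(a, b). box a b)" for A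
      using that z by auto
    show "(LINT x:UNIV - A|lborel. F x) = 0"
      if "A \<in> sigma_sets UNIV (range (\<lambda>(a, b). box a b))" "(LINT x:A|lborel. F x) = 0" for A
    proof -
      have A: "A \<in> sets borel"
        using that by (simp add: borel_eq_box)
      have "(LINT x:A \<union> (UNIV - A)|lborel. F x) = (LINT x:A|lborel. F x) + (LINT x:UNIV - A|lborel. F x)"
        by (rule set_integral_Un) (use A in \<open>auto intro!: si\<close>)
      then show ?thesis
        using that tot by (simp add: set_lebesgue_integral_def)
    qed
    show "(LINT x:(\<Union>i. A i)|lborel. F x) = 0"
      if "disjoint_family A" "range A \<subseteq> sigma_sets UNIV (range (\<lambda>(a, b). box a b))" "\<And>i. (LINT x:A i|lborel. F x) = 0" for A :: "nat \<Rightarrow> 'a set"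
    proof -
      have A: "A i \<in> sets borel" for i
        using that(2) by (auto simp: borel_eq_box)
      have "(LINT x:(\<Union>i. A i)|lborel. F x) = (\<Sum>i. (LINT x:A i|lborel. F x))"
        by (rule lebesgue_integral_countable_add)
          (use A that(1) in \<open>auto intro!: si simp: disjoint_family_on_def\<close>)
      then show ?thesis
        using that(3) by simp
    qed
  qed (simp_all add: set_lebesgue_integral_def)
  then show "(LINT x:A|lborel. F x) = (LINT x:A|lborel. 0)"
    by (simp add: set_lebesgue_integral_def)
qed simp

text \<open>The fundamental lemma of the calculus of variations, by approximating indicators of
  boxes with test functions.\<close>

lemma AE_zero_if_orthogonal_C1c:
  fixes f :: "real^'n::finite \<Rightarrow> real"
  assumes f: "f \<in> borel_measurable lebesgue" "\<And>S. compact S \<Longrightarrow> set_integrable lebesgue S f"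
    and orth: "\<And>\<phi>. \<phi> \<in> C1c UNIV \<Longrightarrow> (LINT x|lebesgue. f x * \<phi> x) = 0"
  shows "AE x in lebesgue. f x = 0"
proof -
  \<comment> \<open>A Borel version is taken because boxes generate only the Borel sets.\<close>
  obtain h where h: "h \<in> borel_measurable lborel" "AE x in lborel. f x = h x"
    using completion_ex_borel_measurable_real[OF f(1)] by blast
  have h': "AE x in lebesgue. f x = h x"
    by (rule AE_completion[OF h(2)])
  have hl: "h \<in> borel_measurable lebesgue"
    using h(1) by (rule measurable_completion)
  have boxint: "integrable lborel (\<lambda>x. indicat_real (box a b) x *\<^sub>R h x)" for a b :: "real^'n"
  proof -
    have bm: "box a b \<in> sets lebesgue"
      by simp
    have "set_integrable lebesgue (box a b) f"
      by (rule set_integrable_subset[OF f(2)[of "cbox a b"]]) (auto simp: box_subset_cbox)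
    then have "integrable lebesgue (\<lambda>x. indicat_real (box a b) x *\<^sub>R f x)"
      by (simp add: set_integrable_def)
    moreover have "integrable lebesgue (\<lambda>x. indicat_real (box a b) x *\<^sub>R f x) \<longleftrightarrow> integrable lebesgue (\<lambda>x. indicat_real (box a b) x *\<^sub>R h x)"
    proof (rule integrable_cong_AE)
      show "AE x in lebesgue. indicat_real (box a b) x *\<^sub>R f x = indicat_real (box a b) x *\<^sub>R h x"
        using h' by eventually_elim simp
    qed (use bm f(1) hl in measurable)
    ultimately show ?thesis
      using h by (simp add: integrable_completion)
  qed
  have zero: "(LINT x:box a b|lborel. h x) = 0" for a b :: "real^'n"
  proof -
    have bm: "box a b \<in> sets lebesgue"
      by simp
    define \<phi> where "\<phi> n x = (\<Prod>i\<in>UNIV. step (real (Suc n) * (x $ i - a $ i)) * step (real (Suc n) * (b $ i - x $ i)))" for n and x :: "real^'n"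
    have b: "\<phi> n \<in> C1c UNIV" "\<And>x. x \<notin> box a b \<Longrightarrow> \<phi> n x = 0" "\<And>x. 0 \<le> \<phi> n x" "\<And>x. \<phi> n x \<le> 1" for n
      unfolding \<phi>_def using C1c_box_bump[where r="real (Suc n)" and a=a and b=b] by (simp_all del: of_nat_Suc)
    have m\<phi>: "\<phi> n \<in> borel_measurable lebesgue" for n
      using C1c_continuous(1)[OF b(1)] by (simp add: borel_measurable_continuous_onI measurable_completion)
    have lim: "(\<lambda>n. \<phi> n x) \<longlonglongrightarrow> indicat_real (box a b) x" for x
    proof -
      have "(\<lambda>n. \<phi> n x) \<longlonglongrightarrow> (\<Prod>i\<in>UNIV. (if x $ i - a $ i > 0 then 1 else 0) * (if b $ i - x $ i > 0 then 1 else 0))"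
        unfolding \<phi>_def
        by (intro tendsto_prod tendsto_mult LIMSEQ_Suc[OF step_scaled_tendsto])
      also have "(\<Prod>i\<in>UNIV. (if x $ i - a $ i > 0 then 1 else 0) * (if b $ i - x $ i > 0 then 1 else (0::real))) = indicat_real (box a b) x"
        by (auto simp: indicator_def mem_box_cart intro!: prod.neutral prod_zero)
      finally show ?thesis .
    qed
    have "(\<lambda>n. LINT x|lebesgue. f x * \<phi> n x) \<longlonglongrightarrow> (LINT x|lebesgue. f x * indicat_real (box a b) x)"
    proof (rule integral_dominated_convergence[where w="\<lambda>x. \<bar>indicat_real (cbox a b) x *\<^sub>R f x\<bar>"])
      show "integrable lebesgue (\<lambda>x. \<bar>indicat_real (cbox a b) x *\<^sub>R f x\<bar>)"
        using f(2)[of "cbox a b"] by (intro integrable_abs) (simp add: set_integrable_def)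
      show "AE x in lebesgue. (\<lambda>n. f x * \<phi> n x) \<longlonglongrightarrow> f x * indicat_real (box a b) x"
        by (intro always_eventually allI tendsto_mult_left lim)
      have "\<bar>f x * \<phi> n x\<bar> \<le> \<bar>indicat_real (cbox a b) x *\<^sub>R f x\<bar>" for n x
      proof (cases "x \<in> box a b")
        case True
        then have "x \<in> cbox a b"
          using box_subset_cbox by blast
        then show ?thesis
          using b(3,4)[of n x] by (simp add: abs_mult mult_left_le)
      qed (use b(2) in auto)
      then show "AE x in lebesgue. norm (f x * \<phi> n x) \<le> \<bar>indicat_real (cbox a b) x *\<^sub>R f x\<bar>" for n
        by simp
    qed (use f(1) m\<phi> bm in measurable)
    then have "(LINT x|lebesgue. f x * indicat_real (box a b) x) = 0"
      using orth[OF b(1)] by (simp add: LIMSEQ_const_iff)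
    also have "(LINT x|lebesgue. f x * indicat_real (box a b) x) = (LINT x|lebesgue. indicat_real (box a b) x *\<^sub>R h x)"
    proof (rule integral_cong_AE)
      show "AE x in lebesgue. f x * indicat_real (box a b) x = indicat_real (box a b) x *\<^sub>R h x"
        using h' by eventually_elim simp
    qed (use f(1) hl bm in measurable)
    also have "\<dots> = (LINT x:box a b|lborel. h x)"
      unfolding set_lebesgue_integral_def using h by (simp add: integral_completion)
    finally show ?thesis .
  qed
  \<comment> \<open>Integrability is only local, so the box criterion is applied on growing boxes;
    intersections of boxes are boxes again.\<close>
  have "AE x in lborel. indicat_real (box (- (real n *\<^sub>R One)) (real n *\<^sub>R One)) x *\<^sub>R h x = 0" for n
  proof (rule AE_zero_if_box_integrals_zero[OF boxint])
    show "(LINT x:box a b|lborel. indicat_real (box (- (real n *\<^sub>R One)) (real n *\<^sub>R One)) x *\<^sub>R h x) = 0" for a b :: "real^'n"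
      using zero unfolding set_lebesgue_integral_def
      by (simp add: box_Int_box mult.assoc[symmetric] indicator_inter_arith[symmetric])
    show "(LINT x|lborel. indicat_real (box (- (real n *\<^sub>R One)) (real n *\<^sub>R (One::real^'n))) x *\<^sub>R h x) = 0"
      using zero unfolding set_lebesgue_integral_def by simp
  qed
  then have "AE x in lborel. \<forall>n. indicat_real (box (- (real n *\<^sub>R One)) (real n *\<^sub>R One)) x *\<^sub>R h x = 0"
    by (subst AE_all_countable) blast
  then have "AE x in lborel. h x = 0"
  proof eventually_elim
    case (elim x)
    obtain n where "x \<in> box (- (real n *\<^sub>R One)) (real n *\<^sub>R One)"
      using UN_box_eq_UNIV by blast
    then show ?case
      using elim[rule_format, of n] by simp
  qed
  then have "AE x in lebesgue. h x = 0"
    by (rule AE_completion)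
  with h' show ?thesis
    by eventually_elim simp
qed

lemma Lp_loc_1_component:
  fixes G :: "real^'n::finite \<Rightarrow> real^'n^'n"
  assumes "G \<in> Lp_loc 1"
  shows "(\<lambda>x. G x $ i $ j) \<in> borel_measurable lebesgue"
    "compact S \<Longrightarrow> set_integrable lebesgue S (\<lambda>x. G x $ i $ j)"
proof -
  have G: "G \<in> borel_measurable lebesgue" "compact S \<Longrightarrow> set_integrable lebesgue S (\<lambda>x. norm (G x) powr 1)" for S
    using assms by (auto simp: Lp_loc_def)
  have "(\<lambda>x. G x \<bullet> axis i (axis j 1)) \<in> borel_measurable lebesgue"
    using G(1) by measurable
  then show m: "(\<lambda>x. G x $ i $ j) \<in> borel_measurable lebesgue"
    by (simp add: inner_axis)
  assume S: "compact S"
  show "set_integrable lebesgue S (\<lambda>x. G x $ i $ j)"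
    unfolding set_integrable_def
  proof (rule Bochner_Integration.integrable_bound)
    show "integrable lebesgue (\<lambda>x. indicat_real S x *\<^sub>R norm (G x) powr 1)"
      using G(2)[OF S] by (simp add: set_integrable_def)
    show "(\<lambda>x. indicat_real S x *\<^sub>R G x $ i $ j) \<in> borel_measurable lebesgue"
      using m S by (intro borel_measurable_scaleR borel_measurable_indicator) (auto simp: borel_compact)
    have "\<bar>G x $ i $ j\<bar> \<le> norm (G x)" for x
      using component_le_norm_cart[of "G x $ i" j] Finite_Cartesian_Product.norm_nth_le[of "G x" i] by simp
    then show "AE x in lebesgue. norm (indicat_real S x *\<^sub>R G x $ i $ j) \<le> norm (indicat_real S x *\<^sub>R norm (G x) powr 1)"
      by (auto simp: abs_mult intro!: mult_left_mono)
  qed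
qed

text \<open>The energy is defined with an unspecified weak gradient; this allows computing with an
  explicit one instead.\<close>

lemma weak_gradient_AE_unique:
  assumes G: "has_weak_gradient u G"
  shows "AE x in lebesgue. weak_gradient u x = G x"
proof -
  have H: "has_weak_gradient u (weak_gradient u)"
    unfolding weak_gradient_def by (rule someI[where P="has_weak_gradient u", OF G])
  let ?H = "weak_gradient u"
  have L: "G \<in> Lp_loc 1" "?H \<in> Lp_loc 1"
    using G H by (auto simp: has_weak_gradient_def)
  have ij: "AE x in lebesgue. ?H x $ i $ j - G x $ i $ j = 0" for i j
  proof (rule AE_zero_if_orthogonal_C1c)
    show "(\<lambda>x. ?H x $ i $ j - G x $ i $ j) \<in> borel_measurable lebesgue"
      using L[THEN Lp_loc_1_component(1)] by measurable
    show "set_integrable lebesgue S (\<lambda>x. ?H x $ i $ j - G x $ i $ j)" if "compact S" for S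
      using L[THEN Lp_loc_1_component(2)] that by (intro set_integral_diff) auto
    fix \<phi> :: "real^'a \<Rightarrow> real" assume \<phi>: "\<phi> \<in> C1c UNIV"
    have e: "(LINT x|lebesgue. ?H x $ i $ j * \<phi> x) = (LINT x|lebesgue. G x $ i $ j * \<phi> x)"
      using G H \<phi> by (auto simp: has_weak_gradient_def)
    have int: "integrable lebesgue (\<lambda>x. K x $ i $ j * \<phi> x)" if K: "K \<in> Lp_loc 1" for K :: "real^'a \<Rightarrow> real^'a^'a"
    proof -
      obtain R where R: "\<And>x. norm x > R \<Longrightarrow> \<phi> x = 0"
        using C1c_support[OF \<phi>] by metis
      obtain M where M: "M \<ge> 0" "\<And>x. \<bar>\<phi> x\<bar> \<le> M"
        using continuous_bounded_support_bounded[OF C1c_continuous(1)[OF \<phi>] R] by metis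
      have m\<phi>: "\<phi> \<in> borel_measurable lebesgue"
        using C1c_continuous(1)[OF \<phi>] by (simp add: borel_measurable_continuous_onI measurable_completion)
      show ?thesis
      proof (rule Bochner_Integration.integrable_bound)
        show "integrable lebesgue (\<lambda>x. M * (indicat_real (cball 0 R) x *\<^sub>R K x $ i $ j))"
          using Lp_loc_1_component(2)[OF K, of "cball 0 R"] by (intro integrable_mult_right) (simp add: set_integrable_def)
        show "(\<lambda>x. K x $ i $ j * \<phi> x) \<in> borel_measurable lebesgue"
          using Lp_loc_1_component(1)[OF K] m\<phi> by measurable
        have "\<bar>K x $ i $ j * \<phi> x\<bar> \<le> \<bar>M * (indicat_real (cball 0 R) x *\<^sub>R K x $ i $ j)\<bar>" for x
          using M R[of x] by (cases "norm x \<le> R") (auto simp: abs_mult mult.commute intro!: mult_right_mono)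
        then show "AE x in lebesgue. norm (K x $ i $ j * \<phi> x) \<le> norm (M * (indicat_real (cball 0 R) x *\<^sub>R K x $ i $ j))"
          by simp
      qed
    qed
    show "(LINT x|lebesgue. (?H x $ i $ j - G x $ i $ j) * \<phi> x) = 0"
      using e by (simp add: left_diff_distrib int L)
  qed
  have "AE x in lebesgue. \<forall>i j. ?H x $ i $ j - G x $ i $ j = 0"
    using ij by (auto intro!: eventually_all_finite)
  then show ?thesis
    by eventually_elim (simp add: vec_eq_iff)
qed


lemma W1p_locI:
  assumes G: "has_weak_gradient u G" and "u \<in> Lp_loc p" "G \<in> Lp_loc p"
  shows "u \<in> W1p_loc p"
proof -
  have "has_weak_gradient u (weak_gradient u)"
    unfolding weak_gradient_def by (rule someI[where P="has_weak_gradient u", OF G])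
  then have m: "weak_gradient u \<in> borel_measurable lebesgue"
    by (simp add: has_weak_gradient_def Lp_loc_def)
  have "set_integrable lebesgue S (\<lambda>x. norm (weak_gradient u x) powr p)" if S: "compact S" for S
  proof -
    have Sm: "S \<in> sets lebesgue"
      using S by (simp add: borel_compact)
    have mG: "G \<in> borel_measurable lebesgue"
      and "integrable lebesgue (\<lambda>x. indicat_real S x *\<^sub>R norm (G x) powr p)"
      using assms(3) S by (auto simp: Lp_loc_def set_integrable_def)
    moreover have "integrable lebesgue (\<lambda>x. indicat_real S x *\<^sub>R norm (G x) powr p) \<longleftrightarrow>
        integrable lebesgue (\<lambda>x. indicat_real S x *\<^sub>R norm (weak_gradient u x) powr p)"
    proof (rule integrable_cong_AE)
      show "AE x in lebesgue. indicat_real S x *\<^sub>R norm (G x) powr p = indicat_real S x *\<^sub>R norm (weak_gradient u x) powr p"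
        using weak_gradient_AE_unique[OF G] by eventually_elim simp
    qed (use m mG Sm in measurable)
    ultimately show ?thesis
      by (simp add: set_integrable_def)
  qed
  then show ?thesis
    using assms m by (auto simp: W1p_loc_def Lp_loc_def)
qed

section \<open>Slicing \<open>\<real>\<^sup>3\<close>\<close>

definition of_slice :: "real \<Rightarrow> complex \<Rightarrow> real^3"
  where "of_slice x w = vector [x, Re w, Im w]"

lemma of_slice_nth [simp]: "of_slice x w $ 1 = x" "of_slice x w $ 2 = Re w" "of_slice x w $ 3 = Im w"
  by (simp_all add: of_slice_def)

lemma continuous_of_slice: "continuous_on UNIV (\<lambda>p. of_slice (fst p) (snd p))"
  by (subst continuous_on_componentwise)
    (auto simp: Basis_vec_def inner_axis UNIV_3 intro!: continuous_intros)

text \<open>Lebesgue measure is determined by its values on boxes, and the preimage of a box is an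
  interval times a rectangle.\<close>

lemma lborel_slices: "(lborel :: (real^3) measure) = distr (lborel \<Otimes>\<^sub>M lborel) borel (\<lambda>(x, w). of_slice x w)"
proof (rule lborel_eqI)
  fix l u :: "real^3" assume lu: "\<And>b. b \<in> Basis \<Longrightarrow> l \<bullet> b \<le> u \<bullet> b"
  have le: "l $ i \<le> u $ i" for i
    using lu[of "axis i 1"] by (simp add: inner_axis axis_in_Basis_iff)
  have m: "(\<lambda>(x, w). of_slice x w) \<in> lborel \<Otimes>\<^sub>M lborel \<rightarrow>\<^sub>M borel"
    using borel_measurable_continuous_onI[OF continuous_of_slice] by (simp add: lborel_prod case_prod_beta')
  have pre: "(\<lambda>(x, w). of_slice x w) -` box l u \<inter> space (lborel \<Otimes>\<^sub>M lborel) =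
      box (l $ 1) (u $ 1) \<times> box (Complex (l $ 2) (l $ 3)) (Complex (u $ 2) (u $ 3))"
    by (auto simp: mem_box_cart forall_3 in_box_complex_iff space_pair_measure)
  have "emeasure (distr (lborel \<Otimes>\<^sub>M lborel) borel (\<lambda>(x, w). of_slice x w)) (box l u) =
      emeasure lborel (box (l $ 1) (u $ 1)) * emeasure lborel (box (Complex (l $ 2) (l $ 3)) (Complex (u $ 2) (u $ 3)))"
    unfolding emeasure_distr[OF m, of "box l u", simplified]
    by (subst pre[simplified]) (simp add: lborel.emeasure_pair_measure_Times)
  also have "\<dots> = ennreal (u $ 1 - l $ 1) * ennreal ((u $ 2 - l $ 2) * (u $ 3 - l $ 3))"
    using le by (simp add: emeasure_lborel_box_eq Basis_complex_def inner_complex_def)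
  also have "\<dots> = ennreal ((u $ 1 - l $ 1) * ((u $ 2 - l $ 2) * (u $ 3 - l $ 3)))"
    using le by (simp add: ennreal_mult)
  also have "(u $ 1 - l $ 1) * ((u $ 2 - l $ 2) * (u $ 3 - l $ 3)) = (\<Prod>b\<in>Basis. (u - l) \<bullet> b)"
  proof -
    have "(Basis :: (real^3) set) = (\<lambda>i. axis i 1) ` UNIV"
      by (auto simp: Basis_vec_def)
    then have "(\<Prod>b\<in>Basis. (u - l) \<bullet> b) = (\<Prod>b\<in>(\<lambda>i. axis i 1) ` UNIV. (u - l) \<bullet> b)"
      by (simp only:)
    also have "\<dots> = (\<Prod>i\<in>(UNIV::3 set). (u - l) \<bullet> axis i 1)"
      by (subst prod.reindex) (simp_all add: inj_on_def axis_eq_axis)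
    also have "\<dots> = (\<Prod>i\<in>(UNIV::3 set). u $ i - l $ i)"
      by (simp add: inner_axis)
    also have "\<dots> = (u $ 1 - l $ 1) * ((u $ 2 - l $ 2) * (u $ 3 - l $ 3))"
      unfolding UNIV_3 by simp
    finally show ?thesis ..
  qed
  finally show "emeasure (distr (lborel \<Otimes>\<^sub>M lborel) borel (\<lambda>(x, w). of_slice x w)) (box l u) = (\<Prod>b\<in>Basis. (u - l) \<bullet> b)" .
qed simp

lemma emeasure_eq_slices:
  fixes A :: "(real^3) set"
  assumes A: "A \<in> sets borel"
  shows "emeasure lborel A = (\<integral>\<^sup>+w. emeasure lborel {x. of_slice x w \<in> A} \<partial>lborel)"
proof -
  let ?f = "\<lambda>(x, w). of_slice x w"
  have m: "?f \<in> lborel \<Otimes>\<^sub>M lborel \<rightarrow>\<^sub>M borel"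
    using borel_measurable_continuous_onI[OF continuous_of_slice] by (simp add: lborel_prod case_prod_beta')
  have "emeasure lborel A = emeasure (lborel \<Otimes>\<^sub>M lborel) (?f -` A \<inter> space (lborel \<Otimes>\<^sub>M lborel))"
    unfolding lborel_slices by (rule emeasure_distr[OF m A])
  also have "\<dots> = (\<integral>\<^sup>+w. emeasure lborel ((\<lambda>x. (x, w)) -` (?f -` A \<inter> space (lborel \<Otimes>\<^sub>M lborel))) \<partial>lborel)"
    by (rule lborel_pair.emeasure_pair_measure_alt2) (rule measurable_sets[OF m A])
  also have "\<dots> = (\<integral>\<^sup>+w. emeasure lborel {x. of_slice x w \<in> A} \<partial>lborel)"
    by (simp add: space_pair_measure vimage_def)
  finally show ?thesis .
qed

text \<open>Tonelli. The kinks of the displacement meet each line parallel to the x_1-axis in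
  countably many points, however they vary from line to line.\<close>

lemma null_if_countable_slices:
  fixes A :: "(real^3) set"
  assumes A: "A \<in> sets borel" and "\<And>w. countable {x. of_slice x w \<in> A}"
  shows "AE x in lebesgue. x \<notin> A"
proof -
  have "emeasure lborel A = (\<integral>\<^sup>+w. emeasure lborel {x. of_slice x w \<in> A} \<partial>lborel)"
    by (rule emeasure_eq_slices[OF A])
  also have "\<dots> = (\<integral>\<^sup>+(w::complex). 0 \<partial>lborel)"
    using emeasure_lborel_countable[OF assms(2)] by simp
  finally have "A \<in> null_sets lborel"
    using A by (auto simp: null_sets_def)
  then show ?thesis
    by (intro AE_completion AE_not_in)
qed

text \<open>Linearity in the squared radius is what makes shells in \<open>rad\<close> have volume
  proportional to their width.\<close>

lemma emeasure_annulus: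
  assumes "0 \<le> a" "a \<le> b"
  shows "emeasure lborel {w::complex. a \<le> (Re w)\<^sup>2 + (Im w)\<^sup>2 \<and> (Re w)\<^sup>2 + (Im w)\<^sup>2 \<le> b} = ennreal (pi * (b - a))"
proof -
  have n: "norm w \<le> sqrt c \<longleftrightarrow> (Re w)\<^sup>2 + (Im w)\<^sup>2 \<le> c" "norm w < sqrt c \<longleftrightarrow> (Re w)\<^sup>2 + (Im w)\<^sup>2 < c" for w c
    by (simp_all add: cmod_def)
  have "{w::complex. a \<le> (Re w)\<^sup>2 + (Im w)\<^sup>2 \<and> (Re w)\<^sup>2 + (Im w)\<^sup>2 \<le> b} = cball 0 (sqrt b) - ball 0 (sqrt a)"
    by (auto simp: n not_less)
  also have "emeasure lborel \<dots> = emeasure lborel (cball (0::complex) (sqrt b)) - emeasure lborel (ball (0::complex) (sqrt a))"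
  proof (rule emeasure_Diff)
    show "emeasure lborel (ball (0::complex) (sqrt a)) \<noteq> \<infinity>"
      using emeasure_lborel_ball_finite[of "0::complex" "sqrt a"] by (rule less_imp_neq)
    have "sqrt a \<le> sqrt b"
      using assms by simp
    then show "ball (0::complex) (sqrt a) \<subseteq> cball 0 (sqrt b)"
      using ball_subset_cball subset_cball by blast
  qed auto
  also have "\<dots> = ennreal (pi * b) - ennreal (pi * a)"
    using assms by (simp add: emeasure_cball emeasure_ball unit_ball_vol_2)
  also have "\<dots> = ennreal (pi * (b - a))"
    using assms by (simp add: ennreal_minus algebra_simps)
  finally show ?thesis .
qed

text \<open>Tonelli with a uniform bound on the lines, of which only those over the annulus
  contribute.\<close>

lemma emeasure_slices_le:
  fixes A :: "(real^3) set"
  assumes A: "A \<in> sets borel" and ab: "0 \<le> a" "a \<le> b"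
    and q: "\<And>x. x \<in> A \<Longrightarrow> a \<le> (x $ 2)\<^sup>2 + (x $ 3)\<^sup>2 \<and> (x $ 2)\<^sup>2 + (x $ 3)\<^sup>2 \<le> b"
    and K: "\<And>w. emeasure lborel {x. of_slice x w \<in> A} \<le> ennreal K" and "K \<ge> 0"
  shows "emeasure lebesgue A \<le> ennreal (K * (pi * (b - a)))"
proof -
  let ?B = "{w::complex. a \<le> (Re w)\<^sup>2 + (Im w)\<^sup>2 \<and> (Re w)\<^sup>2 + (Im w)\<^sup>2 \<le> b}"
  have "closed ?B"
    by (intro closed_Collect_conj closed_Collect_le continuous_intros)
  then have B: "?B \<in> sets borel"
    by simp
  have "emeasure lebesgue A = (\<integral>\<^sup>+w. emeasure lborel {x. of_slice x w \<in> A} \<partial>lborel)"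
    using emeasure_eq_slices[OF A] A by simp
  also have "\<dots> \<le> (\<integral>\<^sup>+w. ennreal K * indicator ?B w \<partial>lborel)"
  proof (rule nn_integral_mono)
    fix w
    show "emeasure lborel {x. of_slice x w \<in> A} \<le> ennreal K * indicator ?B w"
    proof (cases "w \<in> ?B")
      case False
      then have "{x. of_slice x w \<in> A} = {}"
        using q by fastforce
      then show ?thesis
        by (simp only: emeasure_empty zero_le)
    qed (use K in auto)
  qed
  also have "\<dots> = ennreal K * ennreal (pi * (b - a))"
    using B by (simp add: nn_integral_cmult_indicator emeasure_annulus[OF ab])
  also have "\<dots> = ennreal (K * (pi * (b - a)))"
    using ab \<open>K \<ge> 0\<close> by (simp add: ennreal_mult)
  finally show ?thesis .
qed

section \<open>The triangle wave and its branching\<close>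

definition dist_int :: "real \<Rightarrow> real"
  where "dist_int y = \<bar>y - of_int (round y)\<bar>"

text \<open>The wave of period 1 and amplitude 1/4 with \<open>tri y = y\<close> for |y| \<le>
  1/4.\<close>

definition tri :: "real \<Rightarrow> real"
  where "tri y = dist_int (y + 1/4) - 1/4"

text \<open>The shift by a quarter period plays the role of the cosine: its sign is the derivative
  of the wave, and it vanishes exactly at the kinks.\<close>

definition slope :: "real \<Rightarrow> real"
  where "slope y = sgn (tri (y + 1/4))"

text \<open>\<open>tri - excess _ b\<close> truncates the wave at the levels \<open>\<plusminus>b\<close>, and \<open>tri - 2 * excess _ b\<close> reflects
  it there.\<close>

definition excess :: "real \<Rightarrow> real \<Rightarrow> real"
  where "excess y b = max 0 (tri y - b) - max 0 (- tri y - b)"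

text \<open>For \<open>0 \<le> b \<le> 1/4\<close> this is the primitive in \<open>y\<close> of \<open>- \<partial>\<^sub>b excess y b\<close> vanishing at the integers.
  It is periodic because the excess has mean 0.\<close>

definition compens :: "real \<Rightarrow> real \<Rightarrow> real"
  where "compens y b = max 0 (dist_int y - b) - max 0 (dist_int y - 1/2 + b)"

definition compens_deriv :: "real \<Rightarrow> real \<Rightarrow> real"
  where "compens_deriv y b = (if dist_int y > b then - 1 else 0) - (if dist_int y > 1/2 - b then 1 else 0)"

text \<open>Off the kinks and for levels in [0, 1/4], this is both - \<partial>_b
  \<open>excess\<close> and \<partial>_y \<open>compens\<close>, a coincidence that cancels the
  shear; \<open>excess_slope\<close> is \<partial>_y \<open>excess\<close>.\<close>

definition excess_sign :: "real \<Rightarrow> real \<Rightarrow> real"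
  where "excess_sign y b = (if \<bar>tri y\<bar> > b then sgn (tri y) else 0)"

definition excess_slope :: "real \<Rightarrow> real \<Rightarrow> real"
  where "excess_slope y b = (if \<bar>tri y\<bar> > b then slope y else 0)"

lemma dist_int_le: "dist_int y \<le> \<bar>y - of_int k\<bar>"
  unfolding dist_int_def using round_diff_minimal[of y k] by simp

lemma dist_int_bounds: "0 \<le> dist_int y" "dist_int y \<le> 1/2"
  unfolding dist_int_def using of_int_round_abs_le[of y] by (auto simp: abs_minus_commute)

lemma dist_int_eq:
  assumes "\<bar>y - of_int k\<bar> \<le> 1/2"
  shows "dist_int y = \<bar>y - of_int k\<bar>"
proof -
  have "\<bar>y - of_int (round y)\<bar> \<le> 1/2"
    using of_int_round_abs_le[of y] by (simp add: abs_minus_commute)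
  moreover have "dist_int y \<ge> \<bar>y - of_int k\<bar>"
  proof (cases "round y = k")
    case False
    then have "\<bar>real_of_int (round y) - of_int k\<bar> \<ge> 1"
      by linarith
    then show ?thesis
      unfolding dist_int_def using assms by linarith
  qed (simp add: dist_int_def)
  ultimately show ?thesis
    using dist_int_le[of y k] by simp
qed

lemma dist_int_lipschitz: "\<bar>dist_int x - dist_int y\<bar> \<le> \<bar>x - y\<bar>"
proof -
  have "dist_int x \<le> dist_int y + \<bar>x - y\<bar>" for x y
    using dist_int_le[of x "round y"] unfolding dist_int_def[of y] by linarith
  from this[of x y] this[of y x] show ?thesis
    by linarith
qed

lemma tri_lipschitz: "\<bar>tri x - tri y\<bar> \<le> \<bar>x - y\<bar>"
  using dist_int_lipschitz[of "x + 1/4" "y + 1/4"] by (simp add: tri_def)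

lemma tri_bound: "\<bar>tri y\<bar> \<le> 1/4"
  using dist_int_bounds[of "y + 1/4"] unfolding tri_def by linarith

text \<open>Explicit formulas on the rising and on the falling half-period, from which the
  identities between \<open>tri\<close>, \<open>dist_int\<close> and the shifted wave are read
  off.\<close>

lemma tri_cases:
  obtains (up) k :: int where "\<bar>y - of_int k\<bar> \<le> 1/4" "tri y = y - of_int k" "dist_int y = \<bar>y - of_int k\<bar>"
      "tri (y + 1/4) = 1/4 - \<bar>y - of_int k\<bar>"
  | (down) k :: int where "\<bar>y - of_int k - 1/2\<bar> \<le> 1/4" "tri y = of_int k + 1/2 - y"
      "dist_int y = 1/2 - \<bar>y - of_int k - 1/2\<bar>"
      "tri (y + 1/4) = \<bar>y - of_int k - 1/2\<bar> - 1/4"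
proof -
  \<comment> \<open>The period is counted from its trough at k - 1/4.\<close>
  define k where "k = \<lfloor>y + 1/4\<rfloor>"
  have k: "of_int k \<le> y + 1/4" "y + 1/4 < of_int k + 1"
    unfolding k_def by linarith+
  have k1: "real_of_int (k + 1) = of_int k + 1"
    by simp
  show ?thesis
  proof (cases "y + 1/4 \<le> of_int k + 1/2")
    case True
    have 1: "dist_int (y + 1/4) = \<bar>y + 1/4 - of_int k\<bar>"
      by (rule dist_int_eq) (use True k in linarith)
    have 4: "dist_int y = \<bar>y - of_int k\<bar>"
      by (rule dist_int_eq) (use True k in linarith)
    have 2: "tri (y + 1/4) = 1/4 - \<bar>y - of_int k\<bar>"
    proof (cases "y \<ge> of_int k")
      case True
      then have "dist_int (y + 1/4 + 1/4) = \<bar>y + 1/4 + 1/4 - of_int (k + 1)\<bar>"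
        using \<open>y + 1/4 \<le> of_int k + 1/2\<close> k k1 by (intro dist_int_eq) linarith
      then show ?thesis
        using True \<open>y + 1/4 \<le> of_int k + 1/2\<close> k by (simp add: tri_def)
    next
      case False
      then have "dist_int (y + 1/4 + 1/4) = \<bar>y + 1/4 + 1/4 - of_int k\<bar>"
        using k k1 by (intro dist_int_eq) linarith
      then show ?thesis
        using False k by (simp add: tri_def)
    qed
    show ?thesis
    proof (rule up[of k])
      show "\<bar>y - of_int k\<bar> \<le> 1/4"
        using True k by linarith
    qed (use True k 1 4 2 in \<open>auto simp: tri_def\<close>)
  next
    case False
    have 1: "dist_int (y + 1/4) = \<bar>y + 1/4 - of_int (k + 1)\<bar>"
      using False k k1 by (intro dist_int_eq) linarith
    have 2: "dist_int (y + 1/4 + 1/4) = \<bar>y + 1/4 + 1/4 - of_int (k + 1)\<bar>"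
      using False k k1 by (intro dist_int_eq) linarith
    have 3: "dist_int y = 1/2 - \<bar>y - of_int k - 1/2\<bar>"
    proof (cases "y \<ge> of_int k + 1/2")
      case True
      then have "dist_int y = \<bar>y - of_int (k + 1)\<bar>"
        using k k1 by (intro dist_int_eq) linarith
      then show ?thesis
        using True k by simp
    next
      case F: False
      then have "dist_int y = \<bar>y - of_int k\<bar>"
        using k False by (intro dist_int_eq) auto
      then show ?thesis
        using F False k by simp
    qed
    show ?thesis
    proof (rule down[of k])
      show "\<bar>y - of_int k - 1/2\<bar> \<le> 1/4"
        using False k by linarith
    qed (use False k 1 2 3 in \<open>auto simp: tri_def\<close>)
  qed
qed

text \<open>Turns the condition |tri| > b into the band b < dist_int < 1/2 - b, in which
  \<open>compens\<close> is not constant.\<close>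

lemma abs_tri_dist_int: "\<bar>tri y\<bar> = 1/4 - \<bar>dist_int y - 1/4\<bar>"
  by (cases y rule: tri_cases) auto

text \<open>Counterpart of sin^2 + cos^2 = 1: the wave is extremal exactly where its quarter shift
  vanishes.\<close>

lemma abs_tri_quarter: "\<bar>tri (y + 1/4)\<bar> = 1/4 - \<bar>tri y\<bar>"
  by (cases y rule: tri_cases) auto

lemma abs_tri_half_int:
  obtains k :: int where "\<bar>tri y\<bar> = \<bar>y - of_int k / 2\<bar>" "\<bar>y - of_int k / 2\<bar> \<le> 1/4"
proof (cases y rule: tri_cases)
  case (up k)
  show ?thesis
    by (rule that[of "2 * k"]) (use up in auto)
next
  case (down k)
  show ?thesis
  proof (rule that[of "2 * k + 1"])
    have "of_int (2 * k + 1) / 2 = real_of_int k + 1/2"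
      by simp
    then show "\<bar>tri y\<bar> = \<bar>y - of_int (2 * k + 1) / 2\<bar>" "\<bar>y - of_int (2 * k + 1) / 2\<bar> \<le> 1/4"
      using down by linarith+
  qed
qed

lemma tri_of_int: "tri (of_int k) = 0" "dist_int (of_int k) = 0"
  using dist_int_eq[of "of_int k + 1/4" k] dist_int_eq[of "of_int k" k] by (simp_all add: tri_def)

text \<open>The kinks of \<open>dist_int\<close> are the multiples of 1/2, which are the zeros of
  \<open>tri\<close>; between them the sign of \<open>tri\<close> is the slope.\<close>

lemma DERIV_dist_int:
  assumes "tri y \<noteq> 0"
  shows "(dist_int has_real_derivative sgn (tri y)) (at y)"
proof -
  have *: "(dist_int has_real_derivative sgn (y - of_int m)) (at y)"
    if "\<bar>y - of_int m\<bar> < 1/2" "y \<noteq> of_int m" for m :: int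
  proof (cases "y > of_int m")
    case True
    have "((\<lambda>y. y - of_int m) has_real_derivative 1) (at y)"
      by (auto intro!: derivative_eq_intros)
    then have "(dist_int has_real_derivative 1) (at y)"
      by (rule has_field_derivative_transform_within_open[where S="{of_int m<..<of_int m + 1/2}"])
        (use that True in \<open>auto simp: dist_int_eq[of _ m]\<close>)
    then show ?thesis
      using True by simp
  next
    case False
    have "((\<lambda>y. of_int m - y) has_real_derivative - 1) (at y)"
      by (auto intro!: derivative_eq_intros)
    then have "(dist_int has_real_derivative - 1) (at y)"
      by (rule has_field_derivative_transform_within_open[where S="{of_int m - 1/2<..<of_int m}"])
        (use that False in \<open>auto simp: dist_int_eq[of _ m]\<close>)
    then show ?thesis
      using False that by simp
  qed
  show ?thesis
  proof (cases y rule: tri_cases)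
    case (up k)
    then show ?thesis
      using *[of k] assms by auto
  next
    case (down k)
    show ?thesis
    proof (cases "tri y > 0")
      case True
      then show ?thesis
        using *[of k] down by auto
    next
      case False
      then show ?thesis
        using *[of "k + 1"] down assms by auto
    qed
  qed
qed

lemma DERIV_tri:
  assumes "\<bar>tri y\<bar> \<noteq> 1/4"
  shows "(tri has_real_derivative slope y) (at y)"
proof -
  have "tri (y + 1/4) \<noteq> 0"
    using assms abs_tri_quarter[of y] by auto
  then have "((\<lambda>y. dist_int (y + 1/4)) has_real_derivative slope y) (at y)"
    unfolding slope_def using DERIV_shift[of dist_int _ y "1/4"] DERIV_dist_int by blast
  then show ?thesis
    unfolding tri_def[abs_def] by (auto intro!: derivative_eq_intros)
qed

lemma DERIV_pos_part:
  fixes f :: "real \<Rightarrow> real"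
  assumes "(f has_real_derivative D) (at x)" "f x \<noteq> 0"
  shows "((\<lambda>x. max 0 (f x)) has_real_derivative (if f x > 0 then D else 0)) (at x)"
proof (cases "f x > 0")
  case True
  have "eventually (\<lambda>y. f y > 0) (nhds x)"
    using DERIV_isCont[OF assms(1)] True by (auto simp: isCont_def tendsto_at_iff_tendsto_nhds intro: order_tendstoD(1))
  then have "eventually (\<lambda>y. max 0 (f y) = f y) (nhds x)"
    by eventually_elim simp
  then show ?thesis
    using True assms(1) by (subst DERIV_cong_ev[OF refl _ refl]) auto
next
  case False
  then have "f x < 0"
    using assms by simp
  then have "eventually (\<lambda>y. f y < 0) (nhds x)"
    using DERIV_isCont[OF assms(1)] by (auto simp: isCont_def tendsto_at_iff_tendsto_nhds intro: order_tendstoD(2))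
  then have "eventually (\<lambda>y. max 0 (f y) = 0) (nhds x)"
    by eventually_elim simp
  then show ?thesis
    using False by (subst DERIV_cong_ev[OF refl _ refl]) auto
qed

lemma DERIV_excess:
  assumes "\<bar>tri y\<bar> \<noteq> 1/4" "\<bar>tri y\<bar> \<noteq> b" "b \<ge> 0"
  shows "((\<lambda>y. excess y b) has_real_derivative excess_slope y b) (at y)"
    and "((\<lambda>b. excess y b) has_real_derivative - excess_sign y b) (at b)"
proof -
  have "((\<lambda>y. max 0 (tri y - b)) has_real_derivative (if tri y - b > 0 then slope y else 0)) (at y)"
    by (rule DERIV_pos_part) (use assms in \<open>auto intro!: derivative_eq_intros DERIV_tri\<close>)
  moreover have "((\<lambda>y. max 0 (- tri y - b)) has_real_derivative (if - tri y - b > 0 then - slope y else 0)) (at y)"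
    by (rule DERIV_pos_part) (use assms in \<open>auto intro!: derivative_eq_intros DERIV_tri\<close>)
  ultimately have "((\<lambda>y. excess y b) has_real_derivative (if tri y - b > 0 then slope y else 0) - (if - tri y - b > 0 then - slope y else 0)) (at y)"
    unfolding excess_def by (rule DERIV_diff)
  then show "((\<lambda>y. excess y b) has_real_derivative excess_slope y b) (at y)"
    by (rule DERIV_cong) (use assms in \<open>auto simp: excess_slope_def\<close>)
  have "((\<lambda>b. max 0 (tri y - b)) has_real_derivative (if tri y - b > 0 then - 1 else 0)) (at b)"
    by (rule DERIV_pos_part) (use assms in \<open>auto intro!: derivative_eq_intros\<close>)
  moreover have "((\<lambda>b. max 0 (- tri y - b)) has_real_derivative (if - tri y - b > 0 then - 1 else 0)) (at b)"
    by (rule DERIV_pos_part) (use assms in \<open>auto intro!: derivative_eq_intros\<close>)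
  ultimately have "((\<lambda>b. excess y b) has_real_derivative (if tri y - b > 0 then - 1 else 0) - (if - tri y - b > 0 then - 1 else 0)) (at b)"
    unfolding excess_def by (rule DERIV_diff)
  then show "((\<lambda>b. excess y b) has_real_derivative - excess_sign y b) (at b)"
    by (rule DERIV_cong) (use assms in \<open>auto simp: sgn_if excess_sign_def\<close>)
qed

text \<open>The positive parts in \<open>compens\<close> switch at dist_int = b and dist_int = 1/2 -
  b, which is where |tri| = b; between these values the slope is that of
  \<open>dist_int\<close>.\<close>

lemma DERIV_compens:
  assumes "tri y \<noteq> 0" "\<bar>tri y\<bar> \<noteq> b" "b \<le> 1/4"
  shows "((\<lambda>y. compens y b) has_real_derivative excess_sign y b) (at y)"
    and "((\<lambda>b. compens y b) has_real_derivative compens_deriv y b) (at b)"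
proof -
  have ne: "dist_int y - b \<noteq> 0" "dist_int y - 1/2 + b \<noteq> 0"
    using assms(2,3) unfolding abs_tri_dist_int by auto
  have "((\<lambda>y. max 0 (dist_int y - b)) has_real_derivative (if dist_int y - b > 0 then sgn (tri y) else 0)) (at y)"
    by (rule DERIV_pos_part[where f="\<lambda>y. dist_int y - b"]) (use assms ne in \<open>auto intro!: derivative_eq_intros DERIV_dist_int\<close>)
  moreover have "((\<lambda>y. max 0 (dist_int y - 1/2 + b)) has_real_derivative (if dist_int y - 1/2 + b > 0 then sgn (tri y) else 0)) (at y)"
    by (rule DERIV_pos_part[where f="\<lambda>y. dist_int y - 1/2 + b"]) (use assms ne in \<open>auto intro!: derivative_eq_intros DERIV_dist_int\<close>)
  ultimately have "((\<lambda>y. compens y b) has_real_derivative (if dist_int y - b > 0 then sgn (tri y) else 0) - (if dist_int y - 1/2 + b > 0 then sgn (tri y) else 0)) (at y)"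
    unfolding compens_def by (rule DERIV_diff)
  then show "((\<lambda>y. compens y b) has_real_derivative excess_sign y b) (at y)"
    by (rule DERIV_cong) (use ne assms(3) in \<open>auto simp: abs_tri_dist_int excess_sign_def\<close>)
  have "((\<lambda>b. max 0 (dist_int y - b)) has_real_derivative (if dist_int y - b > 0 then - 1 else 0)) (at b)"
    by (rule DERIV_pos_part[where f="\<lambda>b. dist_int y - b"]) (use ne in \<open>auto intro!: derivative_eq_intros\<close>)
  moreover have "((\<lambda>b. max 0 (dist_int y - 1/2 + b)) has_real_derivative (if dist_int y - 1/2 + b > 0 then 1 else 0)) (at b)"
    by (rule DERIV_pos_part[where f="\<lambda>b. dist_int y - 1/2 + b"]) (use ne in \<open>auto intro!: derivative_eq_intros\<close>)
  ultimately have "((\<lambda>b. compens y b) has_real_derivative (if dist_int y - b > 0 then - 1 else 0) - (if dist_int y - 1/2 + b > 0 then 1 else 0)) (at b)"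
    unfolding compens_def by (rule DERIV_diff)
  then show "((\<lambda>b. compens y b) has_real_derivative compens_deriv y b) (at b)"
    by (rule DERIV_cong) (simp add: compens_deriv_def)
qed

lemma abs_compens_deriv_le: "\<bar>compens_deriv y b\<bar> \<le> 2"
  by (simp add: compens_deriv_def)

lemma compens_bound: "0 \<le> b \<Longrightarrow> b \<le> 1/4 \<Longrightarrow> \<bar>compens y b\<bar> \<le> 1/2"
  unfolding compens_def using dist_int_bounds[of y] by (auto simp: max_def)

text \<open>At the faces x_1 = 0 and x_1 = 1 every phase is an integer, so this and the next lemma
  give the boundary values there.\<close>

lemma compens_of_int: "0 \<le> b \<Longrightarrow> b \<le> 1/4 \<Longrightarrow> compens (of_int k) b = 0"
  by (simp add: compens_def tri_of_int)

lemma excess_of_int: "0 \<le> b \<Longrightarrow> excess (of_int k) b = 0"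
  by (simp add: excess_def tri_of_int)

lemma excess_0: "excess y 0 = tri y"
  by (simp add: excess_def max_def)

lemma excess_slope_quarter: "b \<ge> 1/4 \<Longrightarrow> excess_slope y b = 0"
  using tri_bound[of y] by (simp add: excess_slope_def)

text \<open>Folding at a third of the amplitude: each monotone branch of height 1/4 on either side
  becomes three branches of height 1/12. This is where the level 1/12 and the factor 3
  originate.\<close>

lemma tri_fold: "tri y - 2 * excess y (1/12) = tri (3 * y) / 3"
proof -
  have up: "tri t = t - of_int m" if "\<bar>t - of_int m\<bar> \<le> 1/4" for t and m :: int
  proof -
    have "dist_int (t + 1/4) = \<bar>t + 1/4 - of_int m\<bar>"
      by (rule dist_int_eq) (use that in linarith)
    then show ?thesis
      using that unfolding tri_def by linarith
  qed
  have down: "tri t = of_int m + 1/2 - t" if "\<bar>t - of_int m - 1/2\<bar> \<le> 1/4" for t and m :: int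
  proof -
    have "dist_int (t + 1/4) = \<bar>t + 1/4 - of_int (m + 1)\<bar>"
    proof (rule dist_int_eq)
      have "real_of_int (m + 1) = of_int m + 1"
        by simp
      then show "\<bar>t + 1/4 - of_int (m + 1)\<bar> \<le> 1/2"
        using that by linarith
    qed
    then show ?thesis
      using that unfolding tri_def by simp
  qed
  show ?thesis
  proof (cases y rule: tri_cases)
    case (up k)
    have e: "real_of_int (3 * k) = 3 * of_int k" "real_of_int (3 * k - 1) = 3 * of_int k - 1"
      by simp_all
    \<comment> \<open>The outer two pieces are the reflected tips, where 3 y lies on branches of the
      opposite direction.\<close>
    consider "y - of_int k < - 1/12" | "\<bar>y - of_int k\<bar> \<le> 1/12" | "y - of_int k > 1/12"
      by linarith
    then show ?thesis
    proof cases
      case 1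
      then have "tri (3 * y) = of_int (3 * k - 1) + 1/2 - 3 * y"
        using up(1) e by (intro down) linarith
      then show ?thesis
        using 1 up(2) by (simp add: excess_def max_def field_simps)
    next
      case 2
      then have "tri (3 * y) = 3 * y - of_int (3 * k)"
        using up(1) e by (intro \<open>\<And>t m. \<bar>t - of_int m\<bar> \<le> 1/4 \<Longrightarrow> tri t = t - of_int m\<close>) linarith
      then show ?thesis
        using 2 up(2) by (auto simp add: excess_def max_def field_simps)
    next
      case 3
      then have "tri (3 * y) = of_int (3 * k) + 1/2 - 3 * y"
        using up(1) e by (intro down) linarith
      then show ?thesis
        using 3 up(2) by (simp add: excess_def max_def field_simps)
    qed
  next
    case (down k)
    have e: "real_of_int (3 * k + 1) = 3 * of_int k + 1" "real_of_int (3 * k + 2) = 3 * of_int k + 2"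
      by simp_all
    consider "y - of_int k - 1/2 < - 1/12" | "\<bar>y - of_int k - 1/2\<bar> \<le> 1/12" | "y - of_int k - 1/2 > 1/12"
      by linarith
    then show ?thesis
    proof cases
      case 1
      then have "tri (3 * y) = 3 * y - of_int (3 * k + 1)"
        using down(1) e by (intro up) linarith
      then show ?thesis
        using 1 down(2) by (simp add: excess_def max_def field_simps)
    next
      case 2
      then have "tri (3 * y) = of_int (3 * k + 1) + 1/2 - 3 * y"
        using down(1) e by (intro \<open>\<And>t m. \<bar>t - of_int m - 1/2\<bar> \<le> 1/4 \<Longrightarrow> tri t = of_int m + 1/2 - t\<close>) linarith
      then show ?thesis
        using 2 down(2) by (auto simp add: excess_def max_def field_simps)
    next
      case 3
      then have "tri (3 * y) = 3 * y - of_int (3 * k + 2)"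
        using down(1) e by (intro up) linarith
      then show ?thesis
        using 3 down(2) by (simp add: excess_def max_def field_simps)
    qed
  qed
qed

text \<open>\<open>tri_fold\<close> differentiated, at a point that is a kink of none of the
  functions involved.\<close>

lemma slope_fold:
  assumes "\<bar>tri y\<bar> \<noteq> 1/4" "\<bar>tri y\<bar> \<noteq> 1/12" "\<bar>tri (3 * y)\<bar> \<noteq> 1/4"
  shows "slope y - 2 * excess_slope y (1/12) = slope (3 * y)"
proof -
  have "((\<lambda>y. tri y - 2 * excess y (1/12)) has_real_derivative slope y - 2 * excess_slope y (1/12)) (at y)"
    by (intro DERIV_diff DERIV_cmult DERIV_tri DERIV_excess assms) simp
  moreover have "((\<lambda>y. tri (3 * y)) has_real_derivative slope (3 * y) * 3) (at y)"
    by (rule DERIV_chain2[where f=tri and g="\<lambda>y. 3 * y"])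
      (use assms(3) in \<open>auto intro!: derivative_eq_intros DERIV_tri\<close>)
  then have "((\<lambda>y. tri (3 * y) / 3) has_real_derivative slope (3 * y)) (at y)"
    by (auto intro!: derivative_eq_intros)
  ultimately show ?thesis
    unfolding tri_fold by (rule DERIV_unique)
qed

section \<open>Jumps of the slope and size of level sets\<close>

lemma slope_cases:
  assumes "\<bar>tri y\<bar> \<noteq> 1/4"
  shows "slope y = 1 \<or> slope y = - 1"
  using assms abs_tri_quarter[of y] by (auto simp: slope_def sgn_if)

lemma abs_excess_slope_le: "\<bar>excess_slope y b\<bar> \<le> 1" "\<bar>slope y\<bar> \<le> 1"
  by (auto simp: excess_slope_def slope_def sgn_if)

text \<open>Where the slope changes, the quarter shift changes sign or vanishes. Being 1-Lipschitz,
  it is then at most |y - y'| in absolute value, so y is that close to a kink.\<close>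

lemma slope_jump:
  assumes "slope y \<noteq> slope y'"
  shows "\<bar>\<bar>tri y\<bar> - 1/4\<bar> \<le> \<bar>y - y'\<bar>"
proof -
  have "\<bar>tri (y + 1/4)\<bar> \<le> \<bar>tri (y + 1/4) - tri (y' + 1/4)\<bar>"
    using assms by (auto simp: slope_def sgn_if split: if_splits)
  also have "\<dots> \<le> \<bar>y - y'\<bar>"
    using tri_lipschitz[of "y + 1/4" "y' + 1/4"] by simp
  finally show ?thesis
    using tri_bound[of y] by (simp add: abs_tri_quarter)
qed

text \<open>If the slopes agree, exactly one of the two points exceeds its level, and Lipschitz
  continuity puts y close to the level; otherwise a kink is near.\<close>

lemma excess_slope_jump:
  assumes "excess_slope y b \<noteq> excess_slope y' b'"
  shows "\<bar>\<bar>tri y\<bar> - 1/4\<bar> \<le> \<bar>y - y'\<bar> + \<bar>b - b'\<bar> \<or> \<bar>\<bar>tri y\<bar> - b\<bar> \<le> \<bar>y - y'\<bar> + \<bar>b - b'\<bar>"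
proof (cases "slope y = slope y'")
  case True
  then have "(\<bar>tri y\<bar> > b) \<noteq> (\<bar>tri y'\<bar> > b')"
    using assms by (auto simp: excess_slope_def split: if_splits)
  then show ?thesis
    using tri_lipschitz[of y y'] by linarith
next
  case False
  then show ?thesis
    using slope_jump[OF False] by linarith
qed

lemma countable_tri_level:
  assumes "n > 0"
  shows "countable {x. \<bar>tri (real n * x)\<bar> = a}"
proof (rule countable_subset)
  show "{x. \<bar>tri (real n * x)\<bar> = a} \<subseteq> range (\<lambda>k::int. (of_int k / 2 + a) / n) \<union> range (\<lambda>k::int. (of_int k / 2 - a) / n)"
  proof
    fix x assume x: "x \<in> {x. \<bar>tri (real n * x)\<bar> = a}"
    obtain k :: int where "\<bar>tri (real n * x)\<bar> = \<bar>real n * x - of_int k / 2\<bar>"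
      by (rule abs_tri_half_int[of "real n * x"])
    then have "real n * x = of_int k / 2 + a \<or> real n * x = of_int k / 2 - a"
      using x by auto
    then have "x = (of_int k / 2 + a) / n \<or> x = (of_int k / 2 - a) / n"
      using assms by (simp add: field_simps)
    then show "x \<in> range (\<lambda>k::int. (of_int k / 2 + a) / n) \<union> range (\<lambda>k::int. (of_int k / 2 - a) / n)"
      by auto
  qed
qed auto

text \<open>The set lies in two intervals of length 2 \<delta> / n for each zero k / (2 n) of the
  wave. At most 2 n + 3 \<le> 5 n zeros are relevant to [0, 1], which gives 20 \<delta>
  independently of n.\<close>

lemma emeasure_tri_level_le:
  assumes "n > 0" "\<delta> \<ge> 0"
  shows "emeasure lborel {x. 0 \<le> x \<and> x \<le> 1 \<and> \<bar>\<bar>tri (real n * x)\<bar> - a\<bar> \<le> \<delta>} \<le> ennreal (20 * \<delta>)"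
proof -
  let ?I = "\<lambda>c. cbox ((c - \<delta>) / n) ((c + \<delta>) / n)"
  let ?K = "{- 1..2 * int n + 1}"
  let ?U = "\<Union>k\<in>?K. ?I (of_int k / 2 + a) \<union> ?I (of_int k / 2 - a)"
  have "{x. 0 \<le> x \<and> x \<le> 1 \<and> \<bar>\<bar>tri (real n * x)\<bar> - a\<bar> \<le> \<delta>} \<subseteq> ?U"
  proof
    fix x assume "x \<in> {x. 0 \<le> x \<and> x \<le> 1 \<and> \<bar>\<bar>tri (real n * x)\<bar> - a\<bar> \<le> \<delta>}"
    then have x: "0 \<le> x" "x \<le> 1" "\<bar>\<bar>tri (real n * x)\<bar> - a\<bar> \<le> \<delta>"
      by auto
    obtain k :: int where k: "\<bar>tri (real n * x)\<bar> = \<bar>real n * x - of_int k / 2\<bar>" "\<bar>real n * x - of_int k / 2\<bar> \<le> 1/4"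
      by (rule abs_tri_half_int[of "real n * x"])
    have "0 \<le> real n * x" "real n * x \<le> n"
      using x assms mult_left_mono[of x 1 "real n"] by auto
    then have "real_of_int k \<ge> - 1" "real_of_int k \<le> 2 * real n + 1"
      using k by linarith+
    then have kK: "k \<in> ?K"
      by simp
    have "\<bar>real n * x - (of_int k / 2 + a)\<bar> \<le> \<delta> \<or> \<bar>real n * x - (of_int k / 2 - a)\<bar> \<le> \<delta>"
      using x k by linarith
    then have "x \<in> ?I (of_int k / 2 + a) \<union> ?I (of_int k / 2 - a)"
      using assms by (auto simp: field_simps abs_le_iff)
    then show "x \<in> ?U"
      using kK by blast
  qed
  then have "emeasure lborel {x. 0 \<le> x \<and> x \<le> 1 \<and> \<bar>\<bar>tri (real n * x)\<bar> - a\<bar> \<le> \<delta>} \<le> emeasure lborel ?U"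
    by (rule emeasure_mono) auto
  also have "\<dots> \<le> (\<Sum>k\<in>?K. emeasure lborel (?I (of_int k / 2 + a) \<union> ?I (of_int k / 2 - a)))"
    by (rule emeasure_subadditive_finite) auto
  also have "\<dots> \<le> (\<Sum>k\<in>?K. ennreal (4 * \<delta> / n))"
  proof (rule sum_mono)
    fix k
    have I: "emeasure lborel (?I c) = ennreal (2 * \<delta> / n)" for c
    proof -
      have "emeasure lborel (?I c) = ennreal ((c + \<delta>) / n - (c - \<delta>) / n)"
        using assms by (simp add: divide_right_mono)
      also have "(c + \<delta>) / n - (c - \<delta>) / n = 2 * \<delta> / n"
        by (simp add: diff_divide_distrib[symmetric])
      finally show ?thesis .
    qed
    have "emeasure lborel (?I (of_int k / 2 + a) \<union> ?I (of_int k / 2 - a)) \<le>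
       emeasure lborel (?I (of_int k / 2 + a)) + emeasure lborel (?I (of_int k / 2 - a))"
      by (rule emeasure_subadditive) auto
    also have "\<dots> = ennreal (4 * \<delta> / n)"
      using assms unfolding I by (subst ennreal_plus[symmetric]) auto
    finally show "emeasure lborel (?I (of_int k / 2 + a) \<union> ?I (of_int k / 2 - a)) \<le> ennreal (4 * \<delta> / n)" .
  qed
  also have "\<dots> = ennreal (\<Sum>k\<in>?K. 4 * \<delta> / n)"
    using assms by (intro sum_ennreal) simp
  also have "\<dots> = ennreal (real (2 * n + 3) * (4 * \<delta> / n))"
    by (simp add: nat_add_distrib nat_mult_distrib add.commute)
  also have "ennreal (real (2 * n + 3) * (4 * \<delta> / n)) \<le> ennreal (20 * \<delta>)"
  proof (rule ennreal_leI)
    have "(2 * real n + 3) * (4 * \<delta>) \<le> (5 * real n) * (4 * \<delta>)"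
      by (rule mult_right_mono) (use assms in auto)
    then show "real (2 * n + 3) * (4 * \<delta> / n) \<le> 20 * \<delta>"
      using assms by (simp add: field_simps)
  qed
  finally show ?thesis
    by simp
qed

lemma locally_lipschitz_dist_int: "locally_lipschitz dist_int"
  unfolding locally_lipschitz_def using dist_int_lipschitz by (auto intro!: exI[of _ 1])

lemma locally_lipschitz_tri: "locally_lipschitz tri"
  unfolding locally_lipschitz_def using tri_lipschitz by (auto intro!: exI[of _ 1])

lemma locally_lipschitz_excess:
  assumes "locally_lipschitz f" "locally_lipschitz g"
  shows "locally_lipschitz (\<lambda>x. excess (f x) (g x))"
  unfolding excess_def
  by (intro locally_lipschitz_diff locally_lipschitz_max locally_lipschitz_const locally_lipschitz_minus
      locally_lipschitz_compose[OF locally_lipschitz_tri] assms)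

lemma locally_lipschitz_compens:
  assumes "locally_lipschitz f" "locally_lipschitz g"
  shows "locally_lipschitz (\<lambda>x. compens (f x) (g x))"
  unfolding compens_def
  by (intro locally_lipschitz_diff locally_lipschitz_add locally_lipschitz_max locally_lipschitz_const
      locally_lipschitz_compose[OF locally_lipschitz_dist_int] assms)

section \<open>The construction\<close>

lemma add_axis_nth: "(x + t *\<^sub>R axis k 1) $ i = x $ i + (if i = k then t else (0::real))"
  by (simp add: axis_def)

lemma has_partial_const: "has_partial k (\<lambda>_. c) 0 x"
  by (simp add: has_partial_def)

lemma has_partial_component: "has_partial k (\<lambda>x. x $ i) (if i = k then 1 else 0) x"
  unfolding has_partial_def add_axis_nth by (auto intro!: derivative_eq_intros)

lemma has_partial_add:
  "has_partial k f D x \<Longrightarrow> has_partial k g E x \<Longrightarrow> has_partial k (\<lambda>x. f x + g x) (D + E) x"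
  unfolding has_partial_def by (rule DERIV_add)

lemma has_partial_diff:
  "has_partial k f D x \<Longrightarrow> has_partial k g E x \<Longrightarrow> has_partial k (\<lambda>x. f x - g x) (D - E) x"
  unfolding has_partial_def by (rule DERIV_diff)

lemma has_partial_minus: "has_partial k f D x \<Longrightarrow> has_partial k (\<lambda>x. - f x) (- D) x"
  unfolding has_partial_def by (rule DERIV_minus)

lemma has_partial_cmult: "has_partial k f D x \<Longrightarrow> has_partial k (\<lambda>x. c * f x) (c * D) x"
  unfolding has_partial_def by (rule DERIV_cmult)

lemma has_partial_mult:
  "has_partial k f D x \<Longrightarrow> has_partial k g E x \<Longrightarrow> has_partial k (\<lambda>x. f x * g x) (D * g x + E * f x) x"
  unfolding has_partial_def by (drule (1) DERIV_mult) simp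

lemma has_partial_sum:
  "(\<And>i. i \<in> I \<Longrightarrow> has_partial k (f i) (D i) x) \<Longrightarrow> has_partial k (\<lambda>x. \<Sum>i\<in>I. f i x) (\<Sum>i\<in>I. D i) x"
  unfolding has_partial_def by (rule DERIV_sum)

lemma has_partial_chain:
  assumes "(g has_real_derivative D) (at (f x))" "has_partial k f d x"
  shows "has_partial k (\<lambda>x. g (f x)) (D * d) x"
  using assms unfolding has_partial_def by (intro DERIV_chain2[where f=g]) simp_all

text \<open>Only the first argument varies in direction k, so separate differentiability of F
  suffices.\<close>

lemma has_partial_fst:
  assumes "((\<lambda>y. F y (g x)) has_real_derivative D) (at (f x))" "has_partial k f d x"
    and "\<And>t. g (x + t *\<^sub>R axis k 1) = g x"
  shows "has_partial k (\<lambda>x. F (f x) (g x)) (D * d) x"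
  using has_partial_chain[where g="\<lambda>y. F y (g x)", OF assms(1,2)] unfolding has_partial_def assms(3) .

lemma has_partial_snd:
  assumes "((\<lambda>y. F (f x) y) has_real_derivative D) (at (g x))" "has_partial k g d x"
    and "\<And>t. f (x + t *\<^sub>R axis k 1) = f x"
  shows "has_partial k (\<lambda>x. F (f x) (g x)) (D * d) x"
  using has_partial_chain[where g="\<lambda>y. F (f x) y", OF assms(1,2)] unfolding has_partial_def assms(3) .

lemma has_partial_cong:
  assumes "has_partial k f D x" "D = E"
  shows "has_partial k f E x"
  using assms by simp

lemma has_partial_transform:
  assumes "has_partial k f D x" "open S" "x \<in> S" "\<And>y. y \<in> S \<Longrightarrow> f y = g y"
  shows "has_partial k g D x"
  unfolding has_partial_def
proof (rule has_field_derivative_transform_within_open)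
  show "((\<lambda>t. f (x + t *\<^sub>R axis k 1)) has_real_derivative D) (at 0)"
    using assms(1) by (simp add: has_partial_def)
  have "continuous_on UNIV (\<lambda>t. x + t *\<^sub>R axis k 1)"
    by (intro continuous_intros)
  then show "open ((\<lambda>t. x + t *\<^sub>R axis k 1) -` S)"
    using assms(2) by (simp add: continuous_on_open_vimage)
qed (use assms in auto)

section \<open>Coordinates adapted to the cylinder\<close>

definition rad :: "real^3 \<Rightarrow> real"
  where "rad x = (x $ 2)\<^sup>2 + (x $ 3)\<^sup>2"

text \<open>Freezing x_1 outside [0, 1] keeps every phase at an integer there, so the oscillation
  vanishes beyond the two faces.\<close>

definition clamp1 :: "real^3 \<Rightarrow> real"
  where "clamp1 x = max 0 (min 1 (x $ 1))"

lemma mem_cylinder: "x \<in> cylinder \<longleftrightarrow> 0 < x $ 1 \<and> x $ 1 < 1 \<and> rad x < 1"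
proof -
  have "(vector [x $ 2, x $ 3] :: real^2) \<in> ball 0 1 \<longleftrightarrow> sqrt (rad x) < 1"
    by (simp add: rad_def norm_vec_def L2_set_def UNIV_2)
  then show ?thesis
    by (auto simp: cylinder_def)
qed

lemma rad_axis_1: "rad (x + t *\<^sub>R axis 1 1) = rad x"
  unfolding rad_def add_axis_nth by simp

lemma clamp1_axis: "k \<noteq> 1 \<Longrightarrow> clamp1 (x + t *\<^sub>R axis k 1) = clamp1 x"
  unfolding clamp1_def add_axis_nth by simp

lemma has_partial_rad: "has_partial k rad (if k = 1 then 0 else 2 * x $ k) x"
proof -
  have "has_partial k (\<lambda>x. (x $ 2)\<^sup>2 + (x $ 3)\<^sup>2) ((if 2 = k then 1 else 0) * x $ 2 + (if 2 = k then 1 else 0) * x $ 2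
      + ((if 3 = k then 1 else 0) * x $ 3 + (if 3 = k then 1 else 0) * x $ 3)) x"
    unfolding power2_eq_square by (intro has_partial_add has_partial_mult has_partial_component)
  then show ?thesis
    unfolding rad_def[abs_def] using exhaust_3[of k] by (elim has_partial_cong) auto
qed

lemma has_partial_clamp1:
  assumes "0 < x $ 1" "x $ 1 < 1"
  shows "has_partial 1 clamp1 1 x"
proof (rule has_partial_transform)
  show "has_partial 1 (\<lambda>x. x $ 1) 1 x"
    using has_partial_component[of 1 1 x] by simp
  show "open {x::real^3. 0 < x $ 1 \<and> x $ 1 < 1}"
    by (intro open_Collect_conj open_Collect_less continuous_intros)
qed (use assms in \<open>auto simp: clamp1_def\<close>)

lemma locally_lipschitz_rad: "locally_lipschitz rad"
  unfolding rad_def[abs_def] by (intro locally_lipschitz_intros)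

lemma locally_lipschitz_clamp1: "locally_lipschitz clamp1"
  unfolding clamp1_def[abs_def] by (intro locally_lipschitz_intros)

section \<open>Geometry of the shells\<close>

text \<open>Up to a constant, \<open>N * \<rho> ^ j\<close> is the width of shell j divided by the
  period of its wave; the last assumption keeps this ratio at least 1 in all shells up to J. The
  value of \<rho> is fixed only in \<open>elastic_sum_le\<close>.\<close>

locale branching =
  fixes \<rho> :: real and N J :: nat
  assumes rho: "0 < \<rho>" "\<rho> < 1" and N: "N > 0" and J: "1 \<le> N * \<rho> ^ J"
begin

definition freq :: "nat \<Rightarrow> nat"
  where "freq j = N * 3 ^ j"

definition rim :: "nat \<Rightarrow> real"
  where "rim j = 1 - (\<rho> / 3) ^ j"

text \<open>A third of the width of shell j, because \<open>step\<close> makes its transition on an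
  interval of length 3.\<close>

definition len :: "nat \<Rightarrow> real"
  where "len j = (1 - \<rho> / 3) * (\<rho> / 3) ^ j / 3"

text \<open>The level drops from \<open>1/4\<close> to \<open>1/12\<close>, where reflection triples the frequency, except in the last
  shell, where it drops to 0 and truncation flattens the wave; \<open>weight\<close> distinguishes reflection
  from truncation.\<close>

definition drop_height :: "nat \<Rightarrow> real"
  where "drop_height j = (if j < J then 1/6 else 1/4)"

definition weight :: "nat \<Rightarrow> real"
  where "weight j = (if j < J then 2 else 1)"

definition lev :: "nat \<Rightarrow> real \<Rightarrow> real"
  where "lev j q = 1/4 - drop_height j * step ((q - rim j) / len j)"

definition lev1 :: "nat \<Rightarrow> real \<Rightarrow> real"
  where "lev1 j q = - (drop_height j / len j * step1 ((q - rim j) / len j))"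

definition lev2 :: "nat \<Rightarrow> real \<Rightarrow> real"
  where "lev2 j q = - (drop_height j / (len j)\<^sup>2 * step2 ((q - rim j) / len j))"

lemma freq_pos: "freq j > 0"
  using N by (simp add: freq_def)

lemma freq_Suc: "freq (Suc j) = 3 * freq j"
  by (simp add: freq_def)

lemma len_pos: "len j > 0"
  using rho by (simp add: len_def)

lemma len_le: "len j \<le> 1"
proof -
  have "(1 - \<rho> / 3) * (\<rho> / 3) ^ j \<le> 1 * 1"
    using rho by (intro mult_mono power_le_one) auto
  then show ?thesis
    by (simp add: len_def)
qed

lemma rim_Suc: "rim (Suc j) = rim j + 3 * len j"
  by (simp add: rim_def len_def field_simps)

lemma rim_mono: "i \<le> j \<Longrightarrow> rim i \<le> rim j"
  using rho by (simp add: rim_def power_decreasing)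

lemma rim_0: "rim 0 = 0"
  by (simp add: rim_def)

lemma rim_bounds: "0 \<le> rim j" "rim j < 1"
  using rho by (auto simp: rim_def power_le_one)

lemma drop_height_bounds: "0 < drop_height j" "drop_height j \<le> 1/4"
  by (auto simp: drop_height_def)

lemma weight_bounds: "0 < weight j" "weight j \<le> 2"
  by (auto simp: weight_def)

lemma DERIV_lev: "(lev j has_real_derivative lev1 j q) (at q)"
proof -
  have "((\<lambda>q. step ((q - rim j) / len j)) has_real_derivative step1 ((q - rim j) / len j) * (1 / len j)) (at q)"
    by (rule DERIV_chain2[OF DERIV_step]) (use len_pos[of j] in \<open>auto intro!: derivative_eq_intros\<close>)
  then show ?thesis
    unfolding lev_def[abs_def] lev1_def by (auto intro!: derivative_eq_intros)
qed

lemma DERIV_lev1: "(lev1 j has_real_derivative lev2 j q) (at q)"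
proof -
  have "((\<lambda>q. step1 ((q - rim j) / len j)) has_real_derivative step2 ((q - rim j) / len j) * (1 / len j)) (at q)"
    by (rule DERIV_chain2[OF DERIV_step1]) (use len_pos[of j] in \<open>auto intro!: derivative_eq_intros\<close>)
  then show ?thesis
    unfolding lev1_def[abs_def] lev2_def
    using len_pos[of j] by (auto intro!: derivative_eq_intros simp: power2_eq_square)
qed

lemma lev_bounds: "0 \<le> lev j q" "lev j q \<le> 1/4"
proof -
  have "drop_height j * step ((q - rim j) / len j) \<le> 1/4 * 1"
    by (intro mult_mono drop_height_bounds step_bounds) auto
  then show "0 \<le> lev j q"
    by (simp add: lev_def)
  show "lev j q \<le> 1/4"
    using drop_height_bounds[of j] step_bounds by (simp add: lev_def)
qed

lemma abs_lev1_le: "\<bar>lev1 j q\<bar> \<le> 1 / (4 * len j)"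
proof -
  have "\<bar>lev1 j q\<bar> = drop_height j * step1 ((q - rim j) / len j) / len j"
    using drop_height_bounds[of j] step1_bounds[of "(q - rim j) / len j"] len_pos[of j]
    by (simp add: lev1_def abs_mult)
  also have "drop_height j * step1 ((q - rim j) / len j) \<le> 1/4 * 1"
    using drop_height_bounds[of j] by (intro mult_mono step1_bounds) auto
  finally show ?thesis
    using len_pos[of j] by (simp add: divide_right_mono)
qed

lemma abs_lev2_le: "\<bar>lev2 j q\<bar> \<le> 1 / (4 * (len j)\<^sup>2)"
proof -
  have "\<bar>lev2 j q\<bar> = drop_height j * \<bar>step2 ((q - rim j) / len j)\<bar> / (len j)\<^sup>2"
    using drop_height_bounds[of j] by (simp add: lev2_def abs_mult)
  also have "drop_height j * \<bar>step2 ((q - rim j) / len j)\<bar> \<le> 1/4 * 1"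
    using drop_height_bounds[of j] by (intro mult_mono step2_bound) auto
  finally show ?thesis
    using len_pos[of j] by (simp add: divide_right_mono)
qed

text \<open>Since 1/4 is the amplitude of the wave, a summand contributes no excess on the axis side
  of its shell.\<close>

lemma lev_inside:
  assumes "q \<le> rim j"
  shows "lev j q = 1/4" "lev1 j q = 0" "lev2 j q = 0"
proof -
  have "(q - rim j) / len j \<le> 0"
    using assms len_pos[of j] by (simp add: divide_nonpos_pos)
  then show "lev j q = 1/4" "lev1 j q = 0" "lev2 j q = 0"
    by (simp_all add: lev_def lev1_def lev2_def step_eq_0)
qed

lemma lev_outside:
  assumes "q \<ge> rim (Suc j)"
  shows "lev j q = 1/4 - drop_height j" "lev1 j q = 0" "lev2 j q = 0"
proof -
  have "(q - rim j) / len j \<ge> 3"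
    using assms len_pos[of j] by (simp add: rim_Suc field_simps)
  then show "lev j q = 1/4 - drop_height j" "lev1 j q = 0" "lev2 j q = 0"
    by (simp_all add: lev_def lev1_def lev2_def step_eq_1)
qed

lemma lev_lipschitz: "\<bar>lev j q - lev j q'\<bar> \<le> \<bar>q - q'\<bar> / (4 * len j)"
proof -
  have "norm (lev j q - lev j q') \<le> (1 / (4 * len j)) * norm (q - q')"
    by (rule field_differentiable_bound[of UNIV "lev j" "lev1 j"])
      (use abs_lev1_le in \<open>auto simp: DERIV_lev\<close>)
  then show ?thesis
    by simp
qed

lemma locally_lipschitz_lev: "locally_lipschitz (\<lambda>x. lev j (rad x))" "locally_lipschitz (\<lambda>x. lev1 j (rad x))"
  unfolding lev_def lev1_def
  by (intro locally_lipschitz_intros locally_lipschitz_compose[OF locally_lipschitz_step(1)]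
      locally_lipschitz_compose[OF locally_lipschitz_step(2)] locally_lipschitz_rad)+

section \<open>The displacement and its boundary values\<close>

text \<open>One formula for all shells instead of a piecewise definition: a summand is 0 on the axis
  side of its shell and no longer depends on \<open>rad\<close> beyond it, so continuity across the
  rims is automatic.\<close>

definition v :: "real^3 \<Rightarrow> real"
  where "v x = tri (N * clamp1 x) / N
    - (\<Sum>j\<le>J. weight j / freq j * excess (freq j * clamp1 x) (lev j (rad x)))"

definition V :: "real^3 \<Rightarrow> real"
  where "V x = (\<Sum>j\<le>J. weight j / (freq j)\<^sup>2 * (compens (freq j * clamp1 x) (lev j (rad x)) * lev1 j (rad x)))"

text \<open>The component \<open>- x\<^sub>k V\<close> cancels the shear \<open>\<partial>\<^sub>k u\<^sub>1\<close>, since \<open>\<partial>\<^sub>k v = 2 x\<^sub>k \<partial>\<^sub>1 V\<close>.\<close>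

definition u :: "real^3 \<Rightarrow> real^3"
  where "u x = vector [x $ 1 / 2 + v x / 2, - (x $ 2 * V x), - (x $ 3 * V x)]"

lemma u_nth: "u x $ 1 = x $ 1 / 2 + v x / 2" "u x $ 2 = - (x $ 2 * V x)" "u x $ 3 = - (x $ 3 * V x)"
  by (simp_all add: u_def)

lemma locally_lipschitz_u: "locally_lipschitz (\<lambda>x. u x $ i)"
proof -
  have v: "locally_lipschitz v"
    unfolding v_def[abs_def]
    by (intro locally_lipschitz_diff locally_lipschitz_sum locally_lipschitz_divide locally_lipschitz_mult
        locally_lipschitz_const locally_lipschitz_excess locally_lipschitz_compose[OF locally_lipschitz_tri]
        locally_lipschitz_clamp1 locally_lipschitz_lev)
  have V: "locally_lipschitz V"
    unfolding V_def[abs_def]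
    by (intro locally_lipschitz_sum locally_lipschitz_mult
        locally_lipschitz_const locally_lipschitz_compens locally_lipschitz_clamp1 locally_lipschitz_lev)
  show ?thesis
    using exhaust_3[of i]
    by (auto simp: u_nth intro!: locally_lipschitz_add locally_lipschitz_divide locally_lipschitz_minus
        locally_lipschitz_mult locally_lipschitz_component v V)
qed

text \<open>Excluded are the faces and the kinks of \<open>dist_int\<close> (level 0), of
  \<open>tri\<close> (1/4), of the completed folds (1/12) and of \<open>excess\<close> at the
  current level.\<close>

definition regular :: "real^3 \<Rightarrow> bool"
  where "regular x \<longleftrightarrow> x $ 1 \<noteq> 0 \<and> x $ 1 \<noteq> 1 \<and>
    (\<forall>j\<le>J. \<bar>tri (freq j * x $ 1)\<bar> \<notin> {0, 1/4, 1/12, lev j (rad x)})"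

lemma AE_regular: "AE x in lebesgue. regular x"
proof -
  have c: "continuous_on UNIV (\<lambda>x::real^3. \<bar>tri (real n * x $ 1)\<bar>)" for n
    by (intro continuous_intros locally_lipschitz_continuous[OF locally_lipschitz_compose[OF locally_lipschitz_tri]]
       locally_lipschitz_intros)
  \<comment> \<open>The level g may vary with \<open>rad\<close>, but on each line it is constant,
    so the slices are countable.\<close>
  have 1: "AE x in lebesgue. x \<notin> {x::real^3. \<bar>tri (freq j * x $ 1)\<bar> = g (rad x)}"
    if "continuous_on UNIV (\<lambda>x. g (rad x))" for j g
  proof (rule null_if_countable_slices)
    show "{x. \<bar>tri (freq j * x $ 1)\<bar> = g (rad x)} \<in> sets borel"
      by (intro borel_closed closed_Collect_eq c that)
    show "countable {x. of_slice x w \<in> {x. \<bar>tri (freq j * x $ 1)\<bar> = g (rad x)}}" for w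
      using countable_tri_level[OF freq_pos[of j], of "g ((Re w)\<^sup>2 + (Im w)\<^sup>2)"] by (simp add: rad_def)
  qed
  have 2: "AE x in lebesgue. x \<notin> {x::real^3. x $ 1 = a}" for a
  proof (rule null_if_countable_slices)
    show "{x::real^3. x $ 1 = a} \<in> sets borel"
      by (intro borel_closed closed_Collect_eq continuous_intros)
  qed simp
  have "AE x in lebesgue. \<forall>j\<in>{..J}. \<bar>tri (freq j * x $ 1)\<bar> \<notin> {0, 1/4, 1/12, lev j (rad x)}"
  proof (rule AE_finite_allI)
    fix j
    have "continuous_on UNIV (\<lambda>x. lev j (rad x))"
      by (rule locally_lipschitz_continuous[OF locally_lipschitz_lev(1)])
    from 1[OF this, of j] 1[OF continuous_on_const, of j 0] 1[OF continuous_on_const, of j "1/4"]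
      1[OF continuous_on_const, of j "1/12"]
    show "AE x in lebesgue. \<bar>tri (freq j * x $ 1)\<bar> \<notin> {0, 1/4, 1/12, lev j (rad x)}"
      by eventually_elim simp
  qed simp
  with 2[of 0] 2[of 1] show ?thesis
    by eventually_elim (auto simp: regular_def)
qed

text \<open>Iterates \<open>tri_fold\<close>: each completed shell contributes one fold.\<close>

lemma excess_telescope:
  fixes y :: real
  shows "tri (N * y) / N - (\<Sum>i<j. 2 / freq i * excess (freq i * y) (1/12)) = tri (freq j * y) / freq j"
proof (induction j)
  case (Suc j)
  have "tri (freq j * y) / freq j - 2 / freq j * excess (freq j * y) (1/12) = tri (freq (Suc j) * y) / freq (Suc j)"
  proof -
    have "tri (freq j * y) = tri (3 * (freq j * y)) / 3 + 2 * excess (freq j * y) (1/12)"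
      using tri_fold[of "freq j * y"] by simp
    moreover have "tri (freq (Suc j) * y) = tri (3 * (freq j * y))"
      by (simp add: freq_Suc mult.assoc)
    ultimately show ?thesis
      using freq_pos[of j] by (simp add: freq_Suc add_divide_distrib)
  qed
  with Suc show ?case
    by simp
qed (simp add: freq_def)

lemma slope_telescope:
  assumes "regular x" "j \<le> J"
  shows "slope (N * x $ 1) - (\<Sum>i<j. 2 * excess_slope (freq i * x $ 1) (1/12)) = slope (freq j * x $ 1)"
  using assms(2)
proof (induction j)
  case (Suc j)
  have "slope (freq j * x $ 1) - 2 * excess_slope (freq j * x $ 1) (1/12) = slope (3 * (freq j * x $ 1))"
  proof (rule slope_fold)
    have "j \<le> J"
      using Suc by simp
    then show "\<bar>tri (freq j * x $ 1)\<bar> \<noteq> 1/4" "\<bar>tri (freq j * x $ 1)\<bar> \<noteq> 1/12"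
      using assms(1) by (auto simp: regular_def)
    have "\<bar>tri (freq (Suc j) * x $ 1)\<bar> \<noteq> 1/4"
      using assms(1) Suc.prems by (auto simp: regular_def)
    then show "\<bar>tri (3 * (freq j * x $ 1))\<bar> \<noteq> 1/4"
      by (simp add: freq_Suc mult.assoc)
  qed
  with Suc show ?case
    by (simp add: freq_Suc mult.assoc)
qed (simp add: freq_def)

lemma u_boundary:
  assumes "x \<notin> cylinder"
  shows "u x = diag (vector [1/2, 0, 0]) *v x"
proof -
  have "v x = 0 \<and> V x = 0"
  proof (cases "0 < x $ 1 \<and> x $ 1 < 1")
    case False
    \<comment> \<open>Beyond a face the clamped coordinate is 0 or 1, so all phases are
      integers.\<close>
    then obtain k :: int where k: "clamp1 x = of_int k"
      by (auto simp: clamp1_def max_def min_def not_less intro: that[of 0] that[of 1])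
    have "tri (N * clamp1 x) = 0" "excess (freq j * clamp1 x) (lev j (rad x)) = 0" "compens (freq j * clamp1 x) (lev j (rad x)) = 0" for j
      using tri_of_int(1)[of "int N * k"] excess_of_int[of "lev j (rad x)" "int (freq j) * k"]
        compens_of_int[of "lev j (rad x)" "int (freq j) * k"] lev_bounds[of j "rad x"] by (simp_all add: k)
    then show ?thesis
      by (simp add: v_def V_def)
  next
    case True
    \<comment> \<open>All rims are below 1, so outside the lateral boundary every level has reached
      its final value.\<close>
    then have r: "rad x \<ge> rim (Suc j)" for j
      using assms rim_bounds[of "Suc j"] by (simp add: mem_cylinder)
    \<comment> \<open>The last level is 0, so that summand is the whole wave of frequency
      \<open>freq J\<close>, which is exactly what the folds have left.\<close>
    have "(\<Sum>j\<le>J. weight j / freq j * excess (freq j * clamp1 x) (lev j (rad x))) =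
       (\<Sum>j<J. 2 / freq j * excess (freq j * clamp1 x) (1/12)) + tri (freq J * clamp1 x) / freq J"
      unfolding lessThan_Suc_atMost[symmetric] sum.lessThan_Suc
      by (intro arg_cong2[where f="(+)"] sum.cong) (auto simp: weight_def lev_outside(1)[OF r] drop_height_def excess_0)
    moreover have "V x = 0"
      unfolding V_def by (simp add: lev_outside[OF r])
    ultimately show ?thesis
      using excess_telescope[of "clamp1 x" J] by (simp add: v_def)
  qed
  then show ?thesis
    by (simp add: vec_eq_iff forall_3 u_nth matrix_vector_mult_def diag_def sum_3)
qed

text \<open>\<open>dv = \<partial>\<^sub>1 v\<close>, \<open>P = \<partial>\<^sub>1 V\<close>, and \<open>Q\<close> is the derivative of \<open>V\<close> in the variable \<open>rad\<close>.\<close>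

definition dv :: "real^3 \<Rightarrow> real"
  where "dv x = slope (N * x $ 1) - (\<Sum>j\<le>J. weight j * excess_slope (freq j * x $ 1) (lev j (rad x)))"

definition P :: "real^3 \<Rightarrow> real"
  where "P x = (\<Sum>j\<le>J. weight j / freq j * (excess_sign (freq j * x $ 1) (lev j (rad x)) * lev1 j (rad x)))"

definition Q :: "real^3 \<Rightarrow> real"
  where "Q x = (\<Sum>j\<le>J. weight j / (freq j)\<^sup>2 * (compens_deriv (freq j * x $ 1) (lev j (rad x)) * (lev1 j (rad x))\<^sup>2
      + compens (freq j * x $ 1) (lev j (rad x)) * lev2 j (rad x)))"

definition G :: "real^3 \<Rightarrow> real^3^3"
  where "G x = (if 0 < x $ 1 \<and> x $ 1 < 1 then
    (\<chi> i k. if i = 1 then (if k = 1 then 1/2 + dv x / 2 else x $ k * P x)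
      else if k = 1 then - (x $ i * P x)
      else - ((if i = k then V x else 0) + 2 * x $ i * x $ k * Q x))
    else diag (vector [1/2, 0, 0]))"

section \<open>Classical partial derivatives at regular points\<close>

context
  fixes x
  assumes reg: "regular x" and x1: "0 < x $ 1" "x $ 1 < 1"
begin

lemma clamp1_x: "clamp1 x = x $ 1"
  using x1 by (simp add: clamp1_def)

lemma tri_regular:
  assumes "j \<le> J"
  shows "tri (freq j * clamp1 x) \<noteq> 0" "\<bar>tri (freq j * clamp1 x)\<bar> \<noteq> 1/4" "\<bar>tri (freq j * clamp1 x)\<bar> \<noteq> lev j (rad x)"
  using reg assms by (auto simp: regular_def clamp1_x)

lemma has_partial_v_1: "has_partial 1 v (dv x) x"
proof -
  have z: "has_partial 1 (\<lambda>x. real n * clamp1 x) (real n * 1) x" for n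
    by (rule has_partial_cmult[OF has_partial_clamp1[OF x1]])
  have t: "has_partial 1 (\<lambda>x. tri (N * clamp1 x) / N) (slope (N * x $ 1)) x"
  proof -
    have "\<bar>tri (N * clamp1 x)\<bar> \<noteq> 1/4"
      using tri_regular(2)[of 0] by (simp add: freq_def)
    from has_partial_cmult[OF has_partial_chain[OF DERIV_tri[OF this] z], of "1 / N"]
    show ?thesis
      using N by (simp add: clamp1_x)
  qed
  have "has_partial 1 (\<lambda>x. \<Sum>j\<le>J. weight j / freq j * excess (freq j * clamp1 x) (lev j (rad x)))
     (\<Sum>j\<le>J. weight j * excess_slope (freq j * x $ 1) (lev j (rad x))) x"
  proof (rule has_partial_sum)
    fix j assume "j \<in> {..J}"
    then have j: "j \<le> J"
      by simp
    have "has_partial 1 (\<lambda>x. excess (freq j * clamp1 x) (lev j (rad x))) (excess_slope (freq j * clamp1 x) (lev j (rad x)) * (real (freq j) * 1)) x"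
      by (rule has_partial_fst[where F=excess and f="\<lambda>x. freq j * clamp1 x", OF _ z])
        (use tri_regular[OF j] lev_bounds in \<open>auto simp: rad_axis_1 intro!: DERIV_excess\<close>)
    from has_partial_cmult[OF this, of "weight j / freq j"]
    show "has_partial 1 (\<lambda>x. weight j / freq j * excess (freq j * clamp1 x) (lev j (rad x)))
       (weight j * excess_slope (freq j * x $ 1) (lev j (rad x))) x"
      using freq_pos[of j] by (simp add: clamp1_x)
  qed
  from has_partial_diff[OF t this] show ?thesis
    unfolding v_def[abs_def] dv_def .
qed

lemma has_partial_lev:
  "k \<noteq> 1 \<Longrightarrow> has_partial k (\<lambda>x. lev j (rad x)) (lev1 j (rad x) * (2 * x $ k)) x"
  "k \<noteq> 1 \<Longrightarrow> has_partial k (\<lambda>x. lev1 j (rad x)) (lev2 j (rad x) * (2 * x $ k)) x"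
  using has_partial_chain[OF DERIV_lev has_partial_rad[of k]] has_partial_chain[OF DERIV_lev1 has_partial_rad[of k]]
  by simp_all

lemma has_partial_v_other:
  assumes k: "k \<noteq> 1"
  shows "has_partial k v (2 * x $ k * P x) x"
proof -
  have t: "has_partial k (\<lambda>x. tri (N * clamp1 x) / N) 0 x"
    using has_partial_const unfolding has_partial_def clamp1_axis[OF k] by simp
  have "has_partial k (\<lambda>x. \<Sum>j\<le>J. weight j / freq j * excess (freq j * clamp1 x) (lev j (rad x)))
     (\<Sum>j\<le>J. weight j / freq j * (- excess_sign (freq j * clamp1 x) (lev j (rad x)) * (lev1 j (rad x) * (2 * x $ k)))) x"
  proof (intro has_partial_sum has_partial_cmult)
    fix j assume "j \<in> {..J}"
    then have j: "j \<le> J"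
      by simp
    show "has_partial k (\<lambda>x. excess (freq j * clamp1 x) (lev j (rad x))) (- excess_sign (freq j * clamp1 x) (lev j (rad x)) * (lev1 j (rad x) * (2 * x $ k))) x"
      by (rule has_partial_snd[where F=excess and g="\<lambda>x. lev j (rad x)", OF _ has_partial_lev(1)[OF k]])
        (use tri_regular[OF j] lev_bounds in \<open>auto simp: clamp1_axis[OF k] intro!: DERIV_excess\<close>)
  qed
  from has_partial_diff[OF t this] show ?thesis
    unfolding v_def[abs_def] P_def
    by (rule has_partial_cong) (simp add: sum_distrib_left sum_negf clamp1_x mult_ac)
qed

text \<open>The same \<open>P\<close> as in \<open>has_partial_v_other\<close>: \<open>lev1\<close>
  does not depend on x_1, and the derivative of \<open>compens\<close> in its first argument is
  \<open>excess_sign\<close>. This is the exact cancellation of the shear.\<close>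

lemma has_partial_V_1: "has_partial 1 V (P x) x"
proof -
  have z: "has_partial 1 (\<lambda>x. real n * clamp1 x) (real n * 1) x" for n
    by (rule has_partial_cmult[OF has_partial_clamp1[OF x1]])
  have "has_partial 1 V (\<Sum>j\<le>J. weight j / (freq j)\<^sup>2 *
      ((excess_sign (freq j * clamp1 x) (lev j (rad x)) * (real (freq j) * 1)) * lev1 j (rad x) + 0 * compens (freq j * clamp1 x) (lev j (rad x)))) x"
    unfolding V_def[abs_def]
  proof (intro has_partial_sum has_partial_cmult has_partial_mult)
    fix j assume "j \<in> {..J}"
    then have j: "j \<le> J"
      by simp
    show "has_partial 1 (\<lambda>x. compens (freq j * clamp1 x) (lev j (rad x))) (excess_sign (freq j * clamp1 x) (lev j (rad x)) * (real (freq j) * 1)) x"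
      by (rule has_partial_fst[where F=compens and f="\<lambda>x. freq j * clamp1 x", OF _ z])
        (use tri_regular[OF j] lev_bounds in \<open>auto simp: rad_axis_1 intro!: DERIV_compens\<close>)
    show "has_partial 1 (\<lambda>x. lev1 j (rad x)) 0 x"
      using has_partial_const unfolding has_partial_def rad_axis_1 by simp
  qed
  then show ?thesis
    unfolding P_def
    by (rule has_partial_cong) (use freq_pos in \<open>auto simp: clamp1_x power2_eq_square intro!: sum.cong\<close>)
qed

lemma has_partial_V_other:
  assumes k: "k \<noteq> 1"
  shows "has_partial k V (2 * x $ k * Q x) x"
proof -
  have "has_partial k V (\<Sum>j\<le>J. weight j / (freq j)\<^sup>2 *
      ((compens_deriv (freq j * clamp1 x) (lev j (rad x)) * (lev1 j (rad x) * (2 * x $ k))) * lev1 j (rad x)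
        + (lev2 j (rad x) * (2 * x $ k)) * compens (freq j * clamp1 x) (lev j (rad x)))) x"
    unfolding V_def[abs_def]
  proof (intro has_partial_sum has_partial_cmult has_partial_mult has_partial_lev k)
    fix j assume "j \<in> {..J}"
    then have j: "j \<le> J"
      by simp
    show "has_partial k (\<lambda>x. compens (freq j * clamp1 x) (lev j (rad x))) (compens_deriv (freq j * clamp1 x) (lev j (rad x)) * (lev1 j (rad x) * (2 * x $ k))) x"
      by (rule has_partial_snd[where F=compens and g="\<lambda>x. lev j (rad x)", OF _ has_partial_lev(1)[OF k]])
        (use tri_regular[OF j] lev_bounds in \<open>auto simp: clamp1_axis[OF k] intro!: DERIV_compens\<close>)
  qed
  then show ?thesis
    unfolding Q_def
    by (rule has_partial_cong) (simp add: sum_distrib_left clamp1_x algebra_simps power2_eq_square)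
qed

lemma has_partial_u_inside: "has_partial k (\<lambda>x. u x $ i) (G x $ i $ k) x"
proof -
  have u1: "(\<lambda>x. u x $ 1) = (\<lambda>x. 1/2 * (x $ 1 + v x))" and ui: "(\<lambda>x. u x $ i) = (\<lambda>x. - (x $ i * V x))" if "i \<noteq> 1" for i
    using exhaust_3[of i] that by (auto simp: u_nth)
  show ?thesis
  proof (cases "i = 1")
    case True
    have "has_partial k (\<lambda>x. 1/2 * (x $ 1 + v x)) (1/2 * ((if 1 = k then 1 else 0) + (if k = 1 then dv x else 2 * x $ k * P x))) x"
      by (intro has_partial_cmult has_partial_add has_partial_component)
        (use has_partial_v_1 has_partial_v_other in auto)
    moreover have "1/2 * ((if 1 = k then 1 else 0) + (if k = 1 then dv x else 2 * x $ k * P x)) = G x $ 1 $ k"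
      using x1 by (simp add: G_def add_divide_distrib)
    ultimately show ?thesis
      using True u1[of 2] by simp
  next
    case False
    have "has_partial k (\<lambda>x. - (x $ i * V x)) (- ((if i = k then 1 else 0) * V x + (if k = 1 then P x else 2 * x $ k * Q x) * x $ i)) x"
      by (intro has_partial_minus has_partial_mult has_partial_component)
        (use has_partial_V_1 has_partial_V_other in auto)
    moreover have "- ((if i = k then 1 else 0) * V x + (if k = 1 then P x else 2 * x $ k * Q x) * x $ i) = G x $ i $ k"
      using x1 False by (simp add: G_def mult_ac)
    ultimately show ?thesis
      using False ui by simp
  qed
qed

end

lemma has_partial_u:
  assumes "regular x"
  shows "has_partial k (\<lambda>x. u x $ i) (G x $ i $ k) x"
proof (cases "0 < x $ 1 \<and> x $ 1 < 1")
  case True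
  then show ?thesis
    using has_partial_u_inside assms by blast
next
  case False
  let ?F = "diag (vector [1/2, 0, 0]) :: real^3^3"
  \<comment> \<open>Regular points are off the faces, so near such a point outside the slab u is the
    affine boundary datum.\<close>
  let ?S = "{x::real^3. x $ 1 < 0 \<or> 1 < x $ 1}"
  have l: "has_partial k (\<lambda>x. (?F *v x) $ i) (?F $ i $ k) x"
  proof -
    have "has_partial k (\<lambda>x. \<Sum>l\<in>UNIV. ?F $ i $ l * x $ l) (\<Sum>l\<in>UNIV. ?F $ i $ l * (if l = k then 1 else 0)) x"
      by (intro has_partial_sum has_partial_cmult has_partial_component)
    then show ?thesis
      by (simp add: matrix_vector_mult_def if_distrib[of "\<lambda>c. _ * c"] cong: if_cong)
  qed
  have "has_partial k (\<lambda>x. u x $ i) (?F $ i $ k) x"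
  proof (rule has_partial_transform[OF l])
    show "open ?S"
      by (intro open_Collect_disj open_Collect_less continuous_intros)
    show "x \<in> ?S"
      using False assms by (auto simp: regular_def)
    show "(?F *v y) $ i = u y $ i" if "y \<in> ?S" for y
      using u_boundary[of y] that by (auto simp: mem_cylinder)
  qed
  then show ?thesis
    using False by (auto simp: G_def)
qed

lemma u_weak_gradient:
  assumes "p \<ge> 0"
  shows "has_weak_gradient u G" "u \<in> Lp_loc p" "G \<in> Lp_loc p"
proof -
  have "AE x in lebesgue. \<forall>i j. has_partial j (\<lambda>x. u x $ i) (G x $ i $ j) x"
    using AE_regular by eventually_elim (use has_partial_u in blast)
  from has_weak_gradientI[OF locally_lipschitz_u this assms]
  show "has_weak_gradient u G" "u \<in> Lp_loc p" "G \<in> Lp_loc p" .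
qed

end

section \<open>The energy of the construction\<close>

lemma diff_axis_nth: "(x - t *\<^sub>R axis k 1) $ i = x $ i - (if i = k then t else (0::real))"
  by (simp add: axis_def)

lemma closed_rad_slab: "closed {x::real^3. 0 \<le> x $ 1 \<and> x $ 1 \<le> 1 \<and> a \<le> rad x \<and> rad x \<le> 1}"
  by (intro closed_Collect_conj closed_Collect_le continuous_intros
      locally_lipschitz_continuous[OF locally_lipschitz_rad])

lemma emeasure_rad_slab_le:
  assumes "0 \<le> a" "a \<le> 1"
  shows "emeasure lebesgue {x::real^3. 0 \<le> x $ 1 \<and> x $ 1 \<le> 1 \<and> a \<le> rad x \<and> rad x \<le> 1} \<le> ennreal (pi * (1 - a))"
proof -
  let ?A = "{x::real^3. 0 \<le> x $ 1 \<and> x $ 1 \<le> 1 \<and> a \<le> rad x \<and> rad x \<le> 1}"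
  have "emeasure lebesgue ?A \<le> ennreal (1 * (pi * (1 - a)))"
  proof (rule emeasure_slices_le)
    show "?A \<in> sets borel"
      by (intro borel_closed closed_rad_slab)
    show "emeasure lborel {x. of_slice x w \<in> ?A} \<le> ennreal 1" for w
    proof -
      have "emeasure lborel {x. of_slice x w \<in> ?A} \<le> emeasure lborel {0..1::real}"
        by (rule emeasure_mono) auto
      then show ?thesis
        by simp
    qed
  qed (use assms in \<open>auto simp: rad_def\<close>)
  then show ?thesis
    by simp
qed

text \<open>On a line parallel to the x_1-axis the level g (rad x) is constant, so the
  one-dimensional estimate applies line by line.\<close>

lemma emeasure_tri_level_slab_le:
  assumes g: "continuous_on UNIV (\<lambda>x. g (rad x))" and a: "0 \<le> a" "a \<le> 1" and n: "n > 0" and \<delta>: "\<delta> \<ge> 0"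
  shows "{x::real^3. 0 \<le> x $ 1 \<and> x $ 1 \<le> 1 \<and> a \<le> rad x \<and> rad x \<le> 1 \<and> \<bar>\<bar>tri (real n * x $ 1)\<bar> - g (rad x)\<bar> \<le> \<delta>} \<in> sets borel"
      (is "?A \<in> _")
    and "emeasure lebesgue {x::real^3. 0 \<le> x $ 1 \<and> x $ 1 \<le> 1 \<and> a \<le> rad x \<and> rad x \<le> 1 \<and> \<bar>\<bar>tri (real n * x $ 1)\<bar> - g (rad x)\<bar> \<le> \<delta>}
      \<le> ennreal (20 * \<delta> * (pi * (1 - a)))"
proof -
  have "continuous_on UNIV (\<lambda>x::real^3. tri (real n * x $ 1))"
    by (intro locally_lipschitz_continuous[OF locally_lipschitz_compose[OF locally_lipschitz_tri]] locally_lipschitz_intros)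
  then show A: "?A \<in> sets borel"
    by (intro borel_closed closed_Collect_conj closed_Collect_le continuous_intros g
        locally_lipschitz_continuous[OF locally_lipschitz_rad])
  show "emeasure lebesgue ?A \<le> ennreal (20 * \<delta> * (pi * (1 - a)))"
  proof (rule emeasure_slices_le[OF A a])
    fix w
    let ?L = "{x. 0 \<le> x \<and> x \<le> 1 \<and> \<bar>\<bar>tri (real n * x)\<bar> - g ((Re w)\<^sup>2 + (Im w)\<^sup>2)\<bar> \<le> \<delta>}"
    have "continuous_on UNIV (\<lambda>x::real. tri (real n * x))"
      by (intro locally_lipschitz_continuous[OF locally_lipschitz_compose[OF locally_lipschitz_tri]] locally_lipschitz_intros)
    then have "closed ?L"
      by (intro closed_Collect_conj closed_Collect_le continuous_intros)
    then have "emeasure lborel {x. of_slice x w \<in> ?A} \<le> emeasure lborel ?L"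
      by (intro emeasure_mono) (auto simp: rad_def)
    also have "\<dots> \<le> ennreal (20 * \<delta>)"
      by (rule emeasure_tri_level_le[OF n \<delta>])
    finally show "emeasure lborel {x. of_slice x w \<in> ?A} \<le> ennreal (20 * \<delta>)" .
  qed (use \<delta> in \<open>auto simp: rad_def\<close>)
qed

lemma cylinder_sets: "cylinder \<in> sets borel"
proof -
  have "cylinder = {x. 0 < x $ 1 \<and> x $ 1 < 1 \<and> rad x < 1}"
    using mem_cylinder by blast
  moreover have "open {x. 0 < x $ 1 \<and> x $ 1 < 1 \<and> rad x < 1}"
    by (intro open_Collect_conj open_Collect_less continuous_intros locally_lipschitz_continuous[OF locally_lipschitz_rad])
  ultimately show ?thesis
    by simp
qed

lemma emeasure_cylinder_finite: "emeasure lebesgue cylinder < \<infinity>"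
proof -
  have "emeasure lebesgue cylinder \<le> emeasure lebesgue {x::real^3. 0 \<le> x $ 1 \<and> x $ 1 \<le> 1 \<and> 0 \<le> rad x \<and> rad x \<le> 1}"
    using closed_rad_slab by (intro emeasure_mono) (auto simp: mem_cylinder rad_def)
  also have "\<dots> \<le> ennreal (pi * (1 - 0))"
    by (rule emeasure_rad_slab_le) auto
  finally show ?thesis
    using le_less_trans by fastforce
qed

lemma cylinder_component_le:
  assumes "x \<in> cylinder"
  shows "\<bar>x $ i\<bar> \<le> 1"
proof -
  have "(x $ 2)\<^sup>2 \<le> 1" "(x $ 3)\<^sup>2 \<le> 1"
    using assms zero_le_power2[of "x $ 2"] zero_le_power2[of "x $ 3"]
    unfolding mem_cylinder rad_def by linarith+
  then show ?thesis
    using assms exhaust_3[of i] by (auto simp: mem_cylinder abs_square_le_1)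
qed

lemma wells_neq: "wells 1 \<noteq> wells 0"
  by (simp add: wells_def diag_def vec_eq_iff forall_3)

context branching
begin

text \<open>\<open>e\<close> is \<open>\<partial>\<^sub>1 v\<close> without the truncation in the last shell, so that \<open>e = \<plusminus>1\<close> almost everywhere.\<close>

definition e :: "real^3 \<Rightarrow> real"
  where "e x = slope (N * x $ 1) - (\<Sum>j<J. 2 * excess_slope (freq j * x $ 1) (lev j (rad x)))"

text \<open>Choosing by sign gives a well at every point, as \<open>BV_into\<close> asks, also on
  the null set where \<open>e\<close> is not \<plusminus>1.\<close>

definition X :: "real^3 \<Rightarrow> real^3^3"
  where "X x = wells (if e x > 0 then 1 else 0)"

text \<open>The last shell has no upper bound: it includes the layer up to the boundary in which the
  wave is already flat.\<close>

definition in_shell :: "nat \<Rightarrow> real^3 \<Rightarrow> bool"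
  where "in_shell j x \<longleftrightarrow> j \<le> J \<and> rim j \<le> rad x \<and> (j < J \<longrightarrow> rad x < rim (Suc j))"

lemma ex_shell: "\<exists>j. in_shell j x"
proof (cases "rim J \<le> rad x")
  case True
  then show ?thesis
    by (auto simp: in_shell_def)
next
  case False
  define i where "i = (LEAST i. rad x < rim i)"
  have i: "rad x < rim i" "i \<le> J"
    unfolding i_def using False by (auto intro: LeastI[of _ J] Least_le)
  have "i \<noteq> 0"
  proof
    assume "i = 0"
    then have "rad x < 0"
      using i(1) by (simp add: rim_0)
    then show False
      using zero_le_power2[of "x $ 2"] zero_le_power2[of "x $ 3"] unfolding rad_def by linarith
  qed
  then obtain j where j: "i = Suc j"
    by (cases i) auto
  have "\<not> rad x < rim j"
    using not_less_Least[of j "\<lambda>i. rad x < rim i"] j by (simp add: i_def)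
  then show ?thesis
    using i j by (auto simp: in_shell_def intro!: exI[of _ j])
qed

lemma lev_off_shell:
  assumes "in_shell j x" "i \<le> J"
  shows "i < j \<Longrightarrow> rad x \<ge> rim (Suc i)" "i > j \<Longrightarrow> rad x \<le> rim i"
  using assms rim_mono[of "Suc i" j] rim_mono[of "Suc j" i] by (auto simp: in_shell_def)

text \<open>The folds of the inner shells are complete and telescope; those of the outer shells have
  not begun.\<close>

lemma e_shell:
  assumes x: "regular x" "in_shell j x"
  shows "e x = slope (freq j * x $ 1) - (if j < J then 2 * excess_slope (freq j * x $ 1) (lev j (rad x)) else 0)"
proof -
  have j: "j \<le> J"
    using x by (simp add: in_shell_def)
  let ?f = "\<lambda>i. 2 * excess_slope (freq i * x $ 1) (lev i (rad x))"
  have "(\<Sum>i<j. ?f i) = (\<Sum>i<j. 2 * excess_slope (freq i * x $ 1) (1/12))"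
    using lev_off_shell[OF x(2)] j by (intro sum.cong) (auto simp: lev_outside drop_height_def)
  then have 1: "slope (N * x $ 1) - (\<Sum>i<j. ?f i) = slope (freq j * x $ 1)"
    using slope_telescope[OF x(1) j] by simp
  show ?thesis
  proof (cases "j < J")
    case True
    have "(\<Sum>i<J. ?f i) = (\<Sum>i<Suc j. ?f i)"
      using lev_off_shell[OF x(2)] True
      by (intro sum.mono_neutral_right) (auto simp: lev_inside excess_slope_quarter)
    then show ?thesis
      using 1 True by (simp add: e_def)
  next
    case False
    then show ?thesis
      using 1 j by (simp add: e_def)
  qed
qed

text \<open>Since \<open>excess_slope\<close> is 0 or equal to \<open>slope\<close>, a reflection
  merely flips the sign.\<close>

lemma e_values:
  assumes x: "regular x"
  shows "e x = 1 \<or> e x = - 1"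
proof -
  obtain j where j: "in_shell j x"
    using ex_shell by blast
  then have "\<bar>tri (freq j * x $ 1)\<bar> \<noteq> 1/4"
    using x by (auto simp: regular_def in_shell_def)
  from slope_cases[OF this] show ?thesis
    unfolding e_shell[OF x j] by (auto simp: excess_slope_def)
qed

lemma X_nth: "X x $ i $ k = (if i = 1 \<and> k = 1 \<and> e x > 0 then 1 else 0)"
  using exhaust_3[of i] exhaust_3[of k] by (auto simp: X_def wells_def diag_def)

section \<open>Elastic energy\<close>

lemma freq_len: "freq j * len j = N * \<rho> ^ j * ((1 - \<rho> / 3) / 3)"
  by (simp add: freq_def len_def power_divide)

lemma freq_len_ge: "freq j * len j \<ge> 2/9 * (N * \<rho> ^ j)"
proof -
  \<comment> \<open>2/9 is the infimum of (1 - \<rho> / 3) / 3 over \<rho> < 1.\<close>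
  have "N * \<rho> ^ j * (2/9) \<le> N * \<rho> ^ j * ((1 - \<rho> / 3) / 3)"
    using rho by (intro mult_left_mono) auto
  then show ?thesis
    by (simp add: freq_len)
qed

lemma N_rho_ge_1:
  assumes "j \<le> J"
  shows "1 \<le> N * \<rho> ^ j"
proof -
  have "\<rho> ^ J \<le> \<rho> ^ j"
    using rho assms by (intro power_decreasing) auto
  then have "N * \<rho> ^ J \<le> N * \<rho> ^ j"
    by (intro mult_left_mono) auto
  then show ?thesis
    using J by linarith
qed

lemma inverse_freq_len_le: "1 / (freq j * len j)\<^sup>2 \<le> 81/4 / (N * \<rho> ^ j)\<^sup>2"
proof -
  have pos: "0 < 2/9 * (N * \<rho> ^ j)"
    using N rho by simp
  have "(2/9 * (N * \<rho> ^ j))\<^sup>2 \<le> (freq j * len j)\<^sup>2"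
    using pos freq_len_ge[of j] by (intro power_mono) auto
  then have "1 / (freq j * len j)\<^sup>2 \<le> 1 / (2/9 * (N * \<rho> ^ j))\<^sup>2"
    using pos by (intro divide_left_mono mult_pos_pos zero_less_power) (use freq_pos[of j] len_pos[of j] N rho in auto)
  also have "\<dots> = 81/4 / (N * \<rho> ^ j)\<^sup>2"
    by (simp add: power_mult_distrib power_divide)
  finally show ?thesis .
qed

text \<open>The levels of all other shells are constant here, so a single summand survives. Each
  derivative of its level costs 1 / len j, and the amplitude of the wave and the primitive in x_1
  gain 1 / freq j each.\<close>

lemma V_Q_shell:
  assumes x: "regular x" "0 < x $ 1" "x $ 1 < 1" and j: "in_shell j x"
  shows "\<bar>V x\<bar> \<le> 1/4 * (1 / (freq j * len j)\<^sup>2)" "\<bar>Q x\<bar> \<le> 1/2 * (1 / (freq j * len j)\<^sup>2)"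
proof -
  let ?n = "real (freq j)" and ?b = "lev j (rad x)" and ?l = "len j"
  let ?c = "compens (?n * x $ 1) ?b"
  have jJ: "j \<in> {..J}"
    using j by (simp add: in_shell_def)
  have z: "lev1 i (rad x) = 0 \<and> lev2 i (rad x) = 0" if "i \<in> {..J} - {j}" for i
  proof (cases "i < j")
    case True
    then show ?thesis
      using lev_off_shell(1)[OF j] that lev_outside by auto
  next
    case False
    then show ?thesis
      using lev_off_shell(2)[OF j] that lev_inside by auto
  qed
  have V: "V x = weight j / ?n\<^sup>2 * (?c * lev1 j (rad x))"
    unfolding V_def clamp1_x[OF x] sum.remove[OF finite_atMost jJ] using z by simp
  have Q: "Q x = weight j / ?n\<^sup>2 * (compens_deriv (?n * x $ 1) ?b * (lev1 j (rad x))\<^sup>2 + ?c * lev2 j (rad x))"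
    unfolding Q_def sum.remove[OF finite_atMost jJ] using z by simp
  have pos: "?n > 0" "?l > 0"
    using freq_pos len_pos by auto
  have w: "\<bar>weight j / ?n\<^sup>2\<bar> \<le> 2 / ?n\<^sup>2"
    using weight_bounds[of j] pos by (simp add: divide_right_mono)
  have c: "\<bar>?c\<bar> \<le> 1/2"
    by (intro compens_bound lev_bounds)
  have l1: "\<bar>lev1 j (rad x)\<bar> \<le> 1 / (4 * ?l)" "\<bar>lev2 j (rad x)\<bar> \<le> 1 / (4 * ?l\<^sup>2)"
    by (rule abs_lev1_le abs_lev2_le)+
  \<comment> \<open>V carries only one factor 1 / len j; as len j \<le> 1, the square dominates
    it.\<close>
  have "1 / (4 * ?l) \<le> 1 / (4 * ?l\<^sup>2)"
  proof -
    have "?l * ?l \<le> ?l * 1"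
      using pos len_le[of j] by (intro mult_left_mono) auto
    then show ?thesis
      using pos by (intro divide_left_mono) (auto simp: power2_eq_square)
  qed
  then have l1': "\<bar>lev1 j (rad x)\<bar> \<le> 1 / (4 * ?l\<^sup>2)"
    using l1 by linarith
  have "\<bar>V x\<bar> = \<bar>weight j / ?n\<^sup>2\<bar> * (\<bar>?c\<bar> * \<bar>lev1 j (rad x)\<bar>)"
    unfolding V by (simp add: abs_mult)
  also have "\<dots> \<le> 2 / ?n\<^sup>2 * (1/2 * (1 / (4 * ?l\<^sup>2)))"
    by (intro mult_mono w c l1') auto
  finally show "\<bar>V x\<bar> \<le> 1/4 * (1 / (?n * ?l)\<^sup>2)"
    by (simp add: power_mult_distrib mult_ac)
  have "\<bar>compens_deriv (?n * x $ 1) ?b * (lev1 j (rad x))\<^sup>2 + ?c * lev2 j (rad x)\<bar>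
      \<le> \<bar>compens_deriv (?n * x $ 1) ?b\<bar> * \<bar>lev1 j (rad x)\<bar>\<^sup>2 + \<bar>?c\<bar> * \<bar>lev2 j (rad x)\<bar>"
    using abs_triangle_ineq[of "compens_deriv (?n * x $ 1) ?b * (lev1 j (rad x))\<^sup>2" "?c * lev2 j (rad x)"]
    by (simp add: abs_mult)
  also have "\<dots> \<le> 2 * (1 / (4 * ?l))\<^sup>2 + 1/2 * (1 / (4 * ?l\<^sup>2))"
    by (intro add_mono mult_mono abs_compens_deriv_le power_mono l1 c) auto
  also have "\<dots> = 1 / (4 * ?l\<^sup>2)"
    by (simp add: power_mult_distrib power_divide)
  finally have q: "\<bar>compens_deriv (?n * x $ 1) ?b * (lev1 j (rad x))\<^sup>2 + ?c * lev2 j (rad x)\<bar> \<le> 1 / (4 * ?l\<^sup>2)" .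
  have "\<bar>Q x\<bar> \<le> 2 / ?n\<^sup>2 * (1 / (4 * ?l\<^sup>2))"
    unfolding Q abs_mult[of "weight j / ?n\<^sup>2"] by (intro mult_mono w q) auto
  then show "\<bar>Q x\<bar> \<le> 1/2 * (1 / (?n * ?l)\<^sup>2)"
    by (simp add: power_mult_distrib mult_ac)
qed

lemma dv_e: "dv x = e x - excess_slope (freq J * x $ 1) (lev J (rad x))"
  unfolding dv_def e_def lessThan_Suc_atMost[symmetric] sum.lessThan_Suc by (simp add: weight_def)

lemma sym_gradient_bound:
  assumes x: "regular x" "x \<in> cylinder" and j: "in_shell j x"
  shows "norm (sym_part (G x) - X x) \<le> 400 * (if j < J then 1 / (N * \<rho> ^ j)\<^sup>2 else 1)"
proof -
  have x1: "0 < x $ 1" "x $ 1 < 1"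
    using x by (auto simp: mem_cylinder)
  \<comment> \<open>In units of \<open>1 / (N * \<rho> ^ j)\<^sup>2\<close>, |V| + 2 |Q| is at most
    5/4 * 81/4 < 41; the nine entries give 9 * 41 < 400.\<close>
  define B where "B = 41 * (if j < J then 1 / (N * \<rho> ^ j)\<^sup>2 else 1)"
  have le_B: "41 * (1 / (N * \<rho> ^ j)\<^sup>2) \<le> B"
  proof -
    \<comment> \<open>The locale assumption on J bounds the strain in the last shell.\<close>
    have "1 / (N * \<rho> ^ J)\<^sup>2 \<le> 1"
      using one_le_power[OF J, of 2] by (simp add: divide_le_eq)
    moreover have "j < J \<or> j = J"
      using j by (auto simp: in_shell_def)
    ultimately show ?thesis
      by (auto simp: B_def)
  qed
  have B0: "B \<ge> 0"
    by (simp add: B_def)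
  have VQ: "\<bar>V x\<bar> + 2 * \<bar>Q x\<bar> \<le> B"
    using V_Q_shell[OF x(1) x1 j] inverse_freq_len_le[of j] le_B by linarith
  have entry: "\<bar>(sym_part (G x) - X x) $ i $ k\<bar> \<le> B" for i k
  proof -
    consider "i = 1" "k = 1" | "i = 1" "k \<noteq> 1" | "i \<noteq> 1" "k = 1" | "i \<noteq> 1" "k \<noteq> 1"
      by blast
    then show ?thesis
    proof cases
      case 1
      have s: "sym_part (G x) $ 1 $ 1 = 1/2 + dv x / 2"
        using x1 by (simp add: sym_part_def transpose_def G_def)
      \<comment> \<open>The phase entry is (1 + e) / 2, so the error is the truncation in the last
        shell alone.\<close>
      have "(1 + e x) / 2 = X x $ 1 $ 1"
        using e_values[OF x(1)] by (auto simp: X_nth)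
      then have d: "(sym_part (G x) - X x) $ 1 $ 1 = - (excess_slope (freq J * x $ 1) (lev J (rad x)) / 2)"
        using s by (simp add: dv_e field_simps)
      show ?thesis
      proof (cases "j < J")
        case True
        then have "rad x \<le> rim J"
          using lev_off_shell(2)[OF j, of J] by simp
        then show ?thesis
          using 1 d B0 by (simp add: lev_inside excess_slope_quarter)
      next
        case False
        then have "B = 41"
          by (simp add: B_def)
        then show ?thesis
          using 1 d abs_excess_slope_le(1)[of "freq J * x $ 1" "lev J (rad x)"] by (simp add: abs_divide)
      qed
    next
      \<comment> \<open>The shear entries cancel because the entries (1, k) and (k, 1) of
        \<open>G\<close> are opposite for k \<noteq> 1.\<close>
      case 2
      then show ?thesis
        using x1 B0 by (simp add: sym_part_def transpose_def G_def X_nth)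
    next
      case 3
      then show ?thesis
        using x1 B0 by (simp add: sym_part_def transpose_def G_def X_nth)
    next
      case 4
      have "\<bar>x $ i * x $ k\<bar> \<le> 1"
        using cylinder_component_le[OF x(2)] by (simp add: abs_mult mult_le_one)
      then have "\<bar>x $ i * x $ k * Q x\<bar> \<le> \<bar>Q x\<bar>"
        using mult_right_mono[of "\<bar>x $ i * x $ k\<bar>" 1 "\<bar>Q x\<bar>"] by (simp add: abs_mult)
      moreover have "(sym_part (G x) - X x) $ i $ k = - ((if i = k then V x else 0) + 2 * (x $ i * x $ k * Q x))"
        using 4 x1 by (simp add: sym_part_def transpose_def G_def X_nth mult_ac)
      ultimately show ?thesis
        using VQ by auto
    qed
  qed
  have "norm (sym_part (G x) - X x) \<le> real CARD(3) * (real CARD(3) * B)"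
    by (intro norm_vec_le_CARD) (use entry in simp)
  also have "\<dots> \<le> 400 * (if j < J then 1 / (N * \<rho> ^ j)\<^sup>2 else 1)"
    unfolding B_def by simp
  finally show ?thesis .
qed

text \<open>\<open>(\<rho> / 3) ^ j\<close> is 1 - rim j: the volume of shell j is replaced by that
  of the whole layer from its rim to the boundary, which costs a constant factor only.\<close>

definition elastic_bound :: "real \<Rightarrow> real"
  where "elastic_bound p =
    (\<Sum>j\<le>J. (400 * (if j < J then 1 / (N * \<rho> ^ j)\<^sup>2 else 1)) powr p * (pi * (\<rho> / 3) ^ j))"

lemma elastic_energy_le:
  assumes p: "p \<ge> 0"
  shows "(\<integral>\<^sup>+x\<in>cylinder. ennreal (norm (sym_part (weak_gradient u x) - X x) powr p) \<partial>lebesgue)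
    \<le> ennreal (elastic_bound p)"
proof -
  define c where "c j = (400 * (if j < J then 1 / (N * \<rho> ^ j)\<^sup>2 else 1)) powr p" for j
  define T where "T j = {x::real^3. 0 \<le> x $ 1 \<and> x $ 1 \<le> 1 \<and> rim j \<le> rad x \<and> rad x \<le> 1}" for j
  have T: "T j \<in> sets lebesgue" for j
    by (intro sets_completionI_sets) (simp add: T_def closed_rad_slab)
  have "(\<integral>\<^sup>+x\<in>cylinder. ennreal (norm (sym_part (weak_gradient u x) - X x) powr p) \<partial>lebesgue)
     \<le> (\<integral>\<^sup>+x. (\<Sum>j\<le>J. ennreal (c j) * indicator (T j) x) \<partial>lebesgue)"
  proof (rule nn_integral_mono_AE)
    show "AE x in lebesgue. ennreal (norm (sym_part (weak_gradient u x) - X x) powr p) * indicator cylinder x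
        \<le> (\<Sum>j\<le>J. ennreal (c j) * indicator (T j) x)"
      using AE_regular weak_gradient_AE_unique[OF u_weak_gradient(1)[OF p]]
    proof eventually_elim
      case (elim x)
      show ?case
      proof (cases "x \<in> cylinder")
        case True
        obtain j where j: "in_shell j x"
          using ex_shell by blast
        then have "j \<in> {..J}" "x \<in> T j"
          using True by (auto simp: T_def in_shell_def mem_cylinder)
        have "norm (sym_part (weak_gradient u x) - X x) powr p \<le> c j"
          unfolding elim(2) c_def using sym_gradient_bound[OF elim(1) True j] p by (intro powr_mono2) auto
        then have "ennreal (norm (sym_part (weak_gradient u x) - X x) powr p) * indicator cylinder x \<le> ennreal (c j) * indicator (T j) x"
          using True \<open>x \<in> T j\<close> by (simp add: ennreal_leI)
        also have "\<dots> \<le> (\<Sum>j\<le>J. ennreal (c j) * indicator (T j) x)"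
          by (rule member_le_sum[OF \<open>j \<in> {..J}\<close>]) auto
        finally show ?thesis .
      qed simp
    qed
  qed
  also have "\<dots> = (\<Sum>j\<le>J. \<integral>\<^sup>+x. ennreal (c j) * indicator (T j) x \<partial>lebesgue)"
    by (intro nn_integral_sum borel_measurable_times_ennreal borel_measurable_const borel_measurable_indicator T)
  also have "\<dots> \<le> (\<Sum>j\<le>J. ennreal (c j * (pi * (\<rho> / 3) ^ j)))"
  proof (rule sum_mono)
    fix j
    have "(\<integral>\<^sup>+x. ennreal (c j) * indicator (T j) x \<partial>lebesgue) = ennreal (c j) * emeasure lebesgue (T j)"
      by (rule nn_integral_cmult_indicator[OF T])
    also have "\<dots> \<le> ennreal (c j) * ennreal (pi * (1 - rim j))"
      unfolding T_def using rim_bounds[of j] by (intro mult_left_mono emeasure_rad_slab_le) auto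
    also have "\<dots> = ennreal (c j * (pi * (\<rho> / 3) ^ j))"
      using rho by (simp add: rim_def ennreal_mult c_def)
    finally show "(\<integral>\<^sup>+x. ennreal (c j) * indicator (T j) x \<partial>lebesgue) \<le> ennreal (c j * (pi * (\<rho> / 3) ^ j))" .
  qed
  also have "\<dots> = ennreal (\<Sum>j\<le>J. c j * (pi * (\<rho> / 3) ^ j))"
    using rho by (intro sum_ennreal) (simp add: c_def)
  finally show ?thesis
    unfolding c_def elastic_bound_def .
qed

section \<open>Surface energy\<close>

lemma measurable_tri_freq: "(\<lambda>x::real^3. tri (real n * x $ 1)) \<in> borel_measurable borel"
  by (intro borel_measurable_continuous_onI locally_lipschitz_continuous[OF locally_lipschitz_compose[OF locally_lipschitz_tri]] locally_lipschitz_intros)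

lemma measurable_slope: "(\<lambda>x::real^3. slope (real n * x $ 1)) \<in> borel_measurable borel"
proof -
  have "(\<lambda>x::real^3. tri (real n * x $ 1 + 1/4)) \<in> borel_measurable borel"
    by (intro borel_measurable_continuous_onI locally_lipschitz_continuous[OF locally_lipschitz_compose[OF locally_lipschitz_tri]] locally_lipschitz_intros)
  then show ?thesis
    unfolding slope_def sgn_if by measurable
qed

lemma measurable_excess_slope:
  "(\<lambda>x. excess_slope (real (freq j) * x $ 1) (lev j (rad x))) \<in> borel_measurable borel"
proof -
  have l: "(\<lambda>x. lev j (rad x)) \<in> borel_measurable borel"
    by (intro borel_measurable_continuous_onI locally_lipschitz_continuous locally_lipschitz_lev)
  show ?thesis
    unfolding excess_slope_def
    by (intro measurable_If measurable_slope borel_measurable_const)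
      (use l measurable_tri_freq[of "freq j"] in measurable)
qed

lemma measurable_e: "e \<in> borel_measurable borel"
  unfolding e_def[abs_def]
  by (intro borel_measurable_diff borel_measurable_sum borel_measurable_times borel_measurable_const
      measurable_slope measurable_excess_slope)

lemma measurable_lebesgue_e: "e \<in> borel_measurable lebesgue"
  by (rule measurable_completion) (simp add: measurable_e)

lemma rad_shift:
  assumes "x \<in> cylinder" "0 < t" "t < 1"
  shows "\<bar>rad (x - t *\<^sub>R axis k 1) - rad x\<bar> \<le> 3 * t"
proof -
  have "rad (x - t *\<^sub>R axis k 1) - rad x = (if k = 1 then 0 else t * (t - 2 * x $ k))"
    unfolding rad_def diff_axis_nth using exhaust_3[of k]
    by (auto simp: power2_eq_square algebra_simps)
  moreover have "\<bar>t * (t - 2 * x $ k)\<bar> \<le> t * 3"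
    unfolding abs_mult using assms cylinder_component_le[of x k]
    by (intro mult_mono) auto
  ultimately show ?thesis
    using assms by auto
qed

text \<open>A shift by t moves the phase by at most N t, so the slope can change only that close to
  a kink. This set has measure at most 20 N t \<pi>, and the jump is at most 2.\<close>

lemma slope_variation:
  assumes t: "0 < t" "t < 1"
  shows "(\<integral>\<^sup>+x\<in>cylinder. ennreal \<bar>slope (N * (x - t *\<^sub>R axis k 1) $ 1) - slope (N * x $ 1)\<bar> \<partial>lebesgue)
    \<le> ennreal (40 * pi * N * t)"
proof -
  let ?D = "{x::real^3. 0 \<le> x $ 1 \<and> x $ 1 \<le> 1 \<and> 0 \<le> rad x \<and> rad x \<le> 1 \<and> \<bar>\<bar>tri (real N * x $ 1)\<bar> - 1/4\<bar> \<le> N * t}"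
  have "0 \<le> N * t"
    using t by simp
  note D = emeasure_tri_level_slab_le[where g="\<lambda>_. 1/4" and a=0, OF continuous_on_const order_refl zero_le_one N this]
  have "(\<integral>\<^sup>+x\<in>cylinder. ennreal \<bar>slope (N * (x - t *\<^sub>R axis k 1) $ 1) - slope (N * x $ 1)\<bar> \<partial>lebesgue)
    \<le> (\<integral>\<^sup>+x. ennreal 2 * indicator ?D x \<partial>lebesgue)"
  proof (rule nn_integral_mono)
    fix x
    show "ennreal \<bar>slope (N * (x - t *\<^sub>R axis k 1) $ 1) - slope (N * x $ 1)\<bar> * indicator cylinder x \<le> ennreal 2 * indicator ?D x"
    proof (cases "x \<in> cylinder \<and> slope (N * x $ 1) \<noteq> slope (N * (x - t *\<^sub>R axis k 1) $ 1)")
      case True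
      have "\<bar>\<bar>tri (N * x $ 1)\<bar> - 1/4\<bar> \<le> \<bar>N * x $ 1 - N * (x - t *\<^sub>R axis k 1) $ 1\<bar>"
        using True slope_jump by blast
      also have "\<dots> \<le> N * t"
        unfolding diff_axis_nth using t by (auto simp: algebra_simps)
      finally have "x \<in> ?D"
        using True by (auto simp: mem_cylinder rad_def)
      moreover have "\<bar>slope (N * (x - t *\<^sub>R axis k 1) $ 1) - slope (N * x $ 1)\<bar> \<le> 2"
        using abs_excess_slope_le(2)[of "N * (x - t *\<^sub>R axis k 1) $ 1"] abs_excess_slope_le(2)[of "N * x $ 1"] by linarith
      then have "ennreal \<bar>slope (N * (x - t *\<^sub>R axis k 1) $ 1) - slope (N * x $ 1)\<bar> \<le> ennreal 2"
        by (rule ennreal_leI)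
      ultimately show ?thesis
        using True by simp
    qed (auto simp: indicator_def)
  qed
  also have "\<dots> = ennreal 2 * emeasure lebesgue ?D"
    using D by (intro nn_integral_cmult_indicator) auto
  also have "\<dots> \<le> ennreal 2 * ennreal (20 * (N * t) * (pi * (1 - 0)))"
    by (intro mult_left_mono D) simp
  also have "\<dots> = ennreal (40 * pi * N * t)"
    using t by (subst ennreal_mult[symmetric]) (auto simp: mult_ac)
  finally show ?thesis .
qed

text \<open>The integrand is supported in a layer of volume of order
  \<open>(\<rho> / 3) ^ j\<close>, where interfaces have density of order freq j; the product is
  \<open>N * \<rho> ^ j\<close>.\<close>

lemma excess_slope_variation:
  assumes j: "j \<le> J" and t: "0 < t" "t < (\<rho> / 3) ^ J"
  shows "(\<integral>\<^sup>+x\<in>cylinder. ennreal \<bar>excess_slope (freq j * (x - t *\<^sub>R axis k 1) $ 1) (lev j (rad (x - t *\<^sub>R axis k 1)))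
      - excess_slope (freq j * x $ 1) (lev j (rad x))\<bar> \<partial>lebesgue)
    \<le> ennreal (1600 * pi * N * \<rho> ^ j * t)"
proof -
  \<comment> \<open>The phase moves by at most freq j * t, and the level by at most 4 * freq j *
    t.\<close>
  define \<delta> where "\<delta> = 5 * freq j * t"
  \<comment> \<open>The shift changes \<open>rad\<close> by at most 3 t. As t is below
    \<open>(\<rho> / 3) ^ J\<close>, the layer of width \<open>(\<rho> / 3) ^ j\<close> grows at
    most by a factor 4.\<close>
  define a where "a = max 0 (rim j - 3 * t)"
  have tj: "t \<le> (\<rho> / 3) ^ j"
  proof -
    have "(\<rho> / 3) ^ J \<le> (\<rho> / 3) ^ j"
      using rho j by (intro power_decreasing) auto
    then show ?thesis
      using t(2) by linarith
  qed
  have t1: "t < 1"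
    using t(2) power_le_one[of "\<rho> / 3" J] rho by simp
  have a: "0 \<le> a" "a \<le> 1" "1 - a \<le> 4 * (\<rho> / 3) ^ j"
    using rim_bounds[of j] t tj by (auto simp: a_def rim_def)
  have \<delta>0: "\<delta> \<ge> 0"
    using t by (simp add: \<delta>_def)
  let ?D = "\<lambda>g. {x::real^3. 0 \<le> x $ 1 \<and> x $ 1 \<le> 1 \<and> a \<le> rad x \<and> rad x \<le> 1 \<and> \<bar>\<bar>tri (real (freq j) * x $ 1)\<bar> - g (rad x)\<bar> \<le> \<delta>}"
  let ?D1 = "?D (\<lambda>_. 1/4)" and ?D2 = "?D (lev j)"
  have c: "continuous_on UNIV (\<lambda>x. lev j (rad x))"
    by (intro locally_lipschitz_continuous locally_lipschitz_lev)
  note m = emeasure_tri_level_slab_le[where g="\<lambda>_. 1/4", OF continuous_on_const a(1,2) freq_pos[of j] \<delta>0]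
    emeasure_tri_level_slab_le[where g="lev j", OF c a(1,2) freq_pos[of j] \<delta>0]
  have "(\<integral>\<^sup>+x\<in>cylinder. ennreal \<bar>excess_slope (freq j * (x - t *\<^sub>R axis k 1) $ 1) (lev j (rad (x - t *\<^sub>R axis k 1)))
      - excess_slope (freq j * x $ 1) (lev j (rad x))\<bar> \<partial>lebesgue)
    \<le> (\<integral>\<^sup>+x. ennreal 2 * indicator ?D1 x + ennreal 2 * indicator ?D2 x \<partial>lebesgue)"
  proof (rule nn_integral_mono)
    fix x :: "real^3"
    let ?y = "x - t *\<^sub>R axis k 1"
    let ?d = "\<bar>excess_slope (freq j * ?y $ 1) (lev j (rad ?y)) - excess_slope (freq j * x $ 1) (lev j (rad x))\<bar>"
    show "ennreal ?d * indicator cylinder x \<le> ennreal 2 * indicator ?D1 x + ennreal 2 * indicator ?D2 x"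
    proof (cases "x \<in> cylinder \<and> ?d \<noteq> 0")
      case True
      then have x: "x \<in> cylinder" "excess_slope (freq j * x $ 1) (lev j (rad x)) \<noteq> excess_slope (freq j * ?y $ 1) (lev j (rad ?y))"
        by auto
      have r: "\<bar>rad ?y - rad x\<bar> \<le> 3 * t"
        by (rule rad_shift[OF x(1) t(1) t1])
      \<comment> \<open>Otherwise both points lie where the level is 1/4, and nothing exceeds
        it.\<close>
      have "rad x \<ge> rim j - 3 * t"
      proof (rule ccontr)
        assume "\<not> rad x \<ge> rim j - 3 * t"
        then have "rad x \<le> rim j" "rad ?y \<le> rim j"
          using r t by auto
        then show False
          using x(2) by (simp add: lev_inside excess_slope_quarter)
      qed
      then have ar: "a \<le> rad x"
        by (simp add: a_def rad_def)
      have "\<bar>freq j * x $ 1 - freq j * ?y $ 1\<bar> \<le> freq j * t"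
        unfolding diff_axis_nth using t by (auto simp: algebra_simps)
      moreover have "\<bar>lev j (rad x) - lev j (rad ?y)\<bar> \<le> 4 * freq j * t"
      proof -
        have "\<bar>lev j (rad x) - lev j (rad ?y)\<bar> \<le> \<bar>rad x - rad ?y\<bar> / (4 * len j)"
          by (rule lev_lipschitz)
        also have "\<dots> \<le> 3 * t / (4 * len j)"
          using r len_pos[of j] by (intro divide_right_mono) auto
        also have "\<dots> \<le> 4 * freq j * t"
        proof -
          \<comment> \<open>The steepness 3 / (4 len j) is at most 4 freq j because 2/9 >
            3/16.\<close>
          have "2/9 * 1 \<le> freq j * len j"
            using freq_len_ge[of j] N_rho_ge_1[OF j] by linarith
          then have "3 * t \<le> 16 * (freq j * len j) * t"
            using t by (intro mult_right_mono) auto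
          then show ?thesis
            using len_pos[of j] by (simp add: divide_le_eq mult_ac)
        qed
        finally show ?thesis .
      qed
      ultimately have "\<bar>\<bar>tri (freq j * x $ 1)\<bar> - 1/4\<bar> \<le> \<delta> \<or> \<bar>\<bar>tri (freq j * x $ 1)\<bar> - lev j (rad x)\<bar> \<le> \<delta>"
        using excess_slope_jump[OF x(2)] unfolding \<delta>_def by linarith
      then have "x \<in> ?D1 \<or> x \<in> ?D2"
        using x(1) ar by (auto simp: mem_cylinder)
      moreover have "?d \<le> 2"
        using abs_excess_slope_le(1)[of "freq j * ?y $ 1" "lev j (rad ?y)"] abs_excess_slope_le(1)[of "freq j * x $ 1" "lev j (rad x)"]
        by linarith
      then have "ennreal ?d \<le> ennreal 2"
        by (rule ennreal_leI)
      then have d: "ennreal ?d * indicator cylinder x \<le> ennreal 2"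
        using x(1) by simp
      ultimately show ?thesis
      proof (elim disjE)
        assume "x \<in> ?D1"
        then have "ennreal 2 \<le> ennreal 2 * indicator ?D1 x + ennreal 2 * indicator ?D2 x"
          by simp
        with d show ?thesis
          by (rule order_trans)
      next
        assume "x \<in> ?D2"
        then have "ennreal 2 \<le> ennreal 2 * indicator ?D1 x + ennreal 2 * indicator ?D2 x"
          by simp
        with d show ?thesis
          by (rule order_trans)
      qed
    qed (auto simp: indicator_def)
  qed
  also have "\<dots> = ennreal 2 * emeasure lebesgue ?D1 + ennreal 2 * emeasure lebesgue ?D2"
  proof -
    have D: "?D1 \<in> sets lebesgue" "?D2 \<in> sets lebesgue"
      by (rule sets_completionI_sets, simp only: sets_lborel m)+
    note i = borel_measurable_times_ennreal[OF borel_measurable_const borel_measurable_indicator]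
    show ?thesis
      unfolding nn_integral_add[OF i[OF D(1)] i[OF D(2)]] nn_integral_cmult_indicator[OF D(1)]
        nn_integral_cmult_indicator[OF D(2)] ..
  qed
  also have "\<dots> \<le> ennreal 2 * ennreal (20 * \<delta> * (pi * (1 - a))) + ennreal 2 * ennreal (20 * \<delta> * (pi * (1 - a)))"
    by (intro add_mono mult_left_mono m) auto
  also have "\<dots> = ennreal (80 * \<delta> * (pi * (1 - a)))"
  proof -
    have "20 * \<delta> * (pi * (1 - a)) \<ge> 0"
      using \<delta>0 a by simp
    then show ?thesis
      by (subst (1 2) ennreal_mult[symmetric], simp_all only: zero_le_numeral, subst ennreal_plus[symmetric]) simp_all
  qed
  also have "\<dots> \<le> ennreal (80 * \<delta> * (pi * (4 * (\<rho> / 3) ^ j)))"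
    using \<delta>0 a by (intro ennreal_leI mult_left_mono) auto
  also have "80 * \<delta> * (pi * (4 * (\<rho> / 3) ^ j)) = 1600 * pi * N * \<rho> ^ j * t"
    by (simp add: \<delta>_def freq_def power_divide)
  finally show ?thesis .
qed

text \<open>20 is half of the 40 in \<open>slope_variation\<close>, and 1 / (1 - \<rho>) sums the
  geometric series over the shells.\<close>

definition variation_const :: real
  where "variation_const = pi * N * (20 + 1600 / (1 - \<rho>))"

lemma e_variation:
  assumes t: "0 < t" "t < (\<rho> / 3) ^ J"
  shows "(\<integral>\<^sup>+x\<in>cylinder. ennreal \<bar>(1 + e (x - t *\<^sub>R axis k 1)) / 2 - (1 + e x) / 2\<bar> \<partial>lebesgue) \<le> ennreal (variation_const * t)"
proof -
  let ?s = "\<lambda>x. slope (N * (x - t *\<^sub>R axis k 1) $ 1) - slope (N * x $ 1)"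
  let ?d = "\<lambda>j x. excess_slope (freq j * (x - t *\<^sub>R axis k 1) $ 1) (lev j (rad (x - t *\<^sub>R axis k 1)))
      - excess_slope (freq j * x $ 1) (lev j (rad x))"
  have t1: "t < 1"
    using t(2) power_le_one[of "\<rho> / 3" J] rho by simp
  have sm: "(\<lambda>x::real^3. x - t *\<^sub>R axis k 1) \<in> borel_measurable borel"
    by simp
  have ms: "?s \<in> borel_measurable borel"
    using measurable_compose[OF sm measurable_slope[of N]] measurable_slope[of N] by measurable
  have mes: "(\<lambda>x. excess_slope (freq j * x $ 1) (lev j (rad x))) \<in> borel_measurable borel" for j
    by (rule measurable_excess_slope)
  have md: "?d j \<in> borel_measurable borel" for j
    using measurable_compose[OF sm mes[of j]] mes[of j] by measurable
  have "(\<integral>\<^sup>+x\<in>cylinder. ennreal \<bar>(1 + e (x - t *\<^sub>R axis k 1)) / 2 - (1 + e x) / 2\<bar> \<partial>lebesgue) \<le>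
     (\<integral>\<^sup>+x. ennreal (1/2) * (ennreal \<bar>?s x\<bar> * indicator cylinder x) + (\<Sum>j<J. ennreal \<bar>?d j x\<bar> * indicator cylinder x) \<partial>lebesgue)"
  proof (rule nn_integral_mono)
    fix x
    \<comment> \<open>The factor 1/2 cancels the 2 of the reflections.\<close>
    have "(1 + e (x - t *\<^sub>R axis k 1)) / 2 - (1 + e x) / 2 = 1/2 * ?s x - (\<Sum>j<J. ?d j x)"
      unfolding e_def by (simp add: sum_subtractf sum_distrib_left[symmetric] field_simps)
    then have "\<bar>(1 + e (x - t *\<^sub>R axis k 1)) / 2 - (1 + e x) / 2\<bar> \<le> \<bar>1/2 * ?s x\<bar> + \<bar>\<Sum>j<J. ?d j x\<bar>"
      by (simp only: abs_triangle_ineq4)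
    also have "\<bar>1/2 * ?s x\<bar> = 1/2 * \<bar>?s x\<bar>"
      by (simp add: abs_mult)
    also have "1/2 * \<bar>?s x\<bar> + \<bar>\<Sum>j<J. ?d j x\<bar> \<le> 1/2 * \<bar>?s x\<bar> + (\<Sum>j<J. \<bar>?d j x\<bar>)"
      by (rule add_left_mono[OF sum_abs])
    finally have "ennreal \<bar>(1 + e (x - t *\<^sub>R axis k 1)) / 2 - (1 + e x) / 2\<bar> \<le> ennreal (1/2 * \<bar>?s x\<bar> + (\<Sum>j<J. \<bar>?d j x\<bar>))"
      by (rule ennreal_leI)
    also have "\<dots> = ennreal (1/2) * ennreal \<bar>?s x\<bar> + (\<Sum>j<J. ennreal \<bar>?d j x\<bar>)"
    proof -
      have "ennreal (1/2 * \<bar>?s x\<bar> + (\<Sum>j<J. \<bar>?d j x\<bar>)) = ennreal (1/2 * \<bar>?s x\<bar>) + ennreal (\<Sum>j<J. \<bar>?d j x\<bar>)"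
        by (rule ennreal_plus) (auto intro: sum_nonneg)
      also have "ennreal (1/2 * \<bar>?s x\<bar>) = ennreal (1/2) * ennreal \<bar>?s x\<bar>"
        by (rule ennreal_mult) auto
      also have "ennreal (\<Sum>j<J. \<bar>?d j x\<bar>) = (\<Sum>j<J. ennreal \<bar>?d j x\<bar>)"
        by (rule sum_ennreal[symmetric]) simp
      finally show ?thesis .
    qed
    finally show "ennreal \<bar>(1 + e (x - t *\<^sub>R axis k 1)) / 2 - (1 + e x) / 2\<bar> * indicator cylinder x \<le>
       ennreal (1/2) * (ennreal \<bar>?s x\<bar> * indicator cylinder x) + (\<Sum>j<J. ennreal \<bar>?d j x\<bar> * indicator cylinder x)"
      by (cases "x \<in> cylinder") (simp only: indicator_simps mult_1_right, simp)
  qed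
  also have "\<dots> = ennreal (1/2) * (\<integral>\<^sup>+x\<in>cylinder. ennreal \<bar>?s x\<bar> \<partial>lebesgue) + (\<Sum>j<J. \<integral>\<^sup>+x\<in>cylinder. ennreal \<bar>?d j x\<bar> \<partial>lebesgue)"
  proof -
    have cyl: "cylinder \<in> sets lebesgue"
      by (rule sets_completionI_sets) (simp only: sets_lborel cylinder_sets)
    have m: "(\<lambda>x. ennreal \<bar>g x\<bar> * indicator cylinder x) \<in> borel_measurable lebesgue"
      if "g \<in> borel_measurable borel" for g :: "real^3 \<Rightarrow> real"
    proof -
      have "g \<in> borel_measurable lebesgue"
        by (rule measurable_completion) (simp only: measurable_lborel2 that)
      then show ?thesis
        using cyl by measurable
    qed
    note 1 = m[OF ms] and 2 = m[OF md]
    show ?thesis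
      unfolding nn_integral_add[OF borel_measurable_times_ennreal[OF borel_measurable_const 1] borel_measurable_sum[OF 2]]
        nn_integral_cmult[OF 1] nn_integral_sum[OF 2] ..
  qed
  also have "\<dots> \<le> ennreal (1/2) * ennreal (40 * pi * N * t) + (\<Sum>j<J. ennreal (1600 * pi * N * \<rho> ^ j * t))"
    by (intro add_mono mult_left_mono sum_mono slope_variation excess_slope_variation t t1) auto
  also have "\<dots> = ennreal (20 * pi * N * t + (\<Sum>j<J. 1600 * pi * N * \<rho> ^ j * t))"
  proof -
    have "ennreal (1/2) * ennreal (40 * pi * N * t) = ennreal (20 * pi * N * t)"
      using t by (subst ennreal_mult[symmetric]) (auto simp: mult_ac)
    moreover have "(\<Sum>j<J. ennreal (1600 * pi * N * \<rho> ^ j * t)) = ennreal (\<Sum>j<J. 1600 * pi * N * \<rho> ^ j * t)"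
      using t rho by (intro sum_ennreal) simp
    moreover have "ennreal (20 * pi * N * t + (\<Sum>j<J. 1600 * pi * N * \<rho> ^ j * t)) =
        ennreal (20 * pi * N * t) + ennreal (\<Sum>j<J. 1600 * pi * N * \<rho> ^ j * t)"
      using t rho by (intro ennreal_plus) (auto intro!: sum_nonneg)
    ultimately show ?thesis
      by (simp only:)
  qed
  also have "\<dots> \<le> ennreal (variation_const * t)"
  proof (rule ennreal_leI)
    have "(\<Sum>j<J. \<rho> ^ j) \<le> 1 / (1 - \<rho>)"
      using rho by (simp add: sum_gp_strict divide_right_mono)
    then have "1600 * pi * N * t * (\<Sum>j<J. \<rho> ^ j) \<le> 1600 * pi * N * t * (1 / (1 - \<rho>))"
      using t by (intro mult_left_mono) auto
    moreover have "(\<Sum>j<J. 1600 * pi * N * \<rho> ^ j * t) = 1600 * pi * N * t * (\<Sum>j<J. \<rho> ^ j)"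
      unfolding sum_distrib_left by (intro sum.cong) simp_all
    moreover have "variation_const * t = 20 * pi * N * t + 1600 * pi * N * t * (1 / (1 - \<rho>))"
      by (simp add: variation_const_def algebra_simps)
    ultimately show "20 * pi * N * t + (\<Sum>j<J. 1600 * pi * N * \<rho> ^ j * t) \<le> variation_const * t"
      by linarith
  qed
  finally show ?thesis .
qed

lemma variation_const_nonneg: "variation_const \<ge> 0"
  using rho by (simp add: variation_const_def)

text \<open>The restriction to small t depends on J, but the resulting constant does not. The factor
  3 is the dimension.\<close>

lemma total_variation_phase:
  "total_variation cylinder (\<lambda>x. if e x > 0 then 1 else 0) \<le> ennreal (3 * variation_const)"
proof -
  have "total_variation cylinder (\<lambda>x. if e x > 0 then 1 else 0) \<le> ennreal (real CARD(3) * variation_const)"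
  proof (rule total_variation_le[where f="\<lambda>x. (1 + e x) / 2" and \<tau>="(\<rho> / 3) ^ J"])
    show "(\<lambda>x. (1 + e x) / 2) \<in> borel_measurable lebesgue"
      using measurable_lebesgue_e by measurable
    show "(\<lambda>x. if e x > 0 then 1 else 0 :: real) \<in> borel_measurable lebesgue"
      using measurable_lebesgue_e by measurable
    \<comment> \<open>A crude bound that grows with J is harmless: it serves only local
      boundedness.\<close>
    have "\<bar>(1 + e x) / 2\<bar> \<le> 1 + J" for x
    proof -
      have "\<bar>\<Sum>j<J. 2 * excess_slope (freq j * x $ 1) (lev j (rad x))\<bar> \<le> (\<Sum>j<J. \<bar>2 * excess_slope (freq j * x $ 1) (lev j (rad x))\<bar>)"
        by (rule sum_abs)
      also have "\<dots> \<le> (\<Sum>j<J. 2)"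
        using abs_excess_slope_le(1) by (intro sum_mono) (simp add: abs_mult)
      finally show ?thesis
        using abs_excess_slope_le(2)[of "N * x $ 1"] by (simp add: e_def abs_le_iff)
    qed
    then show "locally_bounded (\<lambda>x. (1 + e x) / 2)"
      unfolding locally_bounded_def by blast
    show "AE x in lebesgue. x \<in> cylinder \<longrightarrow> (if e x > 0 then 1 else 0) = (1 + e x) / 2"
      using AE_regular by eventually_elim (use e_values in fastforce)
    show "cylinder \<in> sets lebesgue"
      using cylinder_sets by simp
    show "(\<rho> / 3) ^ J > 0"
      using rho by simp
  qed (use variation_const_nonneg e_variation in auto)
  then show ?thesis
    by simp
qed

section \<open>Admissibility and total energy\<close>

lemma X_BV: "X \<in> BV_into cylinder (wells ` {..1})"
proof -
  have cl: "cylinder \<in> sets lebesgue"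
    using cylinder_sets by simp
  have "(\<lambda>x. X x $ i $ k) \<in> BV cylinder" for i k
  proof -
    have m: "(\<lambda>x. X x $ i $ k) \<in> borel_measurable lebesgue"
      unfolding X_nth using measurable_lebesgue_e by measurable
    have "set_integrable lebesgue cylinder (\<lambda>x. X x $ i $ k)"
      unfolding set_integrable_def
    proof (rule Bochner_Integration.integrable_bound)
      show "integrable lebesgue (indicat_real cylinder)"
        using cl emeasure_cylinder_finite by (intro integrable_real_indicator)
      show "(\<lambda>x. indicat_real cylinder x *\<^sub>R X x $ i $ k) \<in> borel_measurable lebesgue"
        using m cl by (intro borel_measurable_scaleR borel_measurable_indicator)
      show "AE x in lebesgue. norm (indicat_real cylinder x *\<^sub>R X x $ i $ k) \<le> norm (indicat_real cylinder x)"
        by (auto simp: X_nth)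
    qed
    moreover have "total_variation cylinder (\<lambda>x. X x $ i $ k) < \<infinity>"
    proof (cases "i = 1 \<and> k = 1")
      case True
      then show ?thesis
        using total_variation_phase by (simp add: X_nth le_less_trans[OF _ ennreal_less_top])
    next
      case False
      then have z: "(\<lambda>x. X x $ i $ k) = (\<lambda>x. 0)"
        by (auto simp: X_nth)
      have "total_variation cylinder (\<lambda>x. 0) \<le> ennreal (real CARD(3) * 0)"
        by (rule total_variation_le[where f="\<lambda>_. 0" and \<tau>=1]) (use cl in \<open>auto simp: locally_bounded_def\<close>)
      then show ?thesis
        unfolding z by (simp add: le_less_trans)
    qed
    ultimately show ?thesis
      by (simp add: BV_def)
  qed
  then show ?thesis
    by (auto simp: BV_into_def X_def)
qed

lemma u_dirichlet:
  assumes "p \<ge> 0"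
  shows "u \<in> dirichlet_class p cylinder (diag (vector [1/2, 0, 0]))"
proof -
  have "u \<in> W1p_loc p"
    by (rule W1p_locI[OF u_weak_gradient[OF assms]])
  then show ?thesis
    unfolding dirichlet_class_def using u_boundary by (auto intro!: exI[of _ 0])
qed

lemma min_energy_le:
  assumes p: "p \<ge> 0" and "\<epsilon> \<ge> 0"
  shows "min_energy p \<epsilon> cylinder 1 wells (diag (vector [1/2, 0, 0])) \<le>
    ennreal (elastic_bound p + \<epsilon> * (3 * variation_const))"
proof -
  have ph: "phase wells X 1 = (\<lambda>x. if e x > 0 then 1 else 0)"
    using wells_neq by (auto simp: phase_def X_def fun_eq_iff)
  have "min_energy p \<epsilon> cylinder 1 wells (diag (vector [1/2, 0, 0])) \<le> energy p \<epsilon> cylinder 1 wells u X"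
    unfolding min_energy_def by (intro INF_lower2[OF X_BV] INF_lower u_dirichlet p)
  also have "\<dots> \<le> ennreal (elastic_bound p) + ennreal \<epsilon> * ennreal (3 * variation_const)"
    unfolding energy_def
    by (intro add_mono elastic_energy_le p mult_left_mono) (use total_variation_phase ph in auto)
  also have "\<dots> = ennreal (elastic_bound p + \<epsilon> * (3 * variation_const))"
    using assms rho variation_const_nonneg
    by (subst ennreal_plus) (auto simp: ennreal_mult elastic_bound_def intro!: sum_nonneg)
  finally show ?thesis .
qed

text \<open>With the given \<rho>, the factor 3^j from the strain and 3^(-j) from the volume cancel,
  which leaves the series of \<rho>^j. The assumption \<open>last\<close> says that J is maximal, so
  the last shell is thin enough to pay for its bounded energy density.\<close>

lemma elastic_sum_le:
  assumes p: "p \<ge> 1" and \<rho>p: "\<rho> powr (2 * p) = 1/3" and last: "N * \<rho> ^ Suc J < 1"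
  shows "elastic_bound p
    \<le> 400 powr p * pi * (1 / (1 - \<rho>) + 3) * real N powr (- (2 * p))"
proof -
  let ?A = "400 powr p * pi * real N powr (- (2 * p))"
  have pw: "(\<rho> ^ j) powr (2 * p) = (1/3) ^ j" for j
  proof -
    have "(\<rho> ^ j) powr (2 * p) = (\<rho> powr (2 * p)) ^ j"
      using rho by (simp add: powr_powr powr_realpow[symmetric] mult.commute)
    then show ?thesis
      by (simp add: \<rho>p)
  qed
  have "(400 * (1 / (N * \<rho> ^ j)\<^sup>2)) powr p * (pi * (\<rho> / 3) ^ j) = ?A * \<rho> ^ j" for j
  proof -
    have pos: "N * \<rho> ^ j > 0"
      using N rho by simp
    have "((N * \<rho> ^ j)\<^sup>2) powr p = (N * \<rho> ^ j) powr (2 * p)"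
      using pos by (simp add: powr_powr powr_numeral[symmetric] del: powr_numeral)
    also have "\<dots> = N powr (2 * p) * (1/3) ^ j"
      using rho by (simp add: powr_mult pw)
    finally have "(400 * (1 / (N * \<rho> ^ j)\<^sup>2)) powr p = 400 powr p / (N powr (2 * p) * (1/3) ^ j)"
      by (simp add: powr_divide)
    then show ?thesis
      using N by (simp add: powr_minus power_divide field_simps)
  qed
  then have "(\<Sum>j<J. (400 * (1 / (N * \<rho> ^ j)\<^sup>2)) powr p * (pi * (\<rho> / 3) ^ j)) = ?A * (\<Sum>j<J. \<rho> ^ j)"
    by (simp only: sum_distrib_left)
  also have "\<dots> \<le> ?A * (1 / (1 - \<rho>))"
  proof (rule mult_left_mono)
    show "(\<Sum>j<J. \<rho> ^ j) \<le> 1 / (1 - \<rho>)"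
      using rho by (simp add: sum_gp_strict divide_right_mono)
  qed simp
  finally have 1: "(\<Sum>j<J. (400 * (1 / (N * \<rho> ^ j)\<^sup>2)) powr p * (pi * (\<rho> / 3) ^ j)) \<le> ?A * (1 / (1 - \<rho>))" .
  \<comment> \<open>3^(-J) is rewritten as a power of \<rho>^J, which \<open>last\<close> bounds by
    1 / (N \<rho>).\<close>
  have "(\<rho> / 3) ^ J = \<rho> ^ J * (\<rho> ^ J) powr (2 * p)"
    by (simp add: pw power_divide)
  also have "\<dots> \<le> 1 * (1 / (N * \<rho>)) powr (2 * p)"
  proof (intro mult_mono powr_mono2)
    show "\<rho> ^ J \<le> 1 / (N * \<rho>)"
      using last N rho by (simp add: field_simps)
  qed (use p rho in \<open>auto simp: power_le_one\<close>)
  also have "\<dots> = 3 * real N powr (- (2 * p))"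
    using rho N by (simp add: powr_divide powr_mult \<rho>p powr_minus divide_simps)
  finally have "400 powr p * pi * (\<rho> / 3) ^ J \<le> 400 powr p * pi * (3 * real N powr (- (2 * p)))"
    by (intro mult_left_mono) auto
  moreover have "elastic_bound p =
      (\<Sum>j<J. (400 * (1 / (N * \<rho> ^ j)\<^sup>2)) powr p * (pi * (\<rho> / 3) ^ j)) + 400 powr p * pi * (\<rho> / 3) ^ J"
    unfolding elastic_bound_def lessThan_Suc_atMost[symmetric] sum.lessThan_Suc by simp
  moreover have "400 powr p * pi * (1 / (1 - \<rho>) + 3) * real N powr (- (2 * p)) =
      ?A * (1 / (1 - \<rho>)) + 400 powr p * pi * (3 * real N powr (- (2 * p)))"
    by (simp add: algebra_simps)
  ultimately show ?thesis
    using 1 by linarith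
qed

end

theorem proposition1p3:
  fixes p :: real
  assumes "p \<ge> 1"
  shows "\<exists>C::real. C > 0 \<and> (\<forall>\<epsilon>::real. 0 < \<epsilon> \<and> \<epsilon> < 1 \<longrightarrow>
    min_energy p \<epsilon> cylinder 1 wells (diag (vector [1/2, 0, 0]))
      \<le> ennreal (C * \<epsilon> powr (2 * p / (2 * p + 1))))"
proof -
  define \<rho> :: real where "\<rho> = 3 powr (- (1 / (2 * p)))"
  have \<rho>: "0 < \<rho>" "\<rho> < 1"
    using assms powr_less_mono[of "- (1 / (2 * p))" 0 3] by (auto simp: \<rho>_def)
  have \<rho>p: "\<rho> powr (2 * p) = 1/3"
  proof -
    have "\<rho> powr (2 * p) = 3 powr (- 1)"
      using assms unfolding \<rho>_def powr_powr by simp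
    then show ?thesis
      by (simp add: powr_minus)
  qed
  \<comment> \<open>B and D are the factors in \<open>elastic_sum_le\<close> and in 3 *
    \<open>variation_const\<close> once the powers of N are split off.\<close>
  define B where "B = 400 powr p * pi * (1 / (1 - \<rho>) + 3)"
  define D where "D = 3 * pi * (20 + 1600 / (1 - \<rho>))"
  have BD: "B > 0" "D > 0"
    using \<rho> by (auto simp: B_def D_def intro!: mult_pos_pos add_pos_pos)
  have "min_energy p \<epsilon> cylinder 1 wells (diag (vector [1/2, 0, 0])) \<le> ennreal ((B + 2 * D) * \<epsilon> powr (2 * p / (2 * p + 1)))"
    if \<epsilon>: "0 < \<epsilon>" "\<epsilon> < 1" for \<epsilon> :: real
  proof -
    \<comment> \<open>The solution of \<eta>^(-2p) = \<epsilon> \<eta>, the balance of the two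
      energies.\<close>
    define \<eta> where "\<eta> = \<epsilon> powr (- (1 / (2 * p + 1)))"
    define N where "N = nat \<lceil>\<eta>\<rceil>"
    \<comment> \<open>This uses \<epsilon> < 1; rounding \<eta> up then at most doubles it.\<close>
    have "\<eta> \<ge> 1"
      using powr_mono'[of "- (1 / (2 * p + 1))" 0 \<epsilon>] \<epsilon> assms by (simp add: \<eta>_def)
    then have N\<eta>: "\<eta> \<le> N" "N \<le> 2 * \<eta>" "N > 0"
      unfolding N_def by linarith+
    obtain n where "\<rho> ^ n < 1 / N"
      using real_arch_pow_inv[of "1 / N" \<rho>] \<rho> N\<eta> by auto
    then have n: "N * \<rho> ^ n < 1"
      using N\<eta> by (simp add: field_simps)
    \<comment> \<open>J is one less than the first n with \<open>N * \<rho> ^ n < 1\<close>, so that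
      N \<rho>^J \<ge> 1, as the locale demands, and N \<rho>^(J+1) < 1, as
      \<open>elastic_sum_le\<close> demands. N \<ge> 1 excludes n = 0.\<close>
    define m where "m = (LEAST n. N * \<rho> ^ n < 1)"
    have m: "N * \<rho> ^ m < 1"
      unfolding m_def by (rule LeastI[of "\<lambda>n. N * \<rho> ^ n < 1", OF n])
    then have "m \<noteq> 0"
      using N\<eta> by (intro notI) simp
    then obtain J where mJ: "m = Suc J"
      by (cases m) auto
    have "\<not> N * \<rho> ^ J < 1"
      using not_less_Least[of J "\<lambda>n. N * \<rho> ^ n < 1"] mJ by (simp add: m_def)
    then interpret branching \<rho> N J
      by unfold_locales (use \<rho> N\<eta> in auto)
    have N2: "real N powr (- (2 * p)) \<le> \<epsilon> powr (2 * p / (2 * p + 1))"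
    proof -
      have "real N powr (- (2 * p)) \<le> \<eta> powr (- (2 * p))"
        by (rule powr_mono2') (use N\<eta>(1) \<open>\<eta> \<ge> 1\<close> assms in auto)
      also have "\<dots> = \<epsilon> powr (2 * p / (2 * p + 1))"
        by (simp add: \<eta>_def powr_powr)
      finally show ?thesis .
    qed
    have N1: "\<epsilon> * N \<le> 2 * \<epsilon> powr (2 * p / (2 * p + 1))"
    proof -
      have "\<epsilon> * N \<le> 2 * (\<epsilon> * \<eta>)"
        using N\<eta> \<epsilon> by simp
      also have "\<epsilon> * \<eta> = \<epsilon> powr (1 + - (1 / (2 * p + 1)))"
        using \<epsilon> powr_add[of \<epsilon> 1 "- (1 / (2 * p + 1))"] by (simp add: \<eta>_def)
      also have "1 + - (1 / (2 * p + 1)) = 2 * p / (2 * p + 1)"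
        using assms by (simp add: field_simps)
      finally show ?thesis .
    qed
    have "min_energy p \<epsilon> cylinder 1 wells (diag (vector [1/2, 0, 0])) \<le>
      ennreal (elastic_bound p + \<epsilon> * (3 * variation_const))"
      using assms \<epsilon> by (intro min_energy_le) auto
    also have "\<dots> \<le> ennreal ((B + 2 * D) * \<epsilon> powr (2 * p / (2 * p + 1)))"
    proof (rule ennreal_leI)
      have "elastic_bound p \<le> B * real N powr (- (2 * p))"
        unfolding B_def by (rule elastic_sum_le[OF assms \<rho>p]) (use m mJ in simp)
      also have "\<dots> \<le> B * \<epsilon> powr (2 * p / (2 * p + 1))"
        using BD N2 by (intro mult_left_mono) auto
      finally have "elastic_bound p \<le> B * \<epsilon> powr (2 * p / (2 * p + 1))" .
      moreover have "\<epsilon> * (3 * variation_const) = D * (\<epsilon> * N)"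
        by (simp add: variation_const_def D_def)
      moreover have "D * (\<epsilon> * N) \<le> D * (2 * \<epsilon> powr (2 * p / (2 * p + 1)))"
        using BD N1 by (intro mult_left_mono) auto
      ultimately show "elastic_bound p + \<epsilon> * (3 * variation_const)
          \<le> (B + 2 * D) * \<epsilon> powr (2 * p / (2 * p + 1))"
        unfolding distrib_right by linarith
    qed
    finally show ?thesis .
  qed
  then show ?thesis
    using BD by (intro exI[of _ "B + 2 * D"]) auto
qed

end
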